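(* Let $n\ge 3$, $1<p<\infty$, and let $c_1,c_2\ge 0$ be not both zero. For $K\in\mathcal{K}^n_{\mathrm{o}}$ let $\Psi_pK=c_1\cdot\mathrm{M}_p^+K+_p c_2\cdot\mathrm{M}_p^-K$. Then for every $K\in\mathcal{K}^n_{\mathrm{o}}$, $$V(K)^{n/p+1}\,V(\Psi_p^sK)\le V(B)^{n/p+1}\,V(\Psi_p^sB),$$ with equality if and only if $K$ is an ellipsoid centered at the origin.
   Context: $\mathcal{K}^n_{\mathrm{o}}$ is the set of convex bodies (compact convex sets) in $\mathbb{R}^n$ containing the origin in their interiors; $V$ is volume; $B$ is the Euclidean unit ball. The support function is $h(K,x)=\max\{x\cdot y: y\in K\}$ and the radial function is $\rho(K,x)=\max\{\lambda\ge0:\lambda x\in K\}$, $x\ne0$. The polar body is $K^*=\{x\in\mathbb{R}^n: x\cdot y\le 1 \text{ for all } y\in K\}$. For $K\in\mathcal{K}^n_{\mathrm{o}}$, the Santaló point $s$ of $K$ is the unique point $s\in\mathrm{int}\,K$ minimizing $V((K-x)^* )$ over $x\in\mathrm{int}\,K$, and $K^s:=(K-s)^*$ is the polar body of $K$ with respect to its Santaló point. Write $\Psi_p^sK:=(\Psi_pK)^s$ (the polar of $\Psi_pK$ with respect to the Santaló point of $\Psi_pK$). The $L_p$ Minkowski combination $\alpha\cdot K+_p\beta\cdot L$ ($\alpha,\beta\ge0$ not both zero) is the convex body with $h(\alpha\cdot K+_p\beta\cdot L,\cdot)^p=\alpha h(K,\cdot)^p+\beta h(L,\cdot)^p$. Let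 $c_{n,p}=\dfrac{\Gamma\left(\frac{n+p}{2}\right)}{\pi^{(n-1)/2}\,\Gamma\left(\frac{1+p}{2}\right)}$ and $(s)_+=\max\{s,0\}$. The nonsymmetric $L_p$ moment body $\mathrm{M}_p^+K$ is the convex body with $$h(\mathrm{M}_p^+K,u)^p=c_{n,p}\int_{S^{n-1}}(u\cdot v)_+^p\,\rho(K,v)^{n+p}\,dv=c_{n,p}(n+p)\int_K(u\cdot x)_+^p\,dx,\qquad u\in S^{n-1},$$ where $dv$ is spherical Lebesgue measure, and $\mathrm{M}_p^-K=\mathrm{M}_p^+(-K)$. *)

theory Defs
  imports "HOL-Analysis.Analysis"
begin

text \<open>Compact convex sets with the origin in their interior, in a Euclidean space of
  dimension \<open>n = DIM('a)\<close>.\<close>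

definition convex_bodies_o :: "'a::euclidean_space set set" where
  "convex_bodies_o = {K. compact K \<and> convex K \<and> 0 \<in> interior K}"

text \<open>Only meaningful for nonempty compact sets, where the supremum is a maximum.\<close>

definition support_fun :: "'a::euclidean_space set \<Rightarrow> 'a \<Rightarrow> real" where
  "support_fun K x = (SUP y\<in>K. x \<bullet> y)"

abbreviation vol :: "'a::euclidean_space set \<Rightarrow> real" where
  "vol K \<equiv> measure lebesgue K"

definition polar :: "'a::euclidean_space set \<Rightarrow> 'a set" where
  "polar K = {x. \<forall>y\<in>K. x \<bullet> y \<le> 1}"

definition polar_wrt :: "'a::euclidean_space set \<Rightarrow> 'a \<Rightarrow> 'a set" where
  "polar_wrt K x = polar ((\<lambda>y. y - x) ` K)"

definition santalo_point :: "'a::euclidean_space set \<Rightarrow> 'a" where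
  "santalo_point K =
     (THE s. s \<in> interior K \<and> (\<forall>x\<in>interior K. vol (polar_wrt K s) \<le> vol (polar_wrt K x)))"

definition santalo_polar :: "'a::euclidean_space set \<Rightarrow> 'a set" where
  "santalo_polar K = polar_wrt K (santalo_point K)"

text \<open>The convex body \<open>M\<close> with \<open>h(M,u)\<^sup>p = F u\<close> on the unit sphere. Requiring the origin
  in the interior makes \<open>h(M,u) > 0\<close>, so that the real power is the intended one.
  In both uses below \<open>F > 0\<close> on the sphere, for bodies in \<^const>\<open>convex_bodies_o\<close>, so that
  every convex body with nonnegative support function satisfying the equation
  has the origin in its interior.\<close>

definition body_with_support_pow :: "real \<Rightarrow> ('a::euclidean_space \<Rightarrow> real) \<Rightarrow> 'a set" where
  "body_with_support_pow p F =
     (THE M. M \<in> convex_bodies_o \<and> (\<forall>u\<in>sphere 0 1. support_fun M u powr p = F u))"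

definition Lp_comb ::
  "real \<Rightarrow> real \<Rightarrow> 'a::euclidean_space set \<Rightarrow> real \<Rightarrow> 'a set \<Rightarrow> 'a set" where
  "Lp_comb p \<alpha> K \<beta> L =
     body_with_support_pow p (\<lambda>u. \<alpha> * support_fun K u powr p + \<beta> * support_fun L u powr p)"

definition c_np :: "nat \<Rightarrow> real \<Rightarrow> real" where
  "c_np n p = Gamma ((real n + p) / 2) / (pi powr ((real n - 1) / 2) * Gamma ((1 + p) / 2))"

text \<open>The moment bodies, by the volume integral form of the support function; the spherical
  form is this integral in polar coordinates.\<close>

definition moment_body_plus :: "real \<Rightarrow> 'a::euclidean_space set \<Rightarrow> 'a set" where
  "moment_body_plus p K =
     body_with_support_pow p
       (\<lambda>u. c_np DIM('a) p * (real DIM('a) + p) *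
            (LINT x:K|lebesgue. max 0 (u \<bullet> x) powr p))"

definition moment_body_minus :: "real \<Rightarrow> 'a::euclidean_space set \<Rightarrow> 'a set" where
  "moment_body_minus p K = moment_body_plus p (uminus ` K)"

definition Psi :: "real \<Rightarrow> real \<Rightarrow> real \<Rightarrow> 'a::euclidean_space set \<Rightarrow> 'a set" where
  "Psi p c1 c2 K = Lp_comb p c1 (moment_body_plus p K) c2 (moment_body_minus p K)"

definition centered_ellipsoid :: "'a::euclidean_space set \<Rightarrow> bool" where
  "centered_ellipsoid E \<longleftrightarrow> (\<exists>f :: 'a \<Rightarrow> 'a. linear f \<and> bij f \<and> E = f ` cball 0 1)"

end

theory Submission
  imports Defs "HOL-Complex_Analysis.Great_Picard"
begin

text \<open>
  The proof is by Steiner symmetrization. Up to constants the body \<open>\<Psi> = \<Psi>\<^sub>p K\<close> has the support function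
  \<open>h u = (\<integral>x\<in>K. N (u \<bullet> x) powr p) powr (1 / p)\<close>, called \<open>moment_norm\<close>, where \<open>N\<close> is an
  asymmetric absolute value (\<open>Psi_eq_moment_body\<close>). The polar of \<open>\<Psi>\<close> with respect to \<open>x\<close> is the set
  \<open>h y - x \<bullet> y \<le> 1\<close>.

  Symmetrization of \<open>K\<close> in a direction \<open>k\<close> preserves the volume and does not decrease the Santalo
  volume of \<open>\<Psi>\<close>, the volume of its polar with respect to the Santalo point
  (\<open>santalo_volume_steiner\<close>). On each chord of \<open>K\<close> in the direction \<open>k\<close> the triangle inequality for
  \<open>N\<close> gives, after integration and for \<open>z1\<close> and \<open>z2\<close> orthogonal to \<open>k\<close>, the inequality
  \<open>h\<^sub>S ((z1 + z2) / 2 + k) \<le> (h (z1 + k) + h (z2 - k)) / 2\<close> between the functions for the symmetrized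
  and the original body (\<open>moment_norm_steiner_le\<close>). This is the hypothesis of the
  Borell--Brascamp--Lieb inequality with exponent \<open>- 1 / n\<close>, on a space of dimension \<open>n - 1\<close>, for the
  \<open>n\<close>-th powers of the radial functions of the polars. The result is that a half of the polar for the
  symmetrized body is at least the harmonic mean of the two halves, on either side of the hyperplane
  orthogonal to \<open>k\<close>, of the polar for the original one. A harmonic mean is useful only if the two
  halves are equal. Moving the base point along \<open>k\<close> achieves this (\<open>equal_half_volumes\<close>), and it costs
  nothing since the Santalo point minimizes the volume. Existence and uniqueness of the Santalo point
  and the behaviour of the half volumes come from writing them as integrals of \<open>exp (x \<bullet> y - h y)\<close>.
  If equality holds in the end, it holds in the triangle inequality for \<open>N\<close> on almost all chords.
  Since \<open>N\<close> has a kink at \<open>0\<close>, the midpoints of the chords in the direction \<open>k\<close> then lie on a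
  hyperplane.

  The inequality and its equality case follow by an extremal argument, without any convergence of
  iterated symmetrizations. The product of volumes is linearly invariant. Symmetrizing in all
  coordinate directions and rescaling the axes moves any body between two fixed balls without
  decreasing the product, and so by compactness a maximizer exists (\<open>maximizer_exists\<close>). For a
  maximizer every symmetrization is an equality case, so it is invariant under an oblique reflection
  in every direction. In isotropic position these reflections are orthogonal, and the body is a ball
  (\<open>reflection_rich_ellipsoid\<close>). So every maximizer is a centered ellipsoid. By linear invariance all
  centered ellipsoids have the same product as the unit ball, which is therefore the maximum.
\<close>

section \<open>Lebesgue measure on coordinate subspaces\<close>

text \<open>Lebesgue measure on the span of \<open>J\<close>, kept as a measure on the whole space, so that an induction
  over \<open>J\<close> stays in one type and hyperplane integrals apply to functions on the ambient space.\<close>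

definition coord_lborel :: "'a::euclidean_space set \<Rightarrow> 'a measure" where
  "coord_lborel J = distr (\<Pi>\<^sub>M b\<in>J. (lborel :: real measure)) borel (\<lambda>f. \<Sum>b\<in>J. f b *\<^sub>R b)"

lemma sets_coord_lborel [measurable_cong, simp]: "sets (coord_lborel J) = sets borel"
  and space_coord_lborel [simp]: "space (coord_lborel J) = UNIV"
  by (simp_all add: coord_lborel_def)

lemma coord_lborel_Basis: "coord_lborel Basis = (lborel :: 'a::euclidean_space measure)"
  unfolding coord_lborel_def by (subst (2) lborel_def) (simp add: lborel_eq_real)

interpretation PS: product_sigma_finite "\<lambda>_::'a. lborel :: real measure"
  by standard

lemma nn_integral_coord_lborel_empty:
  "f \<in> borel_measurable borel \<Longrightarrow> (\<integral>\<^sup>+y. f y \<partial>coord_lborel {}) = f 0"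
  by (simp add: coord_lborel_def nn_integral_distr PS.nn_integral_empty del: nn_integral_const)

lemma nn_integral_coord_lborel_insert:
  fixes f :: "'a::euclidean_space \<Rightarrow> ennreal"
  assumes "finite J" "k \<notin> J" and [measurable]: "f \<in> borel_measurable borel"
  shows "(\<integral>\<^sup>+x. f x \<partial>coord_lborel (insert k J)) = (\<integral>\<^sup>+y. (\<integral>\<^sup>+t. f (y + t *\<^sub>R k) \<partial>lborel) \<partial>coord_lborel J)"
proof -
  have "(\<integral>\<^sup>+x. f x \<partial>coord_lborel (insert k J))
      = (\<integral>\<^sup>+y. (\<integral>\<^sup>+t. f (\<Sum>b\<in>insert k J. (y(k:=t)) b *\<^sub>R b) \<partial>lborel) \<partial>(\<Pi>\<^sub>M b\<in>J. lborel))"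
    unfolding coord_lborel_def
    by (subst nn_integral_distr, simp, simp, subst PS.product_nn_integral_insert) (use assms in auto)
  also have "\<dots> = (\<integral>\<^sup>+y. (\<integral>\<^sup>+t. f ((\<Sum>b\<in>J. y b *\<^sub>R b) + t *\<^sub>R k) \<partial>lborel) \<partial>(\<Pi>\<^sub>M b\<in>J. lborel))"
  proof -
    have "(\<Sum>b\<in>insert k J. (y(k:=t)) b *\<^sub>R b) = (\<Sum>b\<in>J. y b *\<^sub>R b) + t *\<^sub>R k" for y t
    proof -
      have "(\<Sum>b\<in>J. (y(k:=t)) b *\<^sub>R b) = (\<Sum>b\<in>J. y b *\<^sub>R b)"
        using assms by (intro sum.cong) auto
      then show ?thesis using assms by (simp add: add.commute)
    qed
    then show ?thesis by (simp del: fun_upd_apply)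
  qed
  also have "\<dots> = (\<integral>\<^sup>+y. (\<integral>\<^sup>+t. f (y + t *\<^sub>R k) \<partial>lborel) \<partial>coord_lborel J)"
    unfolding coord_lborel_def by (subst nn_integral_distr) auto
  finally show ?thesis .
qed

lemma sigma_finite_coord_lborel:
  assumes "finite J" "J \<subseteq> (Basis :: 'a::euclidean_space set)"
  shows "sigma_finite_measure (coord_lborel J)"
proof -
  let ?P = "\<Pi>\<^sub>M b\<in>J. (lborel :: real measure)"
  let ?g = "\<lambda>f. \<Sum>b\<in>J. f b *\<^sub>R (b::'a)"
  let ?A = "\<lambda>n::nat. {x::'a. \<forall>b\<in>J. \<bar>x \<bullet> b\<bar> \<le> real n}"
  have meas: "?A n \<in> sets borel" for n
  proof -
    have "closed (\<Inter>b\<in>J. {x::'a. \<bar>x \<bullet> b\<bar> \<le> real n})"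
      by (intro closed_INT ballI closed_Collect_le continuous_intros)
    also have "(\<Inter>b\<in>J. {x::'a. \<bar>x \<bullet> b\<bar> \<le> real n}) = ?A n" by auto
    finally show ?thesis by simp
  qed
  have fin: "emeasure (coord_lborel J) (?A n) \<noteq> \<infinity>" for n
  proof -
    have "emeasure (coord_lborel J) (?A n) = emeasure ?P (?g -` ?A n \<inter> space ?P)"
      unfolding coord_lborel_def using meas by (intro emeasure_distr) auto
    also have "\<dots> \<le> emeasure ?P (\<Pi>\<^sub>E b\<in>J. {- real n..real n})"
    proof (rule emeasure_mono)
      have coord: "f b = (\<Sum>c\<in>J. f c *\<^sub>R c) \<bullet> b" if "b \<in> J" for f b
      proof -
        have "(\<Sum>c\<in>J. f c *\<^sub>R c) \<bullet> b = (\<Sum>c\<in>J. if c = b then f c else 0)"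
          unfolding inner_sum_left using assms that
          by (intro sum.cong) (auto simp: inner_not_same_Basis subset_iff)
        then show ?thesis using assms that by simp
      qed
      show "?g -` ?A n \<inter> space ?P \<subseteq> (\<Pi>\<^sub>E b\<in>J. {- real n..real n})"
      proof
        fix f assume f: "f \<in> ?g -` ?A n \<inter> space ?P"
        show "f \<in> (\<Pi>\<^sub>E b\<in>J. {- real n..real n})"
        proof (rule PiE_I)
          fix b assume b: "b \<in> J"
          then have "\<bar>?g f \<bullet> b\<bar> \<le> real n" using f by blast
          then show "f b \<in> {- real n..real n}" by (simp only: coord[OF b, symmetric]) (simp add: abs_le_iff)
        next
          fix b assume "b \<notin> J"
          have "f \<in> space ?P" using f by (rule IntD2)
          then have "f \<in> J \<rightarrow>\<^sub>E UNIV" by (simp add: space_PiM)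
          then show "f b = undefined" using \<open>b \<notin> J\<close> by (rule PiE_arb)
        qed
      qed
    qed (use assms in \<open>auto intro!: sets_PiM_I_finite\<close>)
    also have "\<dots> = (\<Prod>b\<in>J. emeasure lborel {- real n..real n})"
      using assms by (intro PS.emeasure_PiM) auto
    also have "\<dots> < \<infinity>"
      by (simp add: ennreal_power)
    finally show ?thesis by simp
  qed
  have cover: "\<exists>n. x \<in> ?A n" for x
  proof -
    obtain n where n: "norm x \<le> real n" using real_arch_simple by blast
    have "\<bar>x \<bullet> b\<bar> \<le> real n" if "b \<in> J" for b
      using Basis_le_norm[of b x] assms that n by force
    then show ?thesis by blast
  qed
  show ?thesis
    by standard (rule exI[of _ "range ?A"], use fin meas cover in \<open>auto simp del: infinity_ennreal_def\<close>)
qed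

lemma coord_lborel_scale:
  fixes f :: "'a::euclidean_space \<Rightarrow> ennreal"
  assumes "finite J" "f \<in> borel_measurable borel" "0 < c"
  shows "(\<integral>\<^sup>+y. f y \<partial>coord_lborel J) = ennreal (c ^ card J) * (\<integral>\<^sup>+y. f (c *\<^sub>R y) \<partial>coord_lborel J)"
  using assms(1,2)
proof (induction J arbitrary: f rule: finite_induct)
  case empty
  then show ?case by (simp add: nn_integral_coord_lborel_empty)
next
  case (insert k J)
  note [measurable] = insert.prems
  have m: "(\<lambda>y. \<integral>\<^sup>+t. f (c *\<^sub>R (y + t *\<^sub>R k)) \<partial>lborel) \<in> borel_measurable (coord_lborel J)"
    by measurable
  have "(\<integral>\<^sup>+y. f y \<partial>coord_lborel (insert k J)) = (\<integral>\<^sup>+y. (\<integral>\<^sup>+t. f (y + t *\<^sub>R k) \<partial>lborel) \<partial>coord_lborel J)"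
    using insert.hyps insert.prems by (intro nn_integral_coord_lborel_insert) auto
  also have "\<dots> = ennreal (c ^ card J) * (\<integral>\<^sup>+y. (\<integral>\<^sup>+t. f (c *\<^sub>R y + t *\<^sub>R k) \<partial>lborel) \<partial>coord_lborel J)"
    by (rule insert.IH) measurable
  also have "\<dots> = ennreal (c ^ card J) * (\<integral>\<^sup>+y. ennreal c * (\<integral>\<^sup>+t. f (c *\<^sub>R (y + t *\<^sub>R k)) \<partial>lborel) \<partial>coord_lborel J)"
    by (subst nn_integral_real_affine[where c=c and t=0])
       (use \<open>0 < c\<close> in \<open>auto simp: scaleR_add_right\<close>)
  also have "\<dots> = ennreal (c ^ card J) * (ennreal c * (\<integral>\<^sup>+y. (\<integral>\<^sup>+t. f (c *\<^sub>R (y + t *\<^sub>R k)) \<partial>lborel) \<partial>coord_lborel J))"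
    by (subst nn_integral_cmult[OF m]) (rule refl)
  also have "\<dots> = ennreal (c ^ card (insert k J)) * (\<integral>\<^sup>+y. (\<integral>\<^sup>+t. f (c *\<^sub>R (y + t *\<^sub>R k)) \<partial>lborel) \<partial>coord_lborel J)"
  proof -
    have "ennreal (c ^ card (insert k J)) = ennreal (c ^ card J) * ennreal c"
      using insert.hyps \<open>0 < c\<close> by (simp add: ennreal_mult[symmetric] mult.commute)
    then show ?thesis by (simp only: mult.assoc)
  qed
  also have "(\<integral>\<^sup>+y. (\<integral>\<^sup>+t. f (c *\<^sub>R (y + t *\<^sub>R k)) \<partial>lborel) \<partial>coord_lborel J)
     = (\<integral>\<^sup>+y. f (c *\<^sub>R y) \<partial>coord_lborel (insert k J))"
    using insert.hyps by (subst nn_integral_coord_lborel_insert) auto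
  finally show ?case .
qed

lemma AE_coord_lborel_orthogonal:
  assumes "J \<subseteq> Basis" "k \<in> Basis" "k \<notin> J"
  shows "AE y in coord_lborel J. y \<bullet> (k::'a::euclidean_space) = 0"
  unfolding coord_lborel_def
proof (subst AE_distr_iff)
  have "closed {y::'a. y \<bullet> k = 0}" by (intro closed_Collect_eq continuous_intros)
  then show "{y \<in> space borel. y \<bullet> k = 0} \<in> sets borel" by simp
  have "(\<Sum>b\<in>J. f b *\<^sub>R b) \<bullet> k = 0" for f
    unfolding inner_sum_left using assms
    by (intro sum.neutral) (metis inner_Basis inner_scaleR_left mult_zero_right subsetD)
  then show "AE f in (\<Pi>\<^sub>M b\<in>J. lborel). (\<Sum>b\<in>J. f b *\<^sub>R b) \<bullet> k = 0" by simp
qed simp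

section \<open>The Borell--Brascamp--Lieb inequality\<close>

text \<open>The cut point is taken in \<open>A\<close> itself, although the supremum of \<open>A\<close> may be missing from \<open>A\<close> or
  infinite; this is what the translation argument in \<open>brunn_minkowski_real\<close> needs.\<close>

lemma emeasure_atMost_approx:
  fixes A :: "real set"
  assumes [measurable]: "A \<in> sets borel" and "A \<noteq> {}" and m: "m < emeasure lborel A"
  shows "\<exists>p\<in>A. m < emeasure lborel (A \<inter> {..p})"
proof (cases "\<exists>p\<in>A. \<forall>x\<in>A. x \<le> p")
  case True
  then obtain p where p: "p \<in> A" "\<forall>x\<in>A. x \<le> p" by blast
  then have "A \<inter> {..p} = A" by auto
  then show ?thesis using p m by (intro bexI[of _ p]) simp_all
next
  case False
  have "\<exists>s::nat \<Rightarrow> real. range s \<subseteq> A \<and> (\<forall>x\<in>A. \<exists>n. x \<le> s n)"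
  proof (cases "bdd_above A")
    case True
    have "\<exists>y\<in>A. Sup A - 1 / real (Suc n) < y" for n
      by (rule less_cSupD) (use \<open>A \<noteq> {}\<close> in auto)
    then obtain s where s: "\<And>n. s n \<in> A" "\<And>n. Sup A - 1 / real (Suc n) < s n" by metis
    have "\<exists>n. x \<le> s n" if "x \<in> A" for x
    proof -
      obtain y where "y \<in> A" "x < y" using False \<open>x \<in> A\<close> by (meson not_le)
      then have "x < Sup A" using cSup_upper[OF _ True, of y] by linarith
      then obtain n where "inverse (real (Suc n)) < Sup A - x" using reals_Archimedean[of "Sup A - x"] by auto
      then have "x \<le> s n" using s(2)[of n] by (simp add: inverse_eq_divide)
      then show ?thesis ..
    qed
    then show ?thesis using s by blast
  next
    case False
    then have "\<exists>y\<in>A. real n < y" for n by (meson bdd_above.I not_le)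
    then obtain s where s: "\<And>n. s n \<in> A" "\<And>n. real n < s n" by metis
    have "\<exists>n. x \<le> s n" for x using real_arch_simple[of x] s(2) by (meson less_imp_le order_trans)
    then show ?thesis using s by blast
  qed
  then obtain s where s: "range s \<subseteq> A" "\<And>x. x \<in> A \<Longrightarrow> \<exists>n::nat. x \<le> s n" by blast
  define B where "B n = (\<Union>i\<le>n. A \<inter> {..s i})" for n
  have "incseq B" unfolding B_def incseq_def by (meson SUP_subset_mono atMost_subset_iff order_refl)
  have "(\<Union>n. B n) = A"
  proof
    show "A \<subseteq> (\<Union>n. B n)"
    proof
      fix x assume "x \<in> A"
      with s(2) obtain n where "x \<le> s n" by blast
      with \<open>x \<in> A\<close> show "x \<in> (\<Union>n. B n)" unfolding B_def by blast
    qed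
  qed (auto simp: B_def)
  have "(SUP n. emeasure lborel (B n)) = emeasure lborel A"
    using \<open>(\<Union>n. B n) = A\<close> \<open>incseq B\<close> by (subst SUP_emeasure_incseq) (auto simp: B_def)
  then obtain n where n: "m < emeasure lborel (B n)" using m by (metis less_SUP_iff)
  have "Max (s ` {..n}) \<in> s ` {..n}" by (intro Max_in) auto
  then obtain i where i: "Max (s ` {..n}) = s i" by (rule imageE)
  have "s j \<le> s i" if "j \<le> n" for j unfolding i[symmetric] using that by (intro Max_ge) auto
  then have "B n \<subseteq> A \<inter> {..s i}" unfolding B_def by (force intro: order_trans)
  then have "emeasure lborel (B n) \<le> emeasure lborel (A \<inter> {..s i})"
    by (intro emeasure_mono) auto
  then have "m < emeasure lborel (A \<inter> {..s i})"
    using n by (rule less_le_trans[rotated])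
  then show ?thesis using s(1) by blast
qed

lemma emeasure_lborel_uminus:
  fixes A :: "real set"
  assumes [measurable]: "A \<in> sets borel"
  shows "emeasure lborel (uminus -` A) = emeasure lborel A"
proof -
  have "emeasure lborel A = (\<integral>\<^sup>+x. indicator A x \<partial>lborel)" by simp
  also have "\<dots> = (\<integral>\<^sup>+x. indicator A (- x) \<partial>lborel)"
    by (subst nn_integral_real_affine[where c="-1" and t=0]) auto
  also have "\<dots> = (\<integral>\<^sup>+x. indicator (uminus -` A) x \<partial>lborel)"
    by (intro nn_integral_cong) (auto simp: indicator_def)
  also have "\<dots> = emeasure lborel (uminus -` A)"
    by (intro nn_integral_indicator) (use measurable_sets[of uminus borel borel A] in auto)
  finally show ?thesis ..
qed

lemma emeasure_atLeast_approx:
  fixes A :: "real set"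
  assumes [measurable]: "A \<in> sets borel" and "A \<noteq> {}" and m: "m < emeasure lborel A"
  shows "\<exists>p\<in>A. m < emeasure lborel (A \<inter> {p..})"
proof -
  have "uminus -` A \<noteq> {}" using assms(2) by (metis ex_in_conv minus_minus vimage_eq)
  moreover have "uminus -` A \<in> sets borel" using measurable_sets[of uminus borel borel A] assms(1) by auto
  ultimately obtain p where p: "- p \<in> A" "m < emeasure lborel (uminus -` A \<inter> {..p})"
    using emeasure_atMost_approx[of "uminus -` A" m] m emeasure_lborel_uminus[of A] by auto
  have "uminus -` A \<inter> {..p} = uminus -` (A \<inter> {-p..})" by auto
  then have "m < emeasure lborel (A \<inter> {-p..})" using p emeasure_lborel_uminus[of "A \<inter> {-p..}"] by simp
  then show ?thesis using p by blast
qed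

lemma emeasure_real_affine_image:
  fixes A :: "real set"
  assumes [measurable]: "A \<in> sets borel"
  shows "emeasure lborel ((\<lambda>x. 2 * x + c) -` A) = emeasure lborel A / 2"
proof -
  have "emeasure lborel A = (\<integral>\<^sup>+x. indicator A x \<partial>lborel)" by simp
  also have "\<dots> = 2 * (\<integral>\<^sup>+x. indicator A (c + 2 * x) \<partial>lborel)"
    by (subst nn_integral_real_affine[where c="2" and t=c]) auto
  also have "(\<integral>\<^sup>+x. indicator A (c + 2 * x) \<partial>lborel) = (\<integral>\<^sup>+x. indicator ((\<lambda>x. 2 * x + c) -` A) x \<partial>lborel)"
    by (intro nn_integral_cong) (auto simp: indicator_def add.commute)
  also have "\<dots> = emeasure lborel ((\<lambda>x. 2 * x + c) -` A)"
    by (intro nn_integral_indicator) (use measurable_sets[of "\<lambda>x. 2 * x + c" borel borel A] in auto)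
  finally have "emeasure lborel A = emeasure lborel ((\<lambda>x. 2 * x + c) -` A) * 2" by (simp only: mult.commute)
  then show ?thesis using ennreal_mult_divide_eq[of 2 "emeasure lborel ((\<lambda>x. 2 * x + c) -` A)"] by simp
qed

lemma ennreal_add_le_dense:
  fixes a y D :: ennreal
  assumes "\<And>z. z = 0 \<or> z < a \<Longrightarrow> z + y \<le> D"
  shows "a + y \<le> D"
proof -
  have "a \<le> (SUP z\<in>{z. z = 0 \<or> z < a}. z)"
    by (rule dense_le, rule SUP_upper) simp
  then have "a + y \<le> (SUP z\<in>{z. z = 0 \<or> z < a}. z) + y" by (rule add_right_mono)
  also have "\<dots> = (SUP z\<in>{z. z = 0 \<or> z < a}. z + y)"
    by (rule ennreal_SUP_add_left[symmetric]) blast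
  also have "\<dots> \<le> D" using assms by (intro SUP_least) auto
  finally show ?thesis .
qed

text \<open>For \<open>p \<in> A\<close> and \<open>q \<in> B\<close>, the set \<open>2 * C\<close> contains the translate of \<open>A \<inter> {..p}\<close> by \<open>q\<close> and the
  translate of \<open>B \<inter> {q..}\<close> by \<open>p\<close>, which have only the point \<open>p + q\<close> in common.\<close>

lemma brunn_minkowski_real:
  fixes A B C :: "real set"
  assumes [measurable]: "A \<in> sets borel" "B \<in> sets borel" "C \<in> sets borel"
    and ne: "A \<noteq> {}" "B \<noteq> {}"
    and mid: "\<And>a b. a \<in> A \<Longrightarrow> b \<in> B \<Longrightarrow> (a + b) / 2 \<in> C"
  shows "(emeasure lborel A + emeasure lborel B) / 2 \<le> emeasure lborel C"
proof -
  have fin: "(x + y) / 2 \<le> emeasure lborel C"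
    if x: "x = 0 \<or> x < emeasure lborel A" and y: "y = 0 \<or> y < emeasure lborel B" for x y
  proof -
    obtain p where p: "p \<in> A" "x \<le> emeasure lborel (A \<inter> {..p})"
      using emeasure_atMost_approx[of A x] x ne by force
    obtain q where q: "q \<in> B" "y \<le> emeasure lborel (B \<inter> {q..})"
      using emeasure_atLeast_approx[of B y] y ne by force
    \<comment> \<open>The two translates, scaled by one half into \<open>C\<close>.\<close>
    let ?A = "(\<lambda>x. 2 * x + (- q)) -` (A \<inter> {..p})" and ?B = "(\<lambda>x. 2 * x + (- p)) -` (B \<inter> {q..})"
    have mA [measurable]: "?A \<in> sets borel" "?B \<in> sets borel"
      using measurable_sets[of "\<lambda>x. 2 * x + (- q)" borel borel "A \<inter> {..p}"]
        measurable_sets[of "\<lambda>x. 2 * x + (- p)" borel borel "B \<inter> {q..}"] by auto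
    have sub: "?A \<subseteq> C" "?B \<subseteq> C"
    proof -
      show "?A \<subseteq> C"
      proof
        fix z assume "z \<in> ?A"
        then show "z \<in> C" using mid[of "2 * z - q" q] q by simp
      qed
      show "?B \<subseteq> C"
      proof
        fix z assume "z \<in> ?B"
        then show "z \<in> C" using mid[of p "2 * z - p"] p by simp
      qed
    qed
    have "(x + y) / 2 \<le> (emeasure lborel (A \<inter> {..p}) + emeasure lborel (B \<inter> {q..})) / 2"
      using p q by (intro divide_right_mono_ennreal add_mono) auto
    also have "\<dots> = emeasure lborel ?A + emeasure lborel ?B"
      by (subst (1 2) emeasure_real_affine_image) (simp_all add: add_divide_distrib_ennreal)
    also have "\<dots> = emeasure lborel (?A - {(p + q) / 2}) + emeasure lborel ?B"
      by (simp only: emeasure_Diff_null_set[OF finite_imp_null_set_lborel[OF finite.insertI[OF finite.emptyI]] mA(1)[folded sets_lborel]])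
    also have "\<dots> = emeasure lborel ((?A - {(p + q) / 2}) \<union> ?B)"
    proof (intro plus_emeasure)
      show "(?A - {(p + q) / 2}) \<inter> ?B = {}" by auto
    qed (use mA in auto)
    also have "\<dots> \<le> emeasure lborel C"
      using sub by (intro emeasure_mono) (auto simp del: vimage_Int)
    finally show ?thesis .
  qed
  have two: "u / 2 \<le> v \<longleftrightarrow> u \<le> 2 * v" for u v :: ennreal
  proof
    assume "u / 2 \<le> v"
    then have "2 * (u / 2) \<le> 2 * v" by (rule mult_left_mono) simp
    moreover have "2 * (u / 2) = u"
      using ennreal_mult_divide_eq[of 2 u] by (simp add: ennreal_times_divide mult.commute)
    ultimately show "u \<le> 2 * v" by simp
  next
    assume "u \<le> 2 * v"
    then have "u / 2 \<le> (v * 2) / 2" by (intro divide_right_mono_ennreal) (simp add: mult.commute)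
    then show "u / 2 \<le> v" by (simp add: ennreal_mult_divide_eq)
  qed
  have "emeasure lborel A + emeasure lborel B \<le> 2 * emeasure lborel C"
  proof (rule ennreal_add_le_dense)
    fix z assume z: "z = 0 \<or> z < emeasure lborel A"
    have "emeasure lborel B + z \<le> 2 * emeasure lborel C"
    proof (rule ennreal_add_le_dense)
      fix y assume "y = 0 \<or> y < emeasure lborel B"
      with fin[OF z] show "y + z \<le> 2 * emeasure lborel C" unfolding two by (simp add: add.commute)
    qed
    then show "z + emeasure lborel B \<le> 2 * emeasure lborel C" by (simp add: add.commute)
  qed
  then show ?thesis using two by blast
qed

lemma emeasure_lborel_greaterThan_0 [simp]: "emeasure lborel {0::real<..} = top"
proof (cases "emeasure lborel {0::real<..}")
  case (real r)
  obtain n :: nat where n: "r < real n" using reals_Archimedean2 by blast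
  have "ennreal (real n) = emeasure lborel {0<..<real n}" by simp
  also have "\<dots> \<le> emeasure lborel {0::real<..}" by (rule emeasure_mono) auto
  finally show ?thesis using real n by (simp add: ennreal_le_iff)
qed

lemma nn_integral_layer_cake:
  fixes f :: "real \<Rightarrow> ennreal"
  assumes [measurable]: "f \<in> borel_measurable borel"
  shows "(\<integral>\<^sup>+x. f x \<partial>lborel) = (\<integral>\<^sup>+s. indicator {0<..} s * emeasure lborel {x. ennreal s < f x} \<partial>lborel)"
    and "(\<integral>\<^sup>+x. f x \<partial>lborel) = (\<integral>\<^sup>+s. indicator {0<..} s * emeasure lborel {x. ennreal s \<le> f x} \<partial>lborel)"
proof -
  have lt: "(\<integral>\<^sup>+s. indicator {0<..} s * indicator {x. ennreal s < f x} x \<partial>lborel) = f x" for x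
  proof -
    have "(\<integral>\<^sup>+s. indicator {0<..} s * indicator {x. ennreal s < f x} x \<partial>lborel) =
        (\<integral>\<^sup>+s. indicator {s. 0 < s \<and> ennreal s < f x} s \<partial>lborel)"
      by (intro nn_integral_cong) (auto simp: indicator_def)
    also have "\<dots> = emeasure lborel {s. 0 < s \<and> ennreal s < f x}"
      by (intro nn_integral_indicator) measurable
    also have "\<dots> = f x"
    proof (cases "f x")
      case (real r)
      then have "{s. 0 < s \<and> ennreal s < f x} = {0<..<r}" by (auto simp: ennreal_less_iff)
      then show ?thesis using real by simp
    next
      case top
      then have "{s. 0 < s \<and> ennreal s < f x} = {0<..}" by auto
      then show ?thesis using top by simp
    qed
    finally show ?thesis .
  qed
  have le: "(\<integral>\<^sup>+s. indicator {0<..} s * indicator {x. ennreal s \<le> f x} x \<partial>lborel) = f x" for x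
  proof -
    have "(\<integral>\<^sup>+s. indicator {0<..} s * indicator {x. ennreal s \<le> f x} x \<partial>lborel) =
        (\<integral>\<^sup>+s. indicator {s. 0 < s \<and> ennreal s \<le> f x} s \<partial>lborel)"
      by (intro nn_integral_cong) (auto simp: indicator_def)
    also have "\<dots> = emeasure lborel {s. 0 < s \<and> ennreal s \<le> f x}"
      by (intro nn_integral_indicator) measurable
    also have "\<dots> = f x"
    proof (cases "f x")
      case (real r)
      then have "{s. 0 < s \<and> ennreal s \<le> f x} = {0<..r}" by (auto simp: ennreal_le_iff)
      then show ?thesis using real by simp
    next
      case top
      then have "{s. 0 < s \<and> ennreal s \<le> f x} = {0<..}" by auto
      then show ?thesis using top by simp
    qed
    finally show ?thesis .
  qed
  have "(\<integral>\<^sup>+x. f x \<partial>lborel) = (\<integral>\<^sup>+x. (\<integral>\<^sup>+s. indicator {0<..} s * indicator {x. ennreal s < f x} x \<partial>lborel) \<partial>lborel)"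
    by (simp only: lt)
  also have "\<dots> = (\<integral>\<^sup>+s. (\<integral>\<^sup>+x. indicator {0<..} s * indicator {x. ennreal s < f x} x \<partial>lborel) \<partial>lborel)"
    by (rule lborel_pair.Fubini') (simp add: indicator_def, measurable)
  also have "\<dots> = (\<integral>\<^sup>+s. indicator {0<..} s * emeasure lborel {x. ennreal s < f x} \<partial>lborel)"
    by (intro nn_integral_cong) (subst nn_integral_cmult, auto)
  finally show "(\<integral>\<^sup>+x. f x \<partial>lborel) = (\<integral>\<^sup>+s. indicator {0<..} s * emeasure lborel {x. ennreal s < f x} \<partial>lborel)" .
  have "(\<integral>\<^sup>+x. f x \<partial>lborel) = (\<integral>\<^sup>+x. (\<integral>\<^sup>+s. indicator {0<..} s * indicator {x. ennreal s \<le> f x} x \<partial>lborel) \<partial>lborel)"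
    by (simp only: le)
  also have "\<dots> = (\<integral>\<^sup>+s. (\<integral>\<^sup>+x. indicator {0<..} s * indicator {x. ennreal s \<le> f x} x \<partial>lborel) \<partial>lborel)"
    by (rule lborel_pair.Fubini') (simp add: indicator_def, measurable)
  also have "\<dots> = (\<integral>\<^sup>+s. indicator {0<..} s * emeasure lborel {x. ennreal s \<le> f x} \<partial>lborel)"
    by (intro nn_integral_cong) (subst nn_integral_cmult, auto)
  finally show "(\<integral>\<^sup>+x. f x \<partial>lborel) = (\<integral>\<^sup>+s. indicator {0<..} s * emeasure lborel {x. ennreal s \<le> f x} \<partial>lborel)" .
qed

lemma nn_integral_layer_cake_scaled:
  fixes f :: "real \<Rightarrow> ennreal"
  assumes [measurable]: "f \<in> borel_measurable borel" and "0 < \<alpha>"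
  shows "(\<integral>\<^sup>+x. f x \<partial>lborel) = ennreal \<alpha> * (\<integral>\<^sup>+r. indicator {0<..} r * emeasure lborel {x. ennreal (\<alpha> * r) < f x} \<partial>lborel)"
    and "(\<integral>\<^sup>+x. f x \<partial>lborel) = ennreal \<alpha> * (\<integral>\<^sup>+r. indicator {0<..} r * emeasure lborel {x. ennreal (\<alpha> * r) \<le> f x} \<partial>lborel)"
proof -
  have m1: "(\<lambda>s. indicator {0<..} s * emeasure lborel {x. ennreal s < f x}) \<in> borel_measurable borel"
    and m2: "(\<lambda>s. indicator {0<..} s * emeasure lborel {x. ennreal s \<le> f x}) \<in> borel_measurable borel"
  proof -
    have Q: "{z \<in> space (borel \<Otimes>\<^sub>M lborel). ennreal (fst z) < f (snd z)} \<in> sets (borel \<Otimes>\<^sub>M (lborel::real measure))"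
      "{z \<in> space (borel \<Otimes>\<^sub>M lborel). ennreal (fst z) \<le> f (snd z)} \<in> sets (borel \<Otimes>\<^sub>M (lborel::real measure))"
      by measurable
    have [measurable]: "(\<lambda>s::real. emeasure lborel {x. ennreal s < f x}) \<in> borel_measurable borel"
      using lborel.measurable_emeasure_Pair[OF Q(1)] by (simp add: space_pair_measure vimage_def)
    have [measurable]: "(\<lambda>s::real. emeasure lborel {x. ennreal s \<le> f x}) \<in> borel_measurable borel"
      using lborel.measurable_emeasure_Pair[OF Q(2)] by (simp add: space_pair_measure vimage_def)
    show "(\<lambda>s. indicator {0<..} s * emeasure lborel {x. ennreal s < f x}) \<in> borel_measurable borel"
     "(\<lambda>s. indicator {0<..} s * emeasure lborel {x. ennreal s \<le> f x}) \<in> borel_measurable borel" by measurable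
  qed
  have ind: "indicator {0<..} (\<alpha> * r) = (indicator {0<..} r :: ennreal)" for r :: real
    using \<open>0 < \<alpha>\<close> by (auto simp: indicator_def zero_less_mult_iff)
  show "(\<integral>\<^sup>+x. f x \<partial>lborel) = ennreal \<alpha> * (\<integral>\<^sup>+r. indicator {0<..} r * emeasure lborel {x. ennreal (\<alpha> * r) < f x} \<partial>lborel)"
    unfolding nn_integral_layer_cake(1)[OF assms(1)]
    by (subst nn_integral_real_affine[OF m1, where c=\<alpha> and t=0]) (use \<open>0 < \<alpha>\<close> in \<open>auto simp: ind\<close>)
  show "(\<integral>\<^sup>+x. f x \<partial>lborel) = ennreal \<alpha> * (\<integral>\<^sup>+r. indicator {0<..} r * emeasure lborel {x. ennreal (\<alpha> * r) \<le> f x} \<partial>lborel)"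
    unfolding nn_integral_layer_cake(2)[OF assms(1)]
    by (subst nn_integral_real_affine[OF m2, where c=\<alpha> and t=0]) (use \<open>0 < \<alpha>\<close> in \<open>auto simp: ind\<close>)
qed

text \<open>Jensen's inequality for \<open>t ^ (m + 1)\<close> at the points \<open>x / X\<close> and \<open>y / Y\<close> with weights
  proportional to \<open>X\<close> and \<open>Y\<close>.\<close>

lemma radon_inequality:
  fixes x y X Y :: real
  assumes "0 \<le> x" "0 \<le> y" "0 < X" "0 < Y"
  shows "(x + y) ^ Suc m / (X + Y) ^ m \<le> x ^ Suc m / X ^ m + y ^ Suc m / Y ^ m"
proof -
  have convex: "convex_on {0::real..} (\<lambda>x. x ^ Suc m)"
    using convex_power_odd[of "Suc m"] convex_on_subset[OF convex_power_even[of "Suc m"], of "{0..}"]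
    by (cases "even (Suc m)") auto
  let ?l = "X / (X + Y)" and ?k = "Y / (X + Y)"
  have lk: "?l + ?k = 1" "0 \<le> ?l" "0 \<le> ?k" using assms by (auto simp: add_divide_distrib[symmetric])
  have e: "?l * (x / X) + ?k * (y / Y) = (x + y) / (X + Y)"
    using assms by (simp add: add_divide_distrib)
  have "((x + y) / (X + Y)) ^ Suc m \<le> ?l * (x / X) ^ Suc m + ?k * (y / Y) ^ Suc m"
  proof -
    have "1 - ?k = ?l" "?k \<le> 1" using lk by linarith+
    moreover have "x / X \<in> {0..}" "y / Y \<in> {0..}" using assms by auto
    ultimately show ?thesis
      using convex_onD[OF convex lk(3), of "x / X" "y / Y"] by (simp only: real_scaleR_def e)
  qed
  then have "(X + Y) * ((x + y) / (X + Y)) ^ Suc m \<le> (X + Y) * (?l * (x / X) ^ Suc m + ?k * (y / Y) ^ Suc m)"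
    using assms by (intro mult_left_mono) auto
  moreover have "(X + Y) * ((x + y) / (X + Y)) ^ Suc m = (x + y) ^ Suc m / (X + Y) ^ m"
    using assms by (simp add: power_divide)
  moreover have "(X + Y) * (?l * (x / X) ^ Suc m + ?k * (y / Y) ^ Suc m) = x ^ Suc m / X ^ m + y ^ Suc m / Y ^ m"
    using assms by (simp add: power_divide distrib_left)
  ultimately show ?thesis by simp
qed

text \<open>The hypothesis says that \<open>h\<close> at a midpoint dominates the mean of \<open>f\<close> and \<open>g\<close> with exponent
  \<open>- 1 / (m + 1)\<close>, and the conclusion is the same for the integrals with exponent \<open>- 1 / m\<close>.
  Running over numbers \<open>x\<close> with \<open>x > f s powr (- 1 / (m + 1))\<close> avoids negative powers of the values
  \<open>0\<close> and \<open>\<infinity>\<close>.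

  The one-dimensional Brunn--Minkowski inequality needs two nonempty sets. Measuring the levels of
  \<open>f\<close> and of \<open>g\<close> as fractions \<open>r\<close> of their suprema makes both level sets nonempty for exactly the
  same \<open>r\<close>, namely \<open>r < 1\<close>; this is why \<open>f\<close> and \<open>g\<close> are bounded here. The two suprema are then
  recombined by \<open>radon_inequality\<close>.\<close>

lemma borell_brascamp_lieb_real_bounded:
  fixes f g h :: "real \<Rightarrow> ennreal" and m :: nat
  assumes [measurable]: "f \<in> borel_measurable borel" "g \<in> borel_measurable borel" "h \<in> borel_measurable borel"
    and bd: "\<And>s. f s \<le> ennreal M" "\<And>s. g s \<le> ennreal M"
    and hyp: "\<And>s t x y. 0 < x \<Longrightarrow> 0 < y \<Longrightarrow> ennreal ((1 / x) ^ Suc m) < f s \<Longrightarrow> ennreal ((1 / y) ^ Suc m) < g t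
        \<Longrightarrow> ennreal ((2 / (x + y)) ^ Suc m) \<le> h ((s + t) / 2)"
    and XY: "0 < X" "0 < Y" "ennreal ((1 / X) ^ m) \<le> (\<integral>\<^sup>+s. f s \<partial>lborel)" "ennreal ((1 / Y) ^ m) \<le> (\<integral>\<^sup>+s. g s \<partial>lborel)"
  shows "ennreal ((2 / (X + Y)) ^ m) \<le> (\<integral>\<^sup>+s. h s \<partial>lborel)"
proof -
  have sup: "\<exists>x>0. (SUP s. f s) = ennreal ((1 / x) ^ Suc m)"
    if f: "\<And>s. f s \<le> ennreal M" "ennreal ((1 / X) ^ m) \<le> (\<integral>\<^sup>+s. f s \<partial>lborel)" "0 < X"
    for f :: "real \<Rightarrow> ennreal" and X
  proof -
    have "(SUP s. f s) \<le> ennreal M" using f by (intro SUP_least) auto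
    then obtain \<alpha> where \<alpha>: "0 \<le> \<alpha>" "(SUP s. f s) = ennreal \<alpha>" by (metis ennreal_cases ennreal_neq_top top.extremum_unique)
    have "\<alpha> \<noteq> 0"
    proof
      assume "\<alpha> = 0"
      then have "f s = 0" for s using \<alpha>(2) SUP_upper[of s UNIV f] by simp
      then have "(\<integral>\<^sup>+s. f s \<partial>lborel) = 0" by simp
      then show False using f(2,3) by simp
    qed
    then have "(1 / (1 / root (Suc m) \<alpha>)) ^ Suc m = \<alpha>" "0 < 1 / root (Suc m) \<alpha>"
      using \<alpha>(1) by (auto simp del: power_Suc simp: real_root_gt_zero)
    then show ?thesis using \<alpha>(2) by metis
  qed
  obtain x where x: "0 < x" "(SUP s. f s) = ennreal ((1 / x) ^ Suc m)" using sup[OF bd(1) XY(3,1)] by blast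
  obtain y where y: "0 < y" "(SUP s. g s) = ennreal ((1 / y) ^ Suc m)" using sup[OF bd(2) XY(4,2)] by blast
  define \<alpha> \<beta> \<mu> where "\<alpha> = (1 / x) ^ Suc m" and "\<beta> = (1 / y) ^ Suc m" and "\<mu> = (2 / (x + y)) ^ Suc m"
  have pos: "0 < \<alpha>" "0 < \<beta>" "0 < \<mu>" using x y by (auto simp: \<alpha>_def \<beta>_def \<mu>_def)
  define F where "F r = emeasure lborel {s. ennreal (\<alpha> * r) < f s}" for r
  define G where "G r = emeasure lborel {s. ennreal (\<beta> * r) < g s}" for r
  define H where "H r = emeasure lborel {s. ennreal (\<mu> * r) \<le> h s}" for r
  \<comment> \<open>At level \<open>r\<close> the parameters \<open>x\<close> and \<open>y\<close> of the suprema are divided by the same number \<open>q\<close>.\<close>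
  have level: "(F r + G r) / 2 \<le> H r" if r: "0 < r" for r
  proof (cases "r < 1")
    case True
    define q where "q = root (Suc m) r"
    have q: "0 < q" "q ^ Suc m = r" unfolding q_def using r by (auto simp: real_root_gt_zero simp del: power_Suc)
    have \<alpha>q: "\<alpha> * r = (1 / (x / q)) ^ Suc m" "\<beta> * r = (1 / (y / q)) ^ Suc m" "\<mu> * r = (2 / (x / q + y / q)) ^ Suc m"
      unfolding \<alpha>_def \<beta>_def \<mu>_def q(2)[symmetric] power_mult_distrib[symmetric] by (simp_all add: add_divide_distrib[symmetric] del: power_Suc)
    show ?thesis unfolding F_def G_def H_def
    proof (rule brunn_minkowski_real)
      have "ennreal (\<alpha> * r) < (SUP s. f s)"
        using pos True r unfolding x(2) \<alpha>_def[symmetric] by (simp add: ennreal_less_iff)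
      then show "{s. ennreal (\<alpha> * r) < f s} \<noteq> {}" by (auto simp: less_SUP_iff)
      have "ennreal (\<beta> * r) < (SUP s. g s)"
        using pos True r unfolding y(2) \<beta>_def[symmetric] by (simp add: ennreal_less_iff)
      then show "{s. ennreal (\<beta> * r) < g s} \<noteq> {}" by (auto simp: less_SUP_iff)
      fix s t assume "s \<in> {s. ennreal (\<alpha> * r) < f s}" "t \<in> {s. ennreal (\<beta> * r) < g s}"
      then show "(s + t) / 2 \<in> {s. ennreal (\<mu> * r) \<le> h s}"
        using hyp[of "x / q" "y / q" s t] x(1) y(1) q(1) unfolding \<alpha>q by simp
    qed measurable
  next
    case False
    have "\<not> ennreal (\<alpha> * r) < f s" for s
    proof -
      have "f s \<le> ennreal \<alpha>" unfolding \<alpha>_def x(2)[symmetric] by (rule SUP_upper) simp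
      also have "\<dots> \<le> ennreal (\<alpha> * r)" using pos False by (intro ennreal_leI) simp
      finally show ?thesis by simp
    qed
    moreover have "\<not> ennreal (\<beta> * r) < g s" for s
    proof -
      have "g s \<le> ennreal \<beta>" unfolding \<beta>_def y(2)[symmetric] by (rule SUP_upper) simp
      also have "\<dots> \<le> ennreal (\<beta> * r)" using pos False by (intro ennreal_leI) simp
      finally show ?thesis by simp
    qed
    ultimately show ?thesis by (simp add: F_def G_def)
  qed
  define IF where "IF = (\<integral>\<^sup>+r. indicator {0<..} r * F r \<partial>lborel)"
  define IG where "IG = (\<integral>\<^sup>+r. indicator {0<..} r * G r \<partial>lborel)"
  have mF: "(\<lambda>r. indicator {0<..} r * F r) \<in> borel_measurable borel"
    and mG: "(\<lambda>r. indicator {0<..} r * G r) \<in> borel_measurable borel"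
  proof -
    have Q: "{z \<in> space (borel \<Otimes>\<^sub>M lborel). ennreal (\<alpha> * fst z) < f (snd z)} \<in> sets (borel \<Otimes>\<^sub>M (lborel::real measure))"
      "{z \<in> space (borel \<Otimes>\<^sub>M lborel). ennreal (\<beta> * fst z) < g (snd z)} \<in> sets (borel \<Otimes>\<^sub>M (lborel::real measure))"
      by measurable
    have [measurable]: "F \<in> borel_measurable borel" "G \<in> borel_measurable borel"
      using lborel.measurable_emeasure_Pair[OF Q(1)] lborel.measurable_emeasure_Pair[OF Q(2)]
      unfolding F_def G_def by (simp_all add: space_pair_measure vimage_def)
    show "(\<lambda>r. indicator {0<..} r * F r) \<in> borel_measurable borel" "(\<lambda>r. indicator {0<..} r * G r) \<in> borel_measurable borel"
      by measurable
  qed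
  have intf: "(\<integral>\<^sup>+s. f s \<partial>lborel) = ennreal \<alpha> * IF" unfolding IF_def F_def
    by (rule nn_integral_layer_cake_scaled(1)) (use pos in auto)
  have intg: "(\<integral>\<^sup>+s. g s \<partial>lborel) = ennreal \<beta> * IG" unfolding IG_def G_def
    by (rule nn_integral_layer_cake_scaled(1)) (use pos in auto)
  have inth: "(\<integral>\<^sup>+s. h s \<partial>lborel) = ennreal \<mu> * (\<integral>\<^sup>+r. indicator {0<..} r * H r \<partial>lborel)" unfolding H_def
    by (rule nn_integral_layer_cake_scaled(2)) (use pos in auto)
  have IFle: "ennreal (x ^ Suc m / X ^ m) \<le> IF"
  proof -
    have "ennreal (1 / \<alpha>) * ennreal ((1 / X) ^ m) \<le> ennreal (1 / \<alpha>) * (ennreal \<alpha> * IF)"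
      using XY(3) unfolding intf by (rule mult_left_mono) simp
    also have "\<dots> = IF" using pos(1) by (simp add: mult.assoc[symmetric] ennreal_mult[symmetric])
    also have "ennreal (1 / \<alpha>) * ennreal ((1 / X) ^ m) = ennreal (x ^ Suc m / X ^ m)"
      using pos(1) XY(1) x(1) by (simp add: ennreal_mult[symmetric] \<alpha>_def power_one_over divide_inverse power_inverse del: power_Suc)
    finally show ?thesis .
  qed
  have IGle: "ennreal (y ^ Suc m / Y ^ m) \<le> IG"
  proof -
    have "ennreal (1 / \<beta>) * ennreal ((1 / Y) ^ m) \<le> ennreal (1 / \<beta>) * (ennreal \<beta> * IG)"
      using XY(4) unfolding intg by (rule mult_left_mono) simp
    also have "\<dots> = IG" using pos(2) by (simp add: mult.assoc[symmetric] ennreal_mult[symmetric])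
    also have "ennreal (1 / \<beta>) * ennreal ((1 / Y) ^ m) = ennreal (y ^ Suc m / Y ^ m)"
      using pos(2) XY(2) y(1) by (simp add: ennreal_mult[symmetric] \<beta>_def power_one_over divide_inverse power_inverse del: power_Suc)
    finally show ?thesis .
  qed
  have "(2 / (X + Y)) ^ m \<le> \<mu> * ((x ^ Suc m / X ^ m + y ^ Suc m / Y ^ m) / 2)"
  proof -
    have "(2 / (X + Y)) ^ m = \<mu> * ((x + y) ^ Suc m / (X + Y) ^ m / 2)"
    proof -
      have "(2 / T) ^ m = (2 / s) ^ Suc m * (s ^ Suc m / T ^ m / 2)" if "0 < s" "0 < T" for s T :: real
        using that by (simp add: power_divide)
      from this[of "x + y" "X + Y"] show ?thesis unfolding \<mu>_def using x(1) y(1) XY(1,2) by auto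
    qed
    also have "\<dots> \<le> \<mu> * ((x ^ Suc m / X ^ m + y ^ Suc m / Y ^ m) / 2)"
      using radon_inequality[of x y X Y m] x(1) y(1) XY(1,2) pos(3)
      by (intro mult_left_mono divide_right_mono) auto
    finally show ?thesis .
  qed
  then have "ennreal ((2 / (X + Y)) ^ m) \<le> ennreal (\<mu> * ((x ^ Suc m / X ^ m + y ^ Suc m / Y ^ m) / 2))"
    by (rule ennreal_leI)
  also have "\<dots> = ennreal \<mu> * ((ennreal (x ^ Suc m / X ^ m) + ennreal (y ^ Suc m / Y ^ m)) / 2)"
  proof -
    have nn: "0 \<le> x ^ Suc m / X ^ m" "0 \<le> y ^ Suc m / Y ^ m" using x(1) y(1) XY(1,2) by auto
    then have "(ennreal (x ^ Suc m / X ^ m) + ennreal (y ^ Suc m / Y ^ m)) / 2 = ennreal ((x ^ Suc m / X ^ m + y ^ Suc m / Y ^ m) / 2)"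
      by (metis add_nonneg_nonneg ennreal_divide_numeral ennreal_plus)
    then show ?thesis using pos(3) nn by (simp only: ennreal_mult')
  qed
  also have "\<dots> \<le> ennreal \<mu> * ((IF + IG) / 2)"
    using IFle IGle by (intro mult_left_mono divide_right_mono_ennreal add_mono) auto
  also have "(IF + IG) / 2 = (\<integral>\<^sup>+r. (indicator {0<..} r * F r + indicator {0<..} r * G r) / 2 \<partial>lborel)"
    unfolding IF_def IG_def using mF mG by (simp add: nn_integral_divide nn_integral_add)
  also have "\<dots> \<le> (\<integral>\<^sup>+r. indicator {0<..} r * H r \<partial>lborel)"
    using level by (intro nn_integral_mono) (auto simp: indicator_def)
  finally show ?thesis unfolding inth by (auto simp: mult_left_mono)
qed

lemma nn_integral_truncate:
  fixes f :: "real \<Rightarrow> ennreal"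
  assumes [measurable]: "f \<in> borel_measurable borel" and "a < (\<integral>\<^sup>+s. f s \<partial>lborel)"
  shows "\<exists>N::nat. a < (\<integral>\<^sup>+s. inf (f s) (of_nat N) \<partial>lborel)"
proof -
  have "(SUP N::nat. inf (f s) (of_nat N)) = f s" for s
    by (simp add: inf_SUP[symmetric] ennreal_SUP_of_nat_eq_top)
  then have "(\<integral>\<^sup>+s. f s \<partial>lborel) = (\<integral>\<^sup>+s. (SUP N::nat. inf (f s) (of_nat N)) \<partial>lborel)" by simp
  also have "\<dots> = (SUP N::nat. \<integral>\<^sup>+s. inf (f s) (of_nat N) \<partial>lborel)"
  proof (rule nn_integral_monotone_convergence_SUP)
    show "incseq (\<lambda>(N::nat) s. inf (f s) (of_nat N))"
      by (intro incseq_SucI le_funI inf_mono) auto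
  qed measurable
  finally show ?thesis using assms(2) by (simp add: less_SUP_iff)
qed

lemma borell_brascamp_lieb_real:
  fixes f g h :: "real \<Rightarrow> ennreal" and m :: nat
  assumes [measurable]: "f \<in> borel_measurable borel" "g \<in> borel_measurable borel" "h \<in> borel_measurable borel"
    and hyp: "\<And>s t x y. 0 < x \<Longrightarrow> 0 < y \<Longrightarrow> ennreal ((1 / x) ^ Suc m) < f s \<Longrightarrow> ennreal ((1 / y) ^ Suc m) < g t
        \<Longrightarrow> ennreal ((2 / (x + y)) ^ Suc m) \<le> h ((s + t) / 2)"
    and XY: "0 < X" "0 < Y" "ennreal ((1 / X) ^ m) < (\<integral>\<^sup>+s. f s \<partial>lborel)" "ennreal ((1 / Y) ^ m) < (\<integral>\<^sup>+s. g s \<partial>lborel)"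
  shows "ennreal ((2 / (X + Y)) ^ m) \<le> (\<integral>\<^sup>+s. h s \<partial>lborel)"
proof -
  obtain N1 :: nat where N1: "ennreal ((1 / X) ^ m) < (\<integral>\<^sup>+s. inf (f s) (of_nat N1) \<partial>lborel)"
    using nn_integral_truncate[OF assms(1) XY(3)] by blast
  obtain N2 :: nat where N2: "ennreal ((1 / Y) ^ m) < (\<integral>\<^sup>+s. inf (g s) (of_nat N2) \<partial>lborel)"
    using nn_integral_truncate[OF assms(2) XY(4)] by blast
  show ?thesis
  proof (rule borell_brascamp_lieb_real_bounded)
    have le: "inf a (of_nat n) \<le> ennreal (real (max N1 N2))" if "n \<le> max N1 N2" for a n
      using that by (intro le_infI2) (metis ennreal_leI ennreal_of_nat_eq_real_of_nat of_nat_le_iff)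
    show "inf (f s) (of_nat N1) \<le> ennreal (real (max N1 N2))" "inf (g s) (of_nat N2) \<le> ennreal (real (max N1 N2))" for s
      by (rule le, simp)+
    show "ennreal ((2 / (x + y)) ^ Suc m) \<le> h ((s + t) / 2)"
      if "0 < x" "0 < y" "ennreal ((1 / x) ^ Suc m) < inf (f s) (of_nat N1)" "ennreal ((1 / y) ^ Suc m) < inf (g t) (of_nat N2)" for s t x y
      using that by (intro hyp) (auto simp del: power_Suc elim: less_le_trans)
  qed (use XY N1 N2 in \<open>auto intro: less_imp_le\<close>)
qed

text \<open>Each coordinate that is integrated out improves the exponent from \<open>- 1 / (i + 1)\<close> to \<open>- 1 / i\<close>;
  \<open>m\<close> is the part of the exponent that is left over at the end.\<close>

lemma borell_brascamp_lieb_coord: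
  fixes f g h :: "'a::euclidean_space \<Rightarrow> ennreal"
  assumes "finite J"
    and "f \<in> borel_measurable borel" "g \<in> borel_measurable borel" "h \<in> borel_measurable borel"
    and "\<And>u v x y. 0 < x \<Longrightarrow> 0 < y \<Longrightarrow> ennreal ((1 / x) ^ Suc (card J + m)) < f u \<Longrightarrow> ennreal ((1 / y) ^ Suc (card J + m)) < g v
        \<Longrightarrow> ennreal ((2 / (x + y)) ^ Suc (card J + m)) \<le> h ((1/2) *\<^sub>R (u + v))"
    and XY: "0 < X" "0 < Y" and "ennreal ((1 / X) ^ Suc m) < (\<integral>\<^sup>+u. f u \<partial>coord_lborel J)" "ennreal ((1 / Y) ^ Suc m) < (\<integral>\<^sup>+u. g u \<partial>coord_lborel J)"
  shows "ennreal ((2 / (X + Y)) ^ Suc m) \<le> (\<integral>\<^sup>+u. h u \<partial>coord_lborel J)"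
  using assms(1-5,8,9)
proof (induction J arbitrary: f g h rule: finite_induct)
  case empty
  show ?case
    using empty.prems(4)[OF XY, of 0 0] empty.prems(5,6)
    by (simp add: nn_integral_coord_lborel_empty empty.prems(1-3) del: power_Suc)
next
  case (insert k J)
  note [measurable] = insert.prems(1-3)
  have slice: "(\<integral>\<^sup>+u. q u \<partial>coord_lborel (insert k J)) = (\<integral>\<^sup>+u. (\<integral>\<^sup>+t. q (u + t *\<^sub>R k) \<partial>lborel) \<partial>coord_lborel J)"
    if "q \<in> borel_measurable borel" for q :: "'a \<Rightarrow> ennreal"
    using insert.hyps that by (rule nn_integral_coord_lborel_insert)
  have c: "card (insert k J) + m = Suc (card J + m)" using insert.hyps by simp
  show ?case
    unfolding slice[OF insert.prems(3)]
  proof (rule insert.IH)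
    show "ennreal ((1 / X) ^ Suc m) < (\<integral>\<^sup>+u. (\<integral>\<^sup>+t. f (u + t *\<^sub>R k) \<partial>lborel) \<partial>coord_lborel J)"
      using insert.prems(5) unfolding slice[OF insert.prems(1)] .
    show "ennreal ((1 / Y) ^ Suc m) < (\<integral>\<^sup>+u. (\<integral>\<^sup>+t. g (u + t *\<^sub>R k) \<partial>lborel) \<partial>coord_lborel J)"
      using insert.prems(6) unfolding slice[OF insert.prems(2)] .
    fix u v x y
    assume xy: "0 < x" "0 < y"
      and u: "ennreal ((1 / x) ^ Suc (card J + m)) < (\<integral>\<^sup>+t. f (u + t *\<^sub>R k) \<partial>lborel)"
      and v: "ennreal ((1 / y) ^ Suc (card J + m)) < (\<integral>\<^sup>+t. g (v + t *\<^sub>R k) \<partial>lborel)"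
    show "ennreal ((2 / (x + y)) ^ Suc (card J + m)) \<le> (\<integral>\<^sup>+t. h ((1/2) *\<^sub>R (u + v) + t *\<^sub>R k) \<partial>lborel)"
    proof (rule borell_brascamp_lieb_real[OF _ _ _ _ xy u v])
      fix s t x y :: real
      assume *: "0 < x" "0 < y" "ennreal ((1 / x) ^ Suc (Suc (card J + m))) < f (u + s *\<^sub>R k)"
        "ennreal ((1 / y) ^ Suc (Suc (card J + m))) < g (v + t *\<^sub>R k)"
      have e: "(1/2) *\<^sub>R ((u + s *\<^sub>R k) + (v + t *\<^sub>R k)) = (1/2) *\<^sub>R (u + v) + ((s + t) / 2) *\<^sub>R k"
        by (simp add: algebra_simps add_divide_distrib)
      show "ennreal ((2 / (x + y)) ^ Suc (Suc (card J + m))) \<le> h ((1/2) *\<^sub>R (u + v) + ((s + t) / 2) *\<^sub>R k)"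
        using insert.prems(4)[of x y "u + s *\<^sub>R k" "v + t *\<^sub>R k"] * unfolding c e by simp
    qed measurable
  qed measurable
qed

text \<open>The form used for polar bodies: \<open>\<alpha>\<close>, \<open>\<beta>\<close> and \<open>\<gamma>\<close> are restrictions of gauges to affine
  hyperplanes, so the midpoint hypothesis is linear in them. The exponent that remains is \<open>- 1\<close>, and
  the resulting harmonic mean of the two integrals is their common value when they agree.\<close>

lemma borell_brascamp_lieb_harmonic:
  fixes \<alpha> \<beta> \<gamma> :: "'a::euclidean_space \<Rightarrow> real"
  assumes J: "finite J"
    and [measurable]: "\<alpha> \<in> borel_measurable borel" "\<beta> \<in> borel_measurable borel" "\<gamma> \<in> borel_measurable borel"
    and pos: "\<And>u. 0 < \<alpha> u" "\<And>u. 0 < \<beta> u" "\<And>u. 0 < \<gamma> u"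
    and mid: "\<And>u v. \<gamma> ((1/2) *\<^sub>R (u + v)) \<le> (\<alpha> u + \<beta> v) / 2"
    and eq: "(\<integral>\<^sup>+u. ennreal ((1 / \<alpha> u) ^ Suc (card J)) \<partial>coord_lborel J) = A"
      "(\<integral>\<^sup>+u. ennreal ((1 / \<beta> u) ^ Suc (card J)) \<partial>coord_lborel J) = A"
  shows "A \<le> (\<integral>\<^sup>+u. ennreal ((1 / \<gamma> u) ^ Suc (card J)) \<partial>coord_lborel J)"
proof (rule dense_le)
  fix z assume "z < A"
  show "z \<le> (\<integral>\<^sup>+u. ennreal ((1 / \<gamma> u) ^ Suc (card J)) \<partial>coord_lborel J)"
  proof (cases "z = 0")
    case False
    with \<open>z < A\<close> obtain r where r: "z = ennreal r" "0 < r"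
      by (metis ennreal_cases ennreal_0 less_eq_real_def not_top_less)
    have "ennreal ((2 / (1 / r + 1 / r)) ^ Suc 0) \<le> (\<integral>\<^sup>+u. ennreal ((1 / \<gamma> u) ^ Suc (card J)) \<partial>coord_lborel J)"
    proof (rule borell_brascamp_lieb_coord[OF J])
      show "ennreal ((1 / (1 / r)) ^ Suc 0) < (\<integral>\<^sup>+u. ennreal ((1 / \<alpha> u) ^ Suc (card J)) \<partial>coord_lborel J)"
        "ennreal ((1 / (1 / r)) ^ Suc 0) < (\<integral>\<^sup>+u. ennreal ((1 / \<beta> u) ^ Suc (card J)) \<partial>coord_lborel J)"
        using eq r \<open>z < A\<close> by auto
      fix u v x y assume xy: "0 < (x::real)" "0 < (y::real)"
        and 1: "ennreal ((1 / x) ^ Suc (card J + 0)) < ennreal ((1 / \<alpha> u) ^ Suc (card J))"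
        and 2: "ennreal ((1 / y) ^ Suc (card J + 0)) < ennreal ((1 / \<beta> v) ^ Suc (card J))"
      have *: "b \<le> a" if "ennreal ((1 / a) ^ Suc (card J + 0)) < ennreal ((1 / b) ^ Suc (card J))" "0 < a" "0 < b" for a b :: real
      proof (rule ccontr)
        assume "\<not> b \<le> a"
        then have "(1 / b) ^ Suc (card J) \<le> (1 / a) ^ Suc (card J)"
          using that by (intro power_mono) (auto simp: frac_le)
        then show False using that(1) by (metis Nat.add_0_right ennreal_leI not_le)
      qed
      have "\<gamma> ((1/2) *\<^sub>R (u + v)) \<le> (x + y) / 2"
        using *[OF 1 xy(1) pos(1)] *[OF 2 xy(2) pos(2)] by (intro order_trans[OF mid[of u v]]) simp
      then have "2 / (x + y) \<le> 1 / \<gamma> ((1/2) *\<^sub>R (u + v))"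
        using pos(3)[of "(1/2) *\<^sub>R (u + v)"] xy by (simp add: field_simps)
      then show "ennreal ((2 / (x + y)) ^ Suc (card J + 0)) \<le> ennreal ((1 / \<gamma> ((1/2) *\<^sub>R (u + v))) ^ Suc (card J))"
        using xy by (intro ennreal_leI) (simp only: Nat.add_0_right, intro power_mono, auto)
    qed (use r in auto)
    then show ?thesis using r by simp
  qed simp
qed

section \<open>Support functions\<close>

lemma convex_bodies_oD:
  assumes "L \<in> convex_bodies_o"
  shows "compact L" "convex L" "0 \<in> interior L" "0 \<in> L" "L \<noteq> {}" "closed L" "bounded L" "interior L \<noteq> {}"
    "closure (interior L) = L"
proof -
  show 1: "compact L" "convex L" "0 \<in> interior L" using assms by (auto simp: convex_bodies_o_def)
  then show 2: "0 \<in> L" "L \<noteq> {}" "closed L" "bounded L" "interior L \<noteq> {}"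
    using interior_subset compact_imp_closed compact_imp_bounded by blast+
  show "closure (interior L) = L" using 1 2 by (simp add: convex_closure_interior)
qed

lemma support_fun_upper:
  fixes L :: "'a::euclidean_space set"
  assumes "compact L" "y \<in> L"
  shows "x \<bullet> y \<le> support_fun L x"
proof -
  have "compact ((\<lambda>y. x \<bullet> y) ` L)" by (intro compact_continuous_image continuous_intros assms)
  then show ?thesis unfolding support_fun_def
    using assms by (intro cSUP_upper) (auto intro: bounded_imp_bdd_above compact_imp_bounded)
qed

lemma support_fun_least:
  assumes "L \<noteq> {}" "\<And>y. y \<in> L \<Longrightarrow> x \<bullet> y \<le> b"
  shows "support_fun L x \<le> b"
  unfolding support_fun_def using assms by (intro cSUP_least) auto

lemma support_fun_attained:
  fixes L :: "'a::euclidean_space set"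
  assumes "compact L" "L \<noteq> {}"
  obtains y where "y \<in> L" "support_fun L x = x \<bullet> y"
proof -
  obtain y where y: "y \<in> L" "\<And>z. z \<in> L \<Longrightarrow> x \<bullet> z \<le> x \<bullet> y"
    using continuous_attains_sup[OF assms continuous_on_inner[OF continuous_on_const continuous_on_id], of x] by auto
  then have "support_fun L x = x \<bullet> y"
    using support_fun_upper[OF assms(1) y(1)] support_fun_least[OF assms(2), of x "x \<bullet> y"] by (auto intro: antisym)
  then show ?thesis using that y by blast
qed

lemma support_fun_subadd:
  fixes L :: "'a::euclidean_space set"
  assumes "compact L" "L \<noteq> {}"
  shows "support_fun L (x + y) \<le> support_fun L x + support_fun L y"
  using assms by (intro support_fun_least) (auto simp: inner_add_left intro: add_mono support_fun_upper)

lemma support_fun_scale: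
  fixes L :: "'a::euclidean_space set"
  assumes "compact L" "L \<noteq> {}" "0 \<le> c"
  shows "support_fun L (c *\<^sub>R x) = c * support_fun L x"
proof -
  obtain y where y: "y \<in> L" "support_fun L x = x \<bullet> y" using support_fun_attained assms by blast
  show ?thesis
  proof (rule antisym)
    show "support_fun L (c *\<^sub>R x) \<le> c * support_fun L x"
      using assms by (intro support_fun_least) (auto intro: mult_left_mono support_fun_upper)
    show "c * support_fun L x \<le> support_fun L (c *\<^sub>R x)"
      using support_fun_upper[OF assms(1) y(1), of "c *\<^sub>R x"] y by simp
  qed
qed

lemma support_fun_convex:
  fixes L :: "'a::euclidean_space set"
  assumes "compact L" "L \<noteq> {}"
  shows "convex_on UNIV (support_fun L)"
proof (rule convex_onI)
  fix t :: real and x y :: 'a assume "0 < t" "t < 1"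
  then show "support_fun L ((1 - t) *\<^sub>R x + t *\<^sub>R y) \<le> (1 - t) * support_fun L x + t * support_fun L y"
    using support_fun_subadd[OF assms, of "(1 - t) *\<^sub>R x" "t *\<^sub>R y"] support_fun_scale[OF assms] by simp
qed simp

lemma support_fun_continuous:
  fixes L :: "'a::euclidean_space set"
  assumes "compact L" "L \<noteq> {}"
  shows "continuous_on A (support_fun L)"
  using convex_on_continuous[OF open_UNIV support_fun_convex[OF assms]] continuous_on_subset by blast

lemma mem_iff_support_fun:
  fixes L :: "'a::euclidean_space set"
  assumes "compact L" "convex L" "L \<noteq> {}"
  shows "x \<in> L \<longleftrightarrow> (\<forall>u. u \<bullet> x \<le> support_fun L u)"
proof
  assume R: "\<forall>u. u \<bullet> x \<le> support_fun L u"
  show "x \<in> L"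
  proof (rule ccontr)
    assume "x \<notin> L"
    then obtain a b where ab: "a \<bullet> x < b" "\<forall>y\<in>L. a \<bullet> y > b"
      using separating_hyperplane_closed_point[of L x] assms compact_imp_closed by blast
    have "support_fun L (- a) \<le> - b" using ab assms by (intro support_fun_least) (auto intro: less_imp_le)
    then show False using R ab by (auto dest: spec[of _ "- a"])
  qed
qed (use support_fun_upper assms in blast)

lemma interior_iff_support_fun:
  fixes L :: "'a::euclidean_space set"
  assumes L: "L \<in> convex_bodies_o"
  shows "x \<in> interior L \<longleftrightarrow> (\<forall>u. u \<noteq> 0 \<longrightarrow> u \<bullet> x < support_fun L u)"
proof
  assume "x \<in> interior L"
  then obtain e where e: "0 < e" "cball x e \<subseteq> L" using mem_interior_cball by blast
  show "\<forall>u. u \<noteq> 0 \<longrightarrow> u \<bullet> x < support_fun L u"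
  proof (intro allI impI)
    fix u :: 'a assume u: "u \<noteq> 0"
    have "x + (e / norm u) *\<^sub>R u \<in> L" using e u by (intro subsetD[OF e(2)]) (auto simp: dist_norm)
    then have "u \<bullet> x + (e / norm u) * (u \<bullet> u) \<le> support_fun L u"
      using support_fun_upper[OF convex_bodies_oD(1)[OF L]] by (metis inner_add_right inner_scaleR_right)
    moreover have "0 < (e / norm u) * (u \<bullet> u)" using e u by simp
    ultimately show "u \<bullet> x < support_fun L u" by linarith
  qed
next
  assume R: "\<forall>u. u \<noteq> 0 \<longrightarrow> u \<bullet> x < support_fun L u"
  show "x \<in> interior L"
  proof (rule ccontr)
    assume "x \<notin> interior L"
    then obtain a b where ab: "a \<noteq> 0" "\<forall>y\<in>interior L. a \<bullet> y \<le> b" "\<forall>y\<in>{x}. a \<bullet> y \<ge> b"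
      using separating_hyperplane_sets[of "interior L" "{x}"] convex_bodies_oD[OF L] by (auto simp: convex_interior)
    have "closed {y. a \<bullet> y \<le> b}" by (rule closed_halfspace_le)
    then have "closure (interior L) \<subseteq> {y. a \<bullet> y \<le> b}" using ab(2) by (intro closure_minimal) auto
    then have "support_fun L a \<le> b" using convex_bodies_oD[OF L] by (intro support_fun_least) auto
    then show False using R ab by fastforce
  qed
qed

lemma polar_wrt_eq:
  fixes L :: "'a::euclidean_space set"
  assumes "compact L" "L \<noteq> {}"
  shows "polar_wrt L x = {y. support_fun L y - x \<bullet> y \<le> 1}"
proof -
  have "(\<forall>z\<in>L. y \<bullet> (z - x) \<le> 1) \<longleftrightarrow> support_fun L y - x \<bullet> y \<le> 1" for y
  proof
    assume "\<forall>z\<in>L. y \<bullet> (z - x) \<le> 1"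
    then have "support_fun L y \<le> 1 + x \<bullet> y"
      using assms by (intro support_fun_least) (auto simp: inner_diff_right inner_commute algebra_simps)
    then show "support_fun L y - x \<bullet> y \<le> 1" by simp
  next
    assume "support_fun L y - x \<bullet> y \<le> 1"
    then show "\<forall>z\<in>L. y \<bullet> (z - x) \<le> 1"
      using support_fun_upper[OF assms(1), of _ y] by (force simp: inner_diff_right inner_commute)
  qed
  then show ?thesis by (auto simp: polar_wrt_def polar_def)
qed

section \<open>Volumes of sublevel sets as exponential integrals\<close>

lemma nn_integral_exp_tail: "(\<integral>\<^sup>+t. ennreal (exp (- t)) * indicator {a..} t \<partial>lborel) = ennreal (exp (- a))"
proof -
  have "((\<lambda>t::real. - exp (- t)) \<longlongrightarrow> 0) at_top"
    using tendsto_minus[OF filterlim_compose[OF exp_at_bot filterlim_uminus_at_bot_at_top]] by simp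
  moreover have "((\<lambda>t. - exp (- t)) has_real_derivative exp (- t)) (at t)" for t :: real
    by (auto intro!: derivative_eq_intros)
  ultimately show ?thesis by (subst nn_integral_FTC_atLeast[where F = "\<lambda>t. - exp (- t)" and T = 0]) auto
qed

lemma emeasure_scale_cone:
  fixes C :: "'a::euclidean_space set"
  assumes [measurable]: "C \<in> sets borel" and "0 < t"
  shows "emeasure lborel {y. (1/t) *\<^sub>R y \<in> C} = ennreal (t ^ DIM('a)) * emeasure lborel C"
proof -
  have m: "{y. (1/t) *\<^sub>R y \<in> C} \<in> sets borel"
    using measurable_sets[of "\<lambda>y. (1/t) *\<^sub>R y" borel borel C] assms(1) by (simp add: vimage_def)
  have "emeasure lborel {y. (1/t) *\<^sub>R y \<in> C} = (\<integral>\<^sup>+y. indicator {y. (1/t) *\<^sub>R y \<in> C} y \<partial>coord_lborel Basis)"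
    unfolding coord_lborel_Basis using m by simp
  also have "\<dots> = ennreal (t ^ card (Basis :: 'a set)) * (\<integral>\<^sup>+y. indicator {y. (1/t) *\<^sub>R y \<in> C} (t *\<^sub>R y) \<partial>coord_lborel Basis)"
    using m \<open>0 < t\<close> by (intro coord_lborel_scale) auto
  also have "(\<lambda>y. indicator {y. (1/t) *\<^sub>R y \<in> C} (t *\<^sub>R y)) = (indicator C :: 'a \<Rightarrow> ennreal)"
    using \<open>0 < t\<close> by (auto simp: indicator_def)
  finally show ?thesis unfolding coord_lborel_Basis by simp
qed

text \<open>Integrating the layers \<open>g y \<le> t\<close> of \<open>exp (- g y)\<close>, which are dilates of each other. Unlike the set
  \<open>g y \<le> 1\<close>, the domain of the integral stays fixed when \<open>g\<close> changes, so that volumes of polar bodies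
  with respect to different points can be compared under the integral sign.\<close>

lemma nn_integral_exp_cone:
  fixes g :: "'a::euclidean_space \<Rightarrow> real"
  assumes [measurable]: "g \<in> borel_measurable borel" "C \<in> sets borel"
    and C: "\<And>t y. 0 < t \<Longrightarrow> y \<in> C \<Longrightarrow> t *\<^sub>R y \<in> C"
    and g: "\<And>t y. 0 < t \<Longrightarrow> g (t *\<^sub>R y) = t * g y" "\<And>y. 0 \<le> g y"
  shows "(\<integral>\<^sup>+y. indicator C y * ennreal (exp (- g y)) \<partial>lborel)
       = ennreal (Gamma (real DIM('a) + 1)) * emeasure lborel {y \<in> C. g y \<le> 1}"
proof -
  let ?n = "DIM('a)"
  have "(\<integral>\<^sup>+y. indicator C y * ennreal (exp (- g y)) \<partial>lborel)
      = (\<integral>\<^sup>+y. (\<integral>\<^sup>+t. indicator C y * (ennreal (exp (- t)) * indicator {g y..} t) \<partial>lborel) \<partial>lborel)"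
    by (subst nn_integral_cmult) (auto simp: nn_integral_exp_tail)
  also have "\<dots> = (\<integral>\<^sup>+t. (\<integral>\<^sup>+y. indicator C y * (ennreal (exp (- t)) * indicator {g y..} t) \<partial>lborel) \<partial>lborel)"
    by (rule lborel_pair.Fubini') (simp add: indicator_def, measurable)
  also have "\<dots> = (\<integral>\<^sup>+t. ennreal (exp (- t)) * emeasure lborel {y \<in> C. g y \<le> t} \<partial>lborel)"
  proof (intro nn_integral_cong)
    fix t
    have "(\<integral>\<^sup>+y. indicator C y * (ennreal (exp (- t)) * indicator {g y..} t) \<partial>lborel)
       = (\<integral>\<^sup>+y. ennreal (exp (- t)) * indicator {y \<in> C. g y \<le> t} y \<partial>lborel)"
      by (intro nn_integral_cong) (auto simp: indicator_def)
    also have "\<dots> = ennreal (exp (- t)) * emeasure lborel {y \<in> C. g y \<le> t}"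
      by (rule nn_integral_cmult_indicator) measurable
    finally show "(\<integral>\<^sup>+y. indicator C y * (ennreal (exp (- t)) * indicator {g y..} t) \<partial>lborel)
       = ennreal (exp (- t)) * emeasure lborel {y \<in> C. g y \<le> t}" .
  qed
  also have "\<dots> = (\<integral>\<^sup>+t. ennreal (indicator {0..} t * t powr (real ?n + 1 - 1) / exp t) * emeasure lborel {y \<in> C. g y \<le> 1} \<partial>lborel)"
  proof (intro nn_integral_cong_AE eventually_mono[OF AE_lborel_singleton[of 0]])
    fix t :: real assume "t \<noteq> 0"
    show "ennreal (exp (- t)) * emeasure lborel {y \<in> C. g y \<le> t}
      = ennreal (indicator {0..} t * t powr (real ?n + 1 - 1) / exp t) * emeasure lborel {y \<in> C. g y \<le> 1}"
    proof (cases "0 < t")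
      case True
      have "(y \<in> C \<and> g y \<le> t) \<longleftrightarrow> (1/t) *\<^sub>R y \<in> {y \<in> C. g y \<le> 1}" for y
      proof -
        have "g y = t * g ((1/t) *\<^sub>R y)" using g(1)[of t "(1/t) *\<^sub>R y"] True by simp
        then have "g ((1/t) *\<^sub>R y) \<le> 1 \<longleftrightarrow> g y \<le> t" using True by (metis mult_le_cancel_left_pos mult.right_neutral)
        moreover have "(1/t) *\<^sub>R y \<in> C \<longleftrightarrow> y \<in> C"
          using C[of t "(1/t) *\<^sub>R y"] C[of "1/t" y] True by auto
        ultimately show ?thesis by blast
      qed
      then have "{y \<in> C. g y \<le> t} = {y. (1/t) *\<^sub>R y \<in> {y \<in> C. g y \<le> 1}}" by blast
      then have "emeasure lborel {y \<in> C. g y \<le> t} = ennreal (t ^ ?n) * emeasure lborel {y \<in> C. g y \<le> 1}"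
        using emeasure_scale_cone[of "{y \<in> C. g y \<le> 1}" t] True by simp
      then show ?thesis
        using True by (simp add: mult.assoc[symmetric] ennreal_mult[symmetric] powr_realpow exp_minus divide_inverse mult.commute)
    next
      case False
      then have "t < 0" using \<open>t \<noteq> 0\<close> by simp
      then have "{y \<in> C. g y \<le> t} = {}" using g(2) by (auto simp: not_le intro: less_le_trans)
      then show ?thesis using \<open>t < 0\<close> by (simp only: emeasure_empty) simp
    qed
  qed
  also have "\<dots> = ennreal (Gamma (real ?n + 1)) * emeasure lborel {y \<in> C. g y \<le> 1}"
    by (subst nn_integral_multc) (auto simp: Gamma_conv_nn_integral_real)
  finally show ?thesis .
qed

text \<open>For a cone \<open>A\<close> this is \<open>n!\<close> times the volume of the part in \<open>A\<close> of the polar of \<open>L\<close> with respect to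
  \<open>x\<close>. The point \<open>x\<close> enters only through a linear term in the exponent, so convexity and
  semicontinuity in \<open>x\<close> can be read off from the integrand.\<close>

definition exp_int :: "'a::euclidean_space set \<Rightarrow> 'a set \<Rightarrow> 'a \<Rightarrow> ennreal" where
  "exp_int L A x = (\<integral>\<^sup>+y. indicator A y * ennreal (exp (x \<bullet> y - support_fun L y)) \<partial>lborel)"

lemma support_fun_measurable:
  fixes L :: "'a::euclidean_space set"
  assumes "compact L" "L \<noteq> {}"
  shows "support_fun L \<in> borel_measurable borel"
  using support_fun_continuous[OF assms] by (rule borel_measurable_continuous_onI)

lemma exp_int_eq:
  fixes L :: "'a::euclidean_space set"
  assumes L: "L \<in> convex_bodies_o" and x: "x \<in> L" and A: "A \<in> sets borel" "\<And>t y. 0 < t \<Longrightarrow> y \<in> A \<Longrightarrow> t *\<^sub>R y \<in> A"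
  shows "exp_int L A x = ennreal (Gamma (real DIM('a) + 1)) * emeasure lborel {y \<in> A. support_fun L y - x \<bullet> y \<le> 1}"
proof -
  note LD = convex_bodies_oD[OF L]
  have [measurable]: "support_fun L \<in> borel_measurable borel" using support_fun_measurable LD by blast
  have "exp_int L A x = (\<integral>\<^sup>+y. indicator A y * ennreal (exp (- (support_fun L y - x \<bullet> y))) \<partial>lborel)"
    unfolding exp_int_def by simp
  also have "\<dots> = ennreal (Gamma (real DIM('a) + 1)) * emeasure lborel {y \<in> A. support_fun L y - x \<bullet> y \<le> 1}"
  proof (rule nn_integral_exp_cone)
    show "support_fun L (t *\<^sub>R y) - x \<bullet> (t *\<^sub>R y) = t * (support_fun L y - x \<bullet> y)" if "0 < t" for t y
      using support_fun_scale[OF LD(1,5), of t y] that by (simp add: algebra_simps)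
    show "0 \<le> support_fun L y - x \<bullet> y" for y
      using support_fun_upper[OF LD(1) x, of y] by (simp add: inner_commute)
  qed (use A in auto)
  finally show ?thesis .
qed

lemma bounded_polar_sublevel:
  fixes L :: "'a::euclidean_space set"
  assumes L: "L \<in> convex_bodies_o" and x: "x \<in> interior L"
  shows "bounded {y. support_fun L y - x \<bullet> y \<le> 1}"
proof -
  note LD = convex_bodies_oD[OF L]
  have "continuous_on (sphere 0 1) (\<lambda>u. support_fun L u - x \<bullet> u)"
    by (intro continuous_intros support_fun_continuous LD)
  moreover have "sphere (0::'a) 1 \<noteq> {}" by simp
  ultimately obtain u where u: "u \<in> sphere 0 1" "\<And>v. v \<in> sphere 0 1 \<Longrightarrow> support_fun L u - x \<bullet> u \<le> support_fun L v - x \<bullet> v"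
    using continuous_attains_inf[of "sphere (0::'a) 1" "\<lambda>u. support_fun L u - x \<bullet> u"] by (auto simp: compact_sphere)
  define d where "d = support_fun L u - x \<bullet> u"
  have "u \<noteq> 0" using u(1) by auto
  then have d: "0 < d" using x u(1) interior_iff_support_fun[OF L, of x] unfolding d_def by (simp add: inner_commute)
  have "norm y \<le> 1 / d" if "support_fun L y - x \<bullet> y \<le> 1" for y
  proof (cases "y = 0")
    case False
    have "norm y * d \<le> norm y * (support_fun L ((1 / norm y) *\<^sub>R y) - x \<bullet> ((1 / norm y) *\<^sub>R y))"
      using u(2)[of "(1 / norm y) *\<^sub>R y"] False unfolding d_def by (intro mult_left_mono) auto
    also have "\<dots> = support_fun L y - x \<bullet> y"
      using False support_fun_scale[OF LD(1,5), of "1 / norm y" y] by (simp add: field_simps)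
    finally show ?thesis using that d by (simp add: field_simps)
  qed (use d in simp)
  then show ?thesis unfolding bounded_iff by blast
qed

lemma polar_sublevel_measure:
  fixes L :: "'a::euclidean_space set"
  assumes L: "L \<in> convex_bodies_o" and x: "x \<in> interior L"
  shows "emeasure lborel {y. support_fun L y - x \<bullet> y \<le> 1} = ennreal (vol (polar_wrt L x))"
    and "{y. support_fun L y - x \<bullet> y \<le> 1} \<in> sets borel"
proof -
  note LD = convex_bodies_oD[OF L]
  have cl: "closed {y. support_fun L y - x \<bullet> y \<le> 1}"
    by (intro closed_Collect_le continuous_intros support_fun_continuous LD)
  then show m: "{y. support_fun L y - x \<bullet> y \<le> 1} \<in> sets borel" by simp
  have "compact {y. support_fun L y - x \<bullet> y \<le> 1}" using cl bounded_polar_sublevel[OF assms] by (simp add: compact_eq_bounded_closed)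
  then have "emeasure lborel {y. support_fun L y - x \<bullet> y \<le> 1} < \<infinity>" by (rule emeasure_compact_finite)
  then have "emeasure lborel {y. support_fun L y - x \<bullet> y \<le> 1} = ennreal (measure lborel {y. support_fun L y - x \<bullet> y \<le> 1})"
    by (intro emeasure_eq_ennreal_measure) auto
  then show "emeasure lborel {y. support_fun L y - x \<bullet> y \<le> 1} = ennreal (vol (polar_wrt L x))"
    using m by (simp add: polar_wrt_eq[OF LD(1,5)] measure_completion)
qed

lemma exp_int_interior:
  fixes L :: "'a::euclidean_space set"
  assumes L: "L \<in> convex_bodies_o" and x: "x \<in> interior L"
  shows "exp_int L UNIV x = ennreal (Gamma (real DIM('a) + 1) * vol (polar_wrt L x))"
  using exp_int_eq[OF L, of x UNIV] polar_sublevel_measure[OF assms] interior_subset x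
  by (auto simp: ennreal_mult Gamma_real_pos less_imp_le)

text \<open>A point outside the interior satisfies \<open>u \<bullet> x \<ge> support_fun L u\<close> for some \<open>u \<noteq> 0\<close>. Then the set
  whose volume is taken contains, with a ball around the origin, all translates of this ball along
  the ray of \<open>u\<close>, and infinitely many of these are disjoint.\<close>

lemma exp_int_frontier:
  fixes L :: "'a::euclidean_space set"
  assumes L: "L \<in> convex_bodies_o" and x: "x \<in> L" "x \<notin> interior L"
  shows "exp_int L UNIV x = \<infinity>"
proof -
  note LD = convex_bodies_oD[OF L]
  obtain u where u: "u \<noteq> 0" "support_fun L u \<le> u \<bullet> x" using interior_iff_support_fun[OF L] x(2) by (meson not_le)
  let ?g = "\<lambda>y. support_fun L y - x \<bullet> y"
  have "open {y. ?g y < 1}" by (intro open_Collect_less continuous_intros support_fun_continuous LD)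
  moreover have "support_fun L 0 = 0" using support_fun_scale[OF LD(1,5), of 0 0] by simp
  ultimately obtain r where r: "0 < r" "ball 0 r \<subseteq> {y. ?g y < 1}"
    using open_contains_ball_eq[of "{y. ?g y < 1}" 0] by auto
  \<comment> \<open>Centers on the ray of \<open>u\<close> at mutual distance at least \<open>2 * r\<close>.\<close>
  define c where "c m = (real m * (2 * r / norm u)) *\<^sub>R u" for m :: nat
  have sub: "(\<Union>m. ball (c m) r) \<subseteq> {y. ?g y \<le> 1}"
  proof safe
    fix m y assume "y \<in> ball (c m) r"
    then have "?g (y - c m) < 1" using r(2) by (auto simp: dist_norm norm_minus_commute)
    moreover have "?g (c m) \<le> 0"
    proof -
      have "0 \<le> real m * (2 * r / norm u)" using r(1) by simp
      moreover from this have "?g (c m) = (real m * (2 * r / norm u)) * (support_fun L u - x \<bullet> u)"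
        unfolding c_def support_fun_scale[OF LD(1,5) \<open>0 \<le> real m * (2 * r / norm u)\<close>] by (simp only: inner_scaleR_right right_diff_distrib)
      moreover have "support_fun L u - x \<bullet> u \<le> 0" using u(2) by (simp add: inner_commute)
      ultimately show ?thesis by (simp only: mult_nonneg_nonpos)
    qed
    moreover have "?g y \<le> ?g (y - c m) + ?g (c m)"
      using support_fun_subadd[OF LD(1,5), of "y - c m" "c m"] by (simp add: inner_diff_right)
    ultimately show "?g y \<le> 1" by linarith
  qed
  have disj: "disjoint_family (\<lambda>m. ball (c m) r)"
    unfolding disjoint_family_on_def
  proof (intro ballI impI)
    fix m k :: nat assume "m \<noteq> k"
    have "dist (c m) (c k) = \<bar>real m - real k\<bar> * (2 * r)"
    proof -
      have "dist (c m) (c k) = \<bar>real m * (2 * r / norm u) - real k * (2 * r / norm u)\<bar> * norm u"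
        unfolding c_def dist_norm scaleR_left_diff_distrib[symmetric] by simp
      also have "\<dots> = \<bar>real m - real k\<bar> * \<bar>2 * r / norm u\<bar> * norm u" unfolding left_diff_distrib[symmetric] abs_mult ..
      finally show ?thesis using u(1) r(1) by simp
    qed
    moreover have "1 \<le> \<bar>real m - real k\<bar>" using \<open>m \<noteq> k\<close> by linarith
    ultimately have "2 * r \<le> dist (c m) (c k)" using r(1) by simp
    then show "ball (c m) r \<inter> ball (c k) r = {}" by (intro disjoint_ballI) simp
  qed
  have "(\<Sum>m. emeasure lborel (ball (c m) r)) = emeasure lborel (\<Union>m. ball (c m) r)"
    by (rule suminf_emeasure) (use disj in auto)
  also have "\<dots> \<le> emeasure lborel {y. ?g y \<le> 1}"
    by (rule emeasure_mono[OF sub])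
       (auto intro!: borel_closed closed_Collect_le continuous_intros support_fun_continuous LD)
  finally have le: "(\<Sum>m. emeasure lborel (ball (c m) r)) \<le> emeasure lborel {y. ?g y \<le> 1}" .
  define w where "w = unit_ball_vol (real DIM('a)) * r ^ DIM('a)"
  have w: "0 < w" using r(1) by (simp add: w_def)
  have "emeasure lborel {y. ?g y \<le> 1} = \<infinity>"
  proof (cases "emeasure lborel {y. ?g y \<le> 1}")
    case (real v)
    obtain m :: nat where m: "v / w < real m" using reals_Archimedean2 by blast
    have "ennreal (real m * w) = (\<Sum>i<m. emeasure lborel (ball (c i) r))"
      using r(1) w by (simp add: emeasure_ball w_def[symmetric] ennreal_mult ennreal_of_nat_eq_real_of_nat)
    also have "\<dots> \<le> ennreal v"
      using order_trans[OF sum_le_suminf le] real by auto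
    finally have "real m * w \<le> v" using real by (simp add: ennreal_le_iff)
    then show ?thesis using m w by (simp add: field_simps)
  qed simp
  moreover have "Gamma (real DIM('a) + 1) > 0" by (intro Gamma_real_pos) simp
  ultimately show ?thesis using exp_int_eq[OF L x(1), of UNIV] by (simp add: ennreal_mult_top less_imp_neq[THEN not_sym])
qed

lemma exp_int_convex:
  fixes L :: "'a::euclidean_space set"
  assumes "compact L" "L \<noteq> {}" and [measurable]: "A \<in> sets borel" and t: "0 \<le> t" "t \<le> 1"
  shows "exp_int L A ((1 - t) *\<^sub>R x + t *\<^sub>R z) \<le> ennreal (1 - t) * exp_int L A x + ennreal t * exp_int L A z"
proof -
  have [measurable]: "support_fun L \<in> borel_measurable borel" using support_fun_measurable assms by blast
  have "exp_int L A ((1 - t) *\<^sub>R x + t *\<^sub>R z)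
      \<le> (\<integral>\<^sup>+y. ennreal (1 - t) * (indicator A y * ennreal (exp (x \<bullet> y - support_fun L y)))
           + ennreal t * (indicator A y * ennreal (exp (z \<bullet> y - support_fun L y))) \<partial>lborel)"
    unfolding exp_int_def
  proof (intro nn_integral_mono)
    fix y
    have "((1 - t) *\<^sub>R x + t *\<^sub>R z) \<bullet> y - support_fun L y
        = (1 - t) *\<^sub>R (x \<bullet> y - support_fun L y) + t *\<^sub>R (z \<bullet> y - support_fun L y)"
      by (simp add: inner_add_left algebra_simps)
    then have "exp (((1 - t) *\<^sub>R x + t *\<^sub>R z) \<bullet> y - support_fun L y)
        \<le> (1 - t) * exp (x \<bullet> y - support_fun L y) + t * exp (z \<bullet> y - support_fun L y)"
      using convex_onD[OF exp_convex t] by simp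
    then have "ennreal (exp (((1 - t) *\<^sub>R x + t *\<^sub>R z) \<bullet> y - support_fun L y))
       \<le> ennreal (1 - t) * ennreal (exp (x \<bullet> y - support_fun L y)) + ennreal t * ennreal (exp (z \<bullet> y - support_fun L y))"
      using t by (simp add: ennreal_mult[symmetric] ennreal_plus[symmetric] del: ennreal_plus)
    then show "indicator A y * ennreal (exp (((1 - t) *\<^sub>R x + t *\<^sub>R z) \<bullet> y - support_fun L y))
       \<le> ennreal (1 - t) * (indicator A y * ennreal (exp (x \<bullet> y - support_fun L y)))
           + ennreal t * (indicator A y * ennreal (exp (z \<bullet> y - support_fun L y)))"
      by (auto simp: indicator_def)
  qed
  also have "\<dots> = ennreal (1 - t) * exp_int L A x + ennreal t * exp_int L A z"
    unfolding exp_int_def by (subst nn_integral_add) (simp_all add: nn_integral_cmult)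
  finally show ?thesis .
qed

lemma exp_int_lower_semicontinuous:
  fixes L :: "'a::euclidean_space set"
  assumes "compact L" "L \<noteq> {}" and lim: "(\<lambda>i. X i) \<longlonglongrightarrow> x" and le: "\<And>i. exp_int L UNIV (X i) \<le> b i" and b: "b \<longlonglongrightarrow> c"
  shows "exp_int L UNIV x \<le> c"
proof -
  have [measurable]: "support_fun L \<in> borel_measurable borel" using support_fun_measurable assms by blast
  have "ennreal (exp (x \<bullet> y - support_fun L y)) = liminf (\<lambda>i. ennreal (exp (X i \<bullet> y - support_fun L y)))" for y
    by (rule lim_imp_Liminf[symmetric]) (auto intro!: tendsto_intros lim)
  then have "exp_int L UNIV x = (\<integral>\<^sup>+y. liminf (\<lambda>i. ennreal (exp (X i \<bullet> y - support_fun L y))) \<partial>lborel)"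
    unfolding exp_int_def by simp
  also have "\<dots> \<le> liminf (\<lambda>i. \<integral>\<^sup>+y. ennreal (exp (X i \<bullet> y - support_fun L y)) \<partial>lborel)"
    by (rule nn_integral_liminf) measurable
  also have "\<dots> = liminf (\<lambda>i. exp_int L UNIV (X i))" unfolding exp_int_def by simp
  also have "\<dots> \<le> liminf b" using le by (intro Liminf_mono) auto
  also have "\<dots> = c" using b by (intro lim_imp_Liminf) auto
  finally show ?thesis .
qed

section \<open>The Santalo point\<close>

lemma Gamma_DIM_pos: "0 < Gamma (real DIM('a::euclidean_space) + 1)"
  by (intro Gamma_real_pos) simp

lemma AE_lborel_inner_nonzero:
  fixes k :: "'a::euclidean_space"
  assumes "k \<noteq> 0"
  shows "AE y in lborel. k \<bullet> y \<noteq> 0"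
proof -
  have cl: "closed {y. k \<bullet> y = 0}" by (rule closed_hyperplane)
  have "negligible {y. k \<bullet> y = 0}" using assms by (intro negligible_hyperplane) auto
  then have "{y. k \<bullet> y = 0} \<in> null_sets lebesgue" by (simp add: negligible_iff_null_sets)
  then have "{y. k \<bullet> y = 0} \<in> null_sets lborel"
    using cl by (auto simp: null_sets_def emeasure_completion)
  then show ?thesis by (rule AE_I') auto
qed

text \<open>A minimizing sequence has a limit point in \<open>L\<close>. By semicontinuity \<open>exp_int L UNIV\<close> is at most the
  infimum there, hence finite, and \<open>exp_int_frontier\<close> puts the point in the interior.\<close>

lemma santalo_point_exists:
  fixes L :: "'a::euclidean_space set"
  assumes L: "L \<in> convex_bodies_o"
  shows "\<exists>s\<in>interior L. \<forall>x\<in>interior L. vol (polar_wrt L s) \<le> vol (polar_wrt L x)"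
proof -
  note LD = convex_bodies_oD[OF L]
  define \<kappa> where "\<kappa> = Gamma (real DIM('a) + 1)"
  have \<kappa>: "0 < \<kappa>" unfolding \<kappa>_def by (rule Gamma_DIM_pos)
  define m where "m = (INF x\<in>interior L. vol (polar_wrt L x))"
  have bdd: "bdd_below ((\<lambda>x. vol (polar_wrt L x)) ` interior L)" by (rule bdd_belowI2[of _ 0]) simp
  have "\<exists>x\<in>interior L. vol (polar_wrt L x) < m + 1 / real (Suc i)" for i
    using cInf_lessD[of "(\<lambda>x. vol (polar_wrt L x)) ` interior L" "m + 1 / real (Suc i)"] LD(8) unfolding m_def by auto
  then obtain X where X: "\<And>i. X i \<in> interior L" "\<And>i. vol (polar_wrt L (X i)) < m + 1 / real (Suc i)" by metis
  have "\<forall>i. X i \<in> L" using X(1) interior_subset by blast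
  then obtain s r where s: "s \<in> L" "strict_mono (r::nat \<Rightarrow> nat)" "(X \<circ> r) \<longlonglongrightarrow> s"
    using LD(1) unfolding compact_def by blast
  have lim: "(\<lambda>i. ennreal (\<kappa> * (m + 1 / real (Suc (r i))))) \<longlonglongrightarrow> ennreal (\<kappa> * m)"
  proof (intro tendsto_ennrealI)
    have "((\<lambda>i. 1 / real (Suc i)) \<circ> r) \<longlonglongrightarrow> 0"
      using lim_inverse_n' LIMSEQ_inverse_real_of_nat s(2) by (intro LIMSEQ_subseq_LIMSEQ) (auto simp: inverse_eq_divide)
    then have "(\<lambda>i. \<kappa> * (m + 1 / real (Suc (r i)))) \<longlonglongrightarrow> \<kappa> * (m + 0)"
      by (intro tendsto_intros) (simp add: o_def)
    then show "(\<lambda>i. \<kappa> * (m + 1 / real (Suc (r i)))) \<longlonglongrightarrow> \<kappa> * m" by simp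
  qed
  have "exp_int L UNIV s \<le> ennreal (\<kappa> * m)"
  proof (rule exp_int_lower_semicontinuous[OF LD(1,5) s(3) _ lim])
    fix i show "exp_int L UNIV ((X \<circ> r) i) \<le> ennreal (\<kappa> * (m + 1 / real (Suc (r i))))"
      using X(2)[of "r i"] \<kappa> unfolding o_def exp_int_interior[OF L X(1)] \<kappa>_def[symmetric]
      by (intro ennreal_leI mult_left_mono) auto
  qed
  moreover from this have s_int: "s \<in> interior L"
    using exp_int_frontier[OF L s(1)] ennreal_less_top[of "\<kappa> * m"] by (metis infinity_ennreal_def not_le)
  ultimately have "\<kappa> * vol (polar_wrt L s) \<le> \<kappa> * m \<or> m < 0"
    unfolding exp_int_interior[OF L s_int] \<kappa>_def[symmetric] using \<kappa>
    by (metis ennreal_le_iff mult_nonneg_nonneg less_imp_le not_le)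
  moreover have "0 \<le> m" unfolding m_def using LD(8) by (intro cINF_greatest) auto
  ultimately have "vol (polar_wrt L s) \<le> m" using \<kappa> by auto
  then show ?thesis using s_int cINF_lower[OF bdd] unfolding m_def by (meson order_trans)
qed

text \<open>The exponential function is strictly convex and \<open>s \<bullet> y \<noteq> t \<bullet> y\<close> for almost all \<open>y\<close>, so the midpoint
  of two distinct minimizers would be strictly better.\<close>

lemma santalo_point_unique:
  fixes L :: "'a::euclidean_space set"
  assumes L: "L \<in> convex_bodies_o"
    and s: "s \<in> interior L" "\<And>x. x \<in> interior L \<Longrightarrow> vol (polar_wrt L s) \<le> vol (polar_wrt L x)"
    and t: "t \<in> interior L" "\<And>x. x \<in> interior L \<Longrightarrow> vol (polar_wrt L t) \<le> vol (polar_wrt L x)"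
  shows "s = t"
proof (rule ccontr)
  assume "s \<noteq> t"
  note LD = convex_bodies_oD[OF L]
  have [measurable]: "support_fun L \<in> borel_measurable borel" using support_fun_measurable LD by blast
  define x where "x = (1/2) *\<^sub>R s + (1/2) *\<^sub>R t"
  have x: "x \<in> interior L" unfolding x_def
    using convexD[OF convex_interior[OF LD(2)] s(1) t(1), of "1/2" "1/2"] by simp
  have eq: "vol (polar_wrt L s) = vol (polar_wrt L t)" using s t by (intro antisym) auto
  have fin: "exp_int L UNIV x \<noteq> \<infinity>" unfolding exp_int_interior[OF L x] by simp
  let ?f = "\<lambda>y. ennreal (exp (x \<bullet> y - support_fun L y))"
  let ?g = "\<lambda>y. (ennreal (exp (s \<bullet> y - support_fun L y)) + ennreal (exp (t \<bullet> y - support_fun L y))) / 2"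
  have g: "?g y = ennreal ((exp (s \<bullet> y - support_fun L y) + exp (t \<bullet> y - support_fun L y)) / 2)" for y
    by (subst ennreal_divide_numeral[symmetric]) auto
  have mid: "exp (x \<bullet> y - support_fun L y) \<le> (exp (s \<bullet> y - support_fun L y) + exp (t \<bullet> y - support_fun L y)) / 2"
    and strict: "s \<bullet> y \<noteq> t \<bullet> y \<Longrightarrow> exp (x \<bullet> y - support_fun L y) < (exp (s \<bullet> y - support_fun L y) + exp (t \<bullet> y - support_fun L y)) / 2" for y
  proof -
    define a b where "a = exp ((s \<bullet> y - support_fun L y) / 2)" and "b = exp ((t \<bullet> y - support_fun L y) / 2)"
    have e: "exp (s \<bullet> y - support_fun L y) = a ^ 2" "exp (t \<bullet> y - support_fun L y) = b ^ 2" "exp (x \<bullet> y - support_fun L y) = a * b"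
      unfolding a_def b_def x_def by (auto simp: power2_eq_square mult_exp_exp inner_add_left diff_divide_distrib)
    have sq: "(a ^ 2 + b ^ 2) / 2 - a * b = (a - b) ^ 2 / 2" by (simp add: power2_diff field_simps)
    then show "exp (x \<bullet> y - support_fun L y) \<le> (exp (s \<bullet> y - support_fun L y) + exp (t \<bullet> y - support_fun L y)) / 2"
      unfolding e using zero_le_power2[of "a - b"] by linarith
    assume "s \<bullet> y \<noteq> t \<bullet> y"
    then have "a \<noteq> b" unfolding a_def b_def by simp
    then have "0 < (a - b) ^ 2" by simp
    then show "exp (x \<bullet> y - support_fun L y) < (exp (s \<bullet> y - support_fun L y) + exp (t \<bullet> y - support_fun L y)) / 2"
      unfolding e using sq by linarith
  qed
  have "exp_int L UNIV x = (\<integral>\<^sup>+y. ?f y \<partial>lborel)" unfolding exp_int_def by simp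
  also have "\<dots> < (\<integral>\<^sup>+y. ?g y \<partial>lborel)"
  proof (rule nn_integral_less)
    show "AE y in lborel. ?f y \<le> ?g y" unfolding g using mid by (intro AE_I2 ennreal_leI)
    show "\<not> (AE y in lborel. ?g y \<le> ?f y)"
    proof
      assume "AE y in lborel. ?g y \<le> ?f y"
      moreover have "AE y in lborel. (s - t) \<bullet> y \<noteq> 0" using \<open>s \<noteq> t\<close> by (intro AE_lborel_inner_nonzero) simp
      ultimately have "AE y in (lborel :: 'a measure). False"
      proof eventually_elim
        case (elim y)
        then show False using strict[of y] unfolding g by (auto simp: inner_diff_left ennreal_le_iff)
      qed
      then have "ae_filter (lborel :: 'a measure) = bot" by (rule trivial_limit_def[THEN iffD2])
      then show False by (simp add: ae_filter_eq_bot_iff)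
    qed
    show "(\<integral>\<^sup>+y. ?f y \<partial>lborel) \<noteq> \<infinity>" using fin unfolding exp_int_def by simp
  qed measurable
  also have "\<dots> = (exp_int L UNIV s + exp_int L UNIV t) / 2"
    unfolding exp_int_def by (subst nn_integral_divide) (simp_all add: nn_integral_add)
  also have "\<dots> = exp_int L UNIV s"
    unfolding exp_int_interior[OF L s(1)] exp_int_interior[OF L t(1)] eq
    by (simp add: ennreal_plus[symmetric] ennreal_divide_numeral less_imp_le[OF Gamma_DIM_pos] del: ennreal_plus)
  also have "\<dots> \<le> exp_int L UNIV x"
    unfolding exp_int_interior[OF L s(1)] exp_int_interior[OF L x]
    using s(2)[OF x] less_imp_le[OF Gamma_DIM_pos] by (intro ennreal_leI mult_left_mono)
  finally show False by simp
qed

lemma santalo_point: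
  fixes L :: "'a::euclidean_space set"
  assumes L: "L \<in> convex_bodies_o"
  shows "santalo_point L \<in> interior L"
    and "x \<in> interior L \<Longrightarrow> vol (santalo_polar L) \<le> vol (polar_wrt L x)"
proof -
  have "\<exists>!s. s \<in> interior L \<and> (\<forall>x\<in>interior L. vol (polar_wrt L s) \<le> vol (polar_wrt L x))"
    using santalo_point_exists[OF L] santalo_point_unique[OF L] by blast
  from theI'[OF this] show "santalo_point L \<in> interior L"
    "x \<in> interior L \<Longrightarrow> vol (santalo_polar L) \<le> vol (polar_wrt L x)"
    unfolding santalo_point_def[symmetric] santalo_polar_def by blast+
qed

text \<open>The Santalo point of the smaller body competes in the minimum for the larger one, whose polar with
  respect to that point is smaller.\<close>

lemma santalo_volume_antimono:
  fixes L :: "'a::euclidean_space set"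
  assumes "L \<in> convex_bodies_o" "L' \<in> convex_bodies_o" "L \<subseteq> L'"
  shows "vol (santalo_polar L') \<le> vol (santalo_polar L)"
proof -
  have s: "santalo_point L \<in> interior L" "santalo_point L \<in> interior L'"
    using santalo_point(1)[OF assms(1)] interior_mono[OF assms(3)] by auto
  have "vol (santalo_polar L') \<le> vol (polar_wrt L' (santalo_point L))" by (rule santalo_point(2)[OF assms(2) s(2)])
  also have "\<dots> \<le> vol (santalo_polar L)"
  proof -
    have "polar_wrt L' (santalo_point L) \<subseteq> polar_wrt L (santalo_point L)"
      using assms(3) unfolding polar_wrt_def polar_def by blast
    then have "emeasure lborel {y. support_fun L' y - santalo_point L \<bullet> y \<le> 1} \<le> emeasure lborel {y. support_fun L y - santalo_point L \<bullet> y \<le> 1}"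
      using polar_sublevel_measure(2)[OF assms(1) s(1)] convex_bodies_oD[OF assms(1)] convex_bodies_oD[OF assms(2)]
      by (intro emeasure_mono) (auto simp: polar_wrt_eq)
    then show ?thesis
      unfolding polar_sublevel_measure(1)[OF assms(1) s(1)] polar_sublevel_measure(1)[OF assms(2) s(2)] santalo_polar_def
      by simp
  qed
  finally show ?thesis .
qed

section \<open>Points with equal half volumes of the polar body\<close>

lemma exp_int_split:
  fixes L :: "'a::euclidean_space set"
  assumes "compact L" "L \<noteq> {}" "k \<noteq> 0"
  shows "exp_int L UNIV x = exp_int L {y. 0 < k \<bullet> y} x + exp_int L {y. k \<bullet> y < 0} x"
proof -
  have [measurable]: "support_fun L \<in> borel_measurable borel" using support_fun_measurable assms by blast
  have [measurable]: "{y. 0 < k \<bullet> y} \<in> sets borel" "{y. k \<bullet> y < 0} \<in> sets borel"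
    by (auto intro!: borel_open open_Collect_less continuous_intros)
  have "exp_int L UNIV x = (\<integral>\<^sup>+y. indicator {y. 0 < k \<bullet> y} y * ennreal (exp (x \<bullet> y - support_fun L y))
       + indicator {y. k \<bullet> y < 0} y * ennreal (exp (x \<bullet> y - support_fun L y)) \<partial>lborel)"
    unfolding exp_int_def
    by (intro nn_integral_cong_AE eventually_mono[OF AE_lborel_inner_nonzero[OF assms(3)]]) (auto simp: indicator_def)
  also have "\<dots> = exp_int L {y. 0 < k \<bullet> y} x + exp_int L {y. k \<bullet> y < 0} x"
    unfolding exp_int_def by (rule nn_integral_add) measurable
  finally show ?thesis .
qed

lemma exp_int_mono_set: "A \<subseteq> B \<Longrightarrow> exp_int L A x \<le> exp_int L B x"
  unfolding exp_int_def by (intro nn_integral_mono) (auto simp: indicator_def)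

lemma exp_int_halfspace_antimono:
  fixes L :: "'a::euclidean_space set"
  assumes "s \<le> t"
  shows "exp_int L {y. k \<bullet> y < 0} (x + t *\<^sub>R k) \<le> exp_int L {y. k \<bullet> y < 0} (x + s *\<^sub>R k)"
  unfolding exp_int_def
proof (intro nn_integral_mono)
  fix y
  have "k \<bullet> y < 0 \<Longrightarrow> t * (k \<bullet> y) \<le> s * (k \<bullet> y)" using assms by (intro mult_right_mono_neg) auto
  then show "indicator {y. k \<bullet> y < 0} y * ennreal (exp ((x + t *\<^sub>R k) \<bullet> y - support_fun L y))
      \<le> indicator {y. k \<bullet> y < 0} y * ennreal (exp ((x + s *\<^sub>R k) \<bullet> y - support_fun L y))"
    by (auto simp: indicator_def inner_add_left intro!: ennreal_leI)
qed

text \<open>Towards the end of the line segment in \<open>L\<close>, the volume of the whole polar body tends to infinity,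
  while its half in the direction \<open>- k\<close> decreases.\<close>

lemma half_volume_blowup:
  fixes L :: "'a::euclidean_space set"
  assumes L: "L \<in> convex_bodies_o" and k: "k \<noteq> 0" and \<tau>: "x + \<tau> *\<^sub>R k \<in> interior L"
  shows "\<exists>t. x + t *\<^sub>R k \<in> interior L \<and> exp_int L {y. k \<bullet> y < 0} (x + t *\<^sub>R k) < exp_int L {y. 0 < k \<bullet> y} (x + t *\<^sub>R k)"
proof (rule ccontr)
  assume contra: "\<not> ?thesis"
  note LD = convex_bodies_oD[OF L]
  define T where "T = {t. x + t *\<^sub>R k \<in> interior L}"
  have op: "open T" unfolding T_def
  proof -
    have "continuous_on UNIV (\<lambda>t. x + t *\<^sub>R k)" by (intro continuous_intros)
    from open_vimage[OF open_interior this, of L] show "open {t. x + t *\<^sub>R k \<in> interior L}" by (simp add: vimage_def)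
  qed
  have "\<tau> \<in> T" using \<tau> by (simp add: T_def)
  obtain B where B: "\<And>y. y \<in> L \<Longrightarrow> norm y \<le> B" using LD(7) unfolding bounded_iff by blast
  have bdd: "bdd_above T"
  proof (rule bdd_aboveI)
    fix t assume "t \<in> T"
    then have "norm (x + t *\<^sub>R k) \<le> B" using B interior_subset unfolding T_def by blast
    then have "norm (t *\<^sub>R k) \<le> B + norm x" using norm_triangle_ineq4[of "x + t *\<^sub>R k" x] by simp
    then have "\<bar>t\<bar> \<le> (B + norm x) / norm k" using k by (simp add: field_simps)
    then show "t \<le> (B + norm x) / norm k" by linarith
  qed
  define s where "s = Sup T"
  have s_notin: "s \<notin> T"
  proof
    assume "s \<in> T"
    then obtain e where e: "0 < e" "cball s e \<subseteq> T" using op open_contains_cball by blast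
    then have "s + e \<in> T" by (intro subsetD[OF e(2)]) (simp add: dist_real_def)
    then show False using cSup_upper[OF _ bdd] e(1) unfolding s_def by fastforce
  qed
  have le_s: "t \<le> s" if "t \<in> T" for t using cSup_upper[OF that bdd] unfolding s_def .
  have "\<tau> < s" using le_s[OF \<open>\<tau> \<in> T\<close>] s_notin \<open>\<tau> \<in> T\<close> by (cases "\<tau> = s") auto
  have "\<exists>t\<in>T. max \<tau> (s - 1 / real (Suc i)) < t" for i
    using less_cSupD[of T "max \<tau> (s - 1 / real (Suc i))"] \<open>\<tau> \<in> T\<close> \<open>\<tau> < s\<close> unfolding s_def[symmetric] by auto
  then obtain Y where Y: "\<And>i. Y i \<in> T" "\<And>i. max \<tau> (s - 1 / real (Suc i)) < Y i" by metis
  have Ylim: "Y \<longlonglongrightarrow> s"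
  proof (rule tendsto_sandwich)
    have "(\<lambda>i. s - 1 / real (Suc i)) \<longlonglongrightarrow> s - 0"
      using LIMSEQ_inverse_real_of_nat by (intro tendsto_intros) (simp add: inverse_eq_divide)
    then show "(\<lambda>i. s - 1 / real (Suc i)) \<longlonglongrightarrow> s" by simp
    show "(\<lambda>i. s) \<longlonglongrightarrow> s" by simp
    show "\<forall>\<^sub>F i in sequentially. s - 1 / real (Suc i) \<le> Y i" using Y(2) by (auto intro!: always_eventually less_imp_le)
    show "\<forall>\<^sub>F i in sequentially. Y i \<le> s" using Y(1) le_s by (auto intro!: always_eventually)
  qed
  have xlim: "(\<lambda>i. x + Y i *\<^sub>R k) \<longlonglongrightarrow> x + s *\<^sub>R k" by (intro tendsto_intros Ylim)
  have "x + s *\<^sub>R k \<in> L"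
    using Y(1) interior_subset unfolding T_def by (intro closed_sequentially[OF LD(6) _ xlim]) blast
  define C where "C = exp_int L {y. k \<bullet> y < 0} (x + \<tau> *\<^sub>R k) + exp_int L {y. k \<bullet> y < 0} (x + \<tau> *\<^sub>R k)"
  have "exp_int L UNIV (x + s *\<^sub>R k) \<le> C"
  proof (rule exp_int_lower_semicontinuous[OF LD(1,5) xlim])
    fix i
    have "exp_int L {y. 0 < k \<bullet> y} (x + Y i *\<^sub>R k) \<le> exp_int L {y. k \<bullet> y < 0} (x + Y i *\<^sub>R k)"
      using contra Y(1)[of i] unfolding T_def by (auto simp: not_less)
    also have le: "\<dots> \<le> exp_int L {y. k \<bullet> y < 0} (x + \<tau> *\<^sub>R k)"
      using Y(2)[of i] by (intro exp_int_halfspace_antimono) auto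
    finally show "exp_int L UNIV (x + Y i *\<^sub>R k) \<le> C"
      unfolding exp_int_split[OF LD(1,5) k] C_def using le by (rule add_mono)
  qed simp
  also have "C < \<infinity>"
  proof -
    have "exp_int L {y. k \<bullet> y < 0} (x + \<tau> *\<^sub>R k) \<le> exp_int L UNIV (x + \<tau> *\<^sub>R k)" by (rule exp_int_mono_set) simp
    also have "\<dots> < \<infinity>" unfolding exp_int_interior[OF L \<tau>] by simp
    finally show ?thesis unfolding C_def by (auto simp: less_top)
  qed
  finally have "x + s *\<^sub>R k \<in> interior L"
    using exp_int_frontier[OF L \<open>x + s *\<^sub>R k \<in> L\<close>] by fastforce
  then show False using s_notin by (simp add: T_def)
qed

text \<open>The two half volumes are convex along the line, hence continuous. By \<open>half_volume_blowup\<close>, for \<open>k\<close>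
  and for \<open>- k\<close>, each of them exceeds the other one somewhere.\<close>

lemma equal_half_volumes:
  fixes L :: "'a::euclidean_space set"
  assumes L: "L \<in> convex_bodies_o" and k: "k \<noteq> 0" and \<tau>: "x + \<tau> *\<^sub>R k \<in> interior L"
  shows "\<exists>t. x + t *\<^sub>R k \<in> interior L \<and>
    emeasure lborel {y \<in> {y. 0 < k \<bullet> y}. support_fun L y - (x + t *\<^sub>R k) \<bullet> y \<le> 1}
      = emeasure lborel {y \<in> {y. k \<bullet> y < 0}. support_fun L y - (x + t *\<^sub>R k) \<bullet> y \<le> 1}"
proof -
  note LD = convex_bodies_oD[OF L]
  let ?P = "{y. 0 < k \<bullet> y}" and ?N = "{y. k \<bullet> y < 0}"
  have ms: "?P \<in> sets borel" "?N \<in> sets borel"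
    by (auto intro!: borel_open open_Collect_less continuous_intros)
  define T where "T = {t. x + t *\<^sub>R k \<in> interior L}"
  have op: "open T" unfolding T_def
  proof -
    have "continuous_on UNIV (\<lambda>t. x + t *\<^sub>R k)" by (intro continuous_intros)
    from open_vimage[OF open_interior this, of L] show "open {t. x + t *\<^sub>R k \<in> interior L}" by (simp add: vimage_def)
  qed
  have comb: "x + ((1 - u) * s + u * t) *\<^sub>R k = (1 - u) *\<^sub>R (x + s *\<^sub>R k) + u *\<^sub>R (x + t *\<^sub>R k)" for u s t
    by (simp add: algebra_simps)
  have convT: "convex T" unfolding convex_alt T_def
    using convex_interior[OF LD(2)] unfolding convex_alt by (auto simp: comb)
  have fin: "exp_int L A (x + t *\<^sub>R k) < \<infinity>" if "t \<in> T" for A t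
  proof -
    have "exp_int L A (x + t *\<^sub>R k) \<le> exp_int L UNIV (x + t *\<^sub>R k)" by (rule exp_int_mono_set) simp
    also have "\<dots> < \<infinity>" using that exp_int_interior[OF L] unfolding T_def by simp
    finally show ?thesis .
  qed
  define F where "F A t = enn2real (exp_int L A (x + t *\<^sub>R k))" for A t
  have F: "exp_int L A (x + t *\<^sub>R k) = ennreal (F A t)" "0 \<le> F A t" if "t \<in> T" for A t
    unfolding F_def using fin[OF that, of A] by auto
  have convF: "convex_on T (F A)" if A: "A \<in> sets borel" for A
  proof (rule convex_onI[OF _ convT])
    fix u s t :: real assume u: "0 < u" "u < 1" and st: "s \<in> T" "t \<in> T"
    have mem: "(1 - u) *\<^sub>R s + u *\<^sub>R t \<in> T" using convexD_alt[OF convT st, of u] u by simp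
    have "ennreal (F A ((1 - u) *\<^sub>R s + u *\<^sub>R t)) \<le> ennreal (1 - u) * ennreal (F A s) + ennreal u * ennreal (F A t)"
      using exp_int_convex[OF LD(1,5) A, of u "x + s *\<^sub>R k" "x + t *\<^sub>R k"] u
      unfolding F(1)[OF mem, symmetric] F(1)[OF st(1), symmetric] F(1)[OF st(2), symmetric]
      by (simp only: comb[symmetric] real_scaleR_def)
    also have "\<dots> = ennreal ((1 - u) * F A s + u * F A t)"
      using u F(2)[OF st(1)] F(2)[OF st(2)] by (simp add: ennreal_mult[symmetric] ennreal_plus[symmetric] del: ennreal_plus)
    finally show "F A ((1 - u) *\<^sub>R s + u *\<^sub>R t) \<le> (1 - u) * F A s + u * F A t"
      using u F(2)[OF st(1)] F(2)[OF st(2)] by (subst (asm) ennreal_le_iff) auto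
  qed
  define D where "D t = F ?P t - F ?N t" for t
  have cont: "continuous_on T D" unfolding D_def
    using convex_on_continuous[OF op convF] ms by (intro continuous_intros) auto
  obtain a where a: "a \<in> T" "0 < D a"
  proof -
    obtain t where t: "t \<in> T" "exp_int L ?N (x + t *\<^sub>R k) < exp_int L ?P (x + t *\<^sub>R k)"
      using half_volume_blowup[OF L k \<tau>] unfolding T_def by blast
    then show ?thesis using that[of t] F(2)[OF t(1)] unfolding F(1)[OF t(1)] D_def by (simp add: ennreal_less_iff)
  qed
  obtain b where b: "b \<in> T" "D b < 0"
  proof -
    have k': "- k \<noteq> 0" and \<tau>': "x + (- \<tau>) *\<^sub>R (- k) \<in> interior L" using k \<tau> by auto
    obtain t where t: "x + t *\<^sub>R (- k) \<in> interior L"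
        "exp_int L {y. - k \<bullet> y < 0} (x + t *\<^sub>R (- k)) < exp_int L {y. 0 < - k \<bullet> y} (x + t *\<^sub>R (- k))"
      using half_volume_blowup[OF L k' \<tau>'] by blast
    then have t': "- t \<in> T" "exp_int L ?P (x + (- t) *\<^sub>R k) < exp_int L ?N (x + (- t) *\<^sub>R k)" unfolding T_def by simp_all
    show ?thesis using that[of "- t"] t'(2) F(2)[OF t'(1)] unfolding F(1)[OF t'(1)] D_def by (simp add: ennreal_less_iff t'(1))
  qed
  have "connected (D ` T)" by (rule connected_continuous_image[OF cont convex_connected[OF convT]])
  then have "0 \<in> D ` T"
    using a b by (auto simp: connected_iff_interval dest!: bspec[of _ _ "D b"] bspec[of _ _ "D a"] spec[of _ 0])
  then obtain t where t: "t \<in> T" "D t = 0" by auto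
  then have x: "x + t *\<^sub>R k \<in> interior L" "x + t *\<^sub>R k \<in> L" using interior_subset unfolding T_def by auto
  have "exp_int L ?P (x + t *\<^sub>R k) = exp_int L ?N (x + t *\<^sub>R k)" using t unfolding F(1)[OF t(1)] D_def by simp
  moreover have "exp_int L ?P (x + t *\<^sub>R k) = ennreal (Gamma (real DIM('a) + 1)) * emeasure lborel {y \<in> ?P. support_fun L y - (x + t *\<^sub>R k) \<bullet> y \<le> 1}"
    by (rule exp_int_eq[OF L x(2) ms(1)]) auto
  moreover have "exp_int L ?N (x + t *\<^sub>R k) = ennreal (Gamma (real DIM('a) + 1)) * emeasure lborel {y \<in> ?N. support_fun L y - (x + t *\<^sub>R k) \<bullet> y \<le> 1}"
    by (rule exp_int_eq[OF L x(2) ms(2)]) (auto simp: mult_pos_neg)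
  ultimately show ?thesis using x(1) Gamma_DIM_pos[where 'a='a]
    by (intro exI[of _ t]) (auto simp: ennreal_mult_cancel_left)
qed

section \<open>Convex bodies with a prescribed support function\<close>

definition wulff :: "('a::euclidean_space \<Rightarrow> real) \<Rightarrow> 'a set" where
  "wulff h = {x. \<forall>u. u \<bullet> x \<le> h u}"

lemma wulff_mono: "(\<And>u. h u \<le> h' u) \<Longrightarrow> wulff h \<subseteq> wulff h'"
  unfolding wulff_def using order_trans by blast

text \<open>If the support function were smaller than \<open>h\<close> somewhere, then after scaling \<open>support_fun (wulff h) v \<le> 1 < h v\<close> for some \<open>v\<close>.
  A hyperplane separating \<open>v\<close> from the convex set \<open>h u \<le> 1\<close> yields a point \<open>x\<close> of \<open>wulff h\<close> with
  \<open>v \<bullet> x > 1\<close>.\<close>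

lemma wulff_support_fun:
  fixes h :: "'a::euclidean_space \<Rightarrow> real"
  assumes scale: "\<And>c u. 0 \<le> c \<Longrightarrow> h (c *\<^sub>R u) = c * h u"
    and subadd: "\<And>u v. h (u + v) \<le> h u + h v"
    and pos: "\<And>u. u \<noteq> 0 \<Longrightarrow> 0 < h u"
  shows "wulff h \<in> convex_bodies_o" and "support_fun (wulff h) = h"
proof -
  have h0: "h 0 = 0" using scale[of 0 0] by simp
  have conv: "convex_on UNIV h"
  proof (rule convex_onI)
    fix t :: real and x y :: 'a assume "0 < t" "t < 1"
    then show "h ((1 - t) *\<^sub>R x + t *\<^sub>R y) \<le> (1 - t) * h x + t * h y"
      using subadd[of "(1 - t) *\<^sub>R x" "t *\<^sub>R y"] scale by simp
  qed simp
  have cont: "continuous_on A h" for A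
    using convex_on_continuous[OF open_UNIV conv] continuous_on_subset by blast
  have eq: "wulff h = (\<Inter>u. {x. u \<bullet> x \<le> h u})" unfolding wulff_def by blast
  have cl: "closed (wulff h)" unfolding eq by (intro closed_INT ballI closed_halfspace_le)
  have cv: "convex (wulff h)" unfolding eq by (intro convex_INT convex_halfspace_le)
  have bd: "bounded (wulff h)"
  proof -
    have "norm x \<le> (\<Sum>b\<in>Basis. max (h b) (h (- b)))" if "x \<in> wulff h" for x
    proof -
      have "b \<bullet> x \<le> h b" "- b \<bullet> x \<le> h (- b)" for b using that unfolding wulff_def by blast+
      then have "\<bar>x \<bullet> b\<bar> \<le> max (h b) (h (- b))" for b
        unfolding inner_commute[of x b] by (metis abs_if inner_minus_left max.coboundedI1 max.coboundedI2)
      then show ?thesis by (intro order_trans[OF norm_le_l1] sum_mono) auto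
    qed
    then show ?thesis unfolding bounded_iff by blast
  qed
  have comp: "compact (wulff h)" using cl bd by (simp add: compact_eq_bounded_closed)
  have "sphere (0::'a) 1 \<noteq> {}" by simp
  then obtain w where w: "w \<in> sphere 0 1" "\<And>v. v \<in> sphere 0 1 \<Longrightarrow> h w \<le> h v"
    using continuous_attains_inf[of "sphere (0::'a) 1" h] cont by auto
  have "w \<noteq> 0" using w(1) by auto
  then have hw: "0 < h w" by (rule pos)
  have low: "h w * norm u \<le> h u" for u
  proof (cases "u = 0")
    case False
    have "norm u * h w \<le> norm u * h ((1 / norm u) *\<^sub>R u)"
      using w(2)[of "(1 / norm u) *\<^sub>R u"] False by (intro mult_left_mono) auto
    also have "\<dots> = h u" using False scale[of "1 / norm u" u] by simp
    finally show ?thesis by (simp add: mult.commute)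
  qed (simp add: h0)
  have "ball 0 (h w) \<subseteq> wulff h"
  proof
    fix x :: 'a assume "x \<in> ball 0 (h w)"
    then have "u \<bullet> x \<le> h u" for u
      using order_trans[OF norm_cauchy_schwarz[of u x] order_trans[OF _ low[of u]]]
      by (simp add: mult.commute mult_left_mono)
    then show "x \<in> wulff h" unfolding wulff_def by blast
  qed
  then have "0 \<in> interior (wulff h)" using hw by (meson centre_in_ball interiorI open_ball)
  then show K: "wulff h \<in> convex_bodies_o" using comp cv unfolding convex_bodies_o_def by blast
  note KD = convex_bodies_oD[OF K]
  \<comment> \<open>This set turns out to be the polar of \<open>wulff h\<close>.\<close>
  have C: "closed {u. h u \<le> 1}" "convex {u. h u \<le> 1}"
  proof -
    show "closed {u. h u \<le> 1}" by (intro closed_Collect_le continuous_intros cont)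
    show "convex {u. h u \<le> 1}" unfolding convex_alt
    proof safe
      fix x y t assume "h x \<le> 1" "h y \<le> 1" "0 \<le> t" "t \<le> (1::real)"
      then show "h ((1 - t) *\<^sub>R x + t *\<^sub>R y) \<le> 1"
        using convex_onD[OF conv, of t x y] convex_bound_le[of "h x" 1 "h y" "1 - t" t] by simp
    qed
  qed
  have key: "1 < support_fun (wulff h) v" if v: "1 < h v" for v
  proof -
    obtain a b where ab: "a \<bullet> v < b" "\<And>u. h u \<le> 1 \<Longrightarrow> b < a \<bullet> u"
      using separating_hyperplane_closed_point[OF C(2,1), of v] v by auto
    have "b < 0" using ab(2)[of 0] h0 by simp
    define x where "x = (1 / b) *\<^sub>R a"
    have x1: "u \<bullet> x \<le> 1" if "h u \<le> 1" for u
      using ab(2)[OF that] \<open>b < 0\<close> unfolding x_def by (simp add: inner_commute field_simps)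
    have "x \<in> wulff h" unfolding wulff_def
    proof safe
      fix u show "u \<bullet> x \<le> h u"
      proof (cases "u = 0")
        case False
        then have "h ((1 / h u) *\<^sub>R u) \<le> 1" using scale[of "1 / h u" u] pos[OF False] by simp
        from x1[OF this] show ?thesis using pos[OF False] by (simp add: field_simps)
      qed (simp add: h0)
    qed
    then have "v \<bullet> x \<le> support_fun (wulff h) v" by (intro support_fun_upper comp)
    moreover have "1 < v \<bullet> x" using ab(1) \<open>b < 0\<close> unfolding x_def by (simp add: inner_commute field_simps)
    ultimately show ?thesis by simp
  qed
  show "support_fun (wulff h) = h"
  proof
    fix u
    show "support_fun (wulff h) u = h u"
    proof (rule antisym)
      show "support_fun (wulff h) u \<le> h u" using KD by (intro support_fun_least) (auto simp: wulff_def)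
      show "h u \<le> support_fun (wulff h) u"
      proof (cases "u = 0")
        case False
        show ?thesis
        proof (rule ccontr)
          assume "\<not> ?thesis"
          then have lt: "support_fun (wulff h) u < h u" by simp
          have "0 < support_fun (wulff h) u" using interior_iff_support_fun[OF K, of 0] KD(3) False by simp
          then have "1 < h ((1 / support_fun (wulff h) u) *\<^sub>R u)"
            using lt scale[of "1 / support_fun (wulff h) u" u] by simp
          from key[OF this] show False
            using support_fun_scale[OF KD(1,5), of "1 / support_fun (wulff h) u" u] \<open>0 < support_fun (wulff h) u\<close> by simp
        qed
      qed (use support_fun_scale[OF KD(1,5), of 0 0] h0 in simp)
    qed
  qed
qed

lemma body_with_support_pow_eq:
  fixes h :: "'a::euclidean_space \<Rightarrow> real"
  assumes scale: "\<And>c u. 0 \<le> c \<Longrightarrow> h (c *\<^sub>R u) = c * h u"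
    and subadd: "\<And>u v. h (u + v) \<le> h u + h v"
    and pos: "\<And>u. u \<noteq> 0 \<Longrightarrow> 0 < h u"
    and F: "\<And>u. u \<in> sphere 0 1 \<Longrightarrow> F u = h u powr p" and p: "0 < p"
  shows "body_with_support_pow p F = wulff h"
  unfolding body_with_support_pow_def
proof (rule the_equality)
  note W = wulff_support_fun[of h, OF scale subadd pos]
  show "wulff h \<in> convex_bodies_o \<and> (\<forall>u\<in>sphere 0 1. support_fun (wulff h) u powr p = F u)"
    using W F by simp
  fix M assume M: "M \<in> convex_bodies_o \<and> (\<forall>u\<in>sphere 0 1. support_fun M u powr p = F u)"
  then have MD: "compact M" "convex M" "M \<noteq> {}" "0 \<in> interior M" using convex_bodies_oD by blast+
  have sphere: "support_fun M u = h u" if "u \<in> sphere 0 1" for u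
  proof -
    have "u \<noteq> 0" using that by auto
    have "0 < support_fun M u" using interior_iff_support_fun[of M 0] M MD(4) \<open>u \<noteq> 0\<close> by simp
    moreover have "0 < h u" using pos \<open>u \<noteq> 0\<close> by blast
    moreover have "support_fun M u powr p = h u powr p" using M F that by simp
    ultimately show ?thesis using p powr_less_mono2[of p "support_fun M u" "h u"] powr_less_mono2[of p "h u" "support_fun M u"] by linarith
  qed
  have "support_fun M u = h u" for u
  proof (cases "u = 0")
    case False
    have "support_fun M u = norm u * support_fun M ((1 / norm u) *\<^sub>R u)"
      using False support_fun_scale[OF MD(1,3), of "1 / norm u" u] by simp
    also have "\<dots> = norm u * h ((1 / norm u) *\<^sub>R u)" using False by (subst sphere) auto
    also have "\<dots> = h u" using False scale[of "1 / norm u" u] by simp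
    finally show ?thesis .
  qed (use support_fun_scale[OF MD(1,3), of 0 0] scale[of 0 0] in simp)
  then show "M = wulff h"
    using mem_iff_support_fun[OF MD(1,2,3)] unfolding wulff_def by auto
qed

section \<open>Moment bodies\<close>

text \<open>An asymmetric absolute value: a sublinear function whose \<open>p\<close>-th power is the weighted sum of the
  powers of the positive and of the negative part (\<open>askew_powr\<close>). It merges the two
  one-sided moment bodies into a single integral.\<close>

definition askew :: "real \<Rightarrow> real \<Rightarrow> real \<Rightarrow> real" where
  "askew a b t = max (a * t) (- (b * t))"

lemma askew_nonneg: "0 \<le> a \<Longrightarrow> 0 \<le> b \<Longrightarrow> 0 \<le> askew a b t"
  unfolding askew_def by (cases "0 \<le> t") (auto simp: le_max_iff_disj mult_nonneg_nonpos)

lemma askew_add: "askew a b (s + t) \<le> askew a b s + askew a b t"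
  unfolding askew_def by (auto simp: algebra_simps max_def)

lemma askew_scale: "0 \<le> c \<Longrightarrow> askew a b (c * t) = c * askew a b t"
proof -
  assume "0 \<le> c"
  then have "c * askew a b t = max (c * (a * t)) (c * (- (b * t)))" unfolding askew_def by (simp only: max_mult_distrib_left if_True)
  then show ?thesis unfolding askew_def by (simp add: mult.left_commute)
qed

text \<open>The points \<open>v + q\<close> and \<open>v - q\<close> lie on opposite sides of the kink at \<open>0\<close>. This strictness is the source
  of the equality case; a weight \<open>a\<close> or \<open>b\<close> may vanish.\<close>

lemma askew_kink:
  assumes "0 < a + b" "\<bar>v\<bar> < \<bar>q\<bar>"
  shows "2 * askew a b v < askew a b (v + q) + askew a b (v - q)"
proof -
  have main: "2 * askew a b v < askew a b (v + q) + askew a b (v - q)" if q: "\<bar>v\<bar> < q" for q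
  proof -
    have "0 < (a + b) * (q - v)" "0 < (a + b) * (q + v)" using assms(1) q by auto
    moreover have "a * (v + q) \<le> askew a b (v + q)" "- (b * (v - q)) \<le> askew a b (v - q)" unfolding askew_def by auto
    moreover have "askew a b v = a * v \<or> askew a b v = - (b * v)" unfolding askew_def by (auto simp: max_def)
    ultimately show ?thesis by (auto simp: algebra_simps)
  qed
  show ?thesis
  proof (cases "0 \<le> q")
    case True then show ?thesis using main[of q] assms by simp
  next
    case False then show ?thesis using main[of "- q"] assms by simp
  qed
qed

lemma askew_powr:
  assumes "0 \<le> a" "0 \<le> b" "0 < p"
  shows "askew a b t powr p = a powr p * max 0 t powr p + b powr p * max 0 (- t) powr p"
proof (cases "0 \<le> t")
  case True
  then have "0 \<le> a * t" "0 \<le> b * t" using assms by auto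
  then have "askew a b t = a * t" unfolding askew_def by linarith
  then show ?thesis using True assms by (simp add: powr_mult)
next
  case False
  then have "a * t \<le> 0" "b * t \<le> 0" using assms by (auto simp: mult_nonneg_nonpos)
  then have "askew a b t = b * (- t)" unfolding askew_def by linarith
  then show ?thesis using False assms powr_mult[of b "- t" p] by simp
qed

lemma askew_continuous [continuous_intros]:
  "continuous_on A f \<Longrightarrow> continuous_on A (\<lambda>x. askew a b (f x))"
  unfolding askew_def by (intro continuous_intros)

lemma askew_measurable [measurable]: "askew a b \<in> borel_measurable borel"
  unfolding askew_def[abs_def] by measurable

text \<open>With \<open>weighted_sum_eq\<close> this gives Minkowski's inequality for \<open>L\<^sup>p\<close> norms \<open>A\<close> and \<open>B\<close> after integration. The bound is
  linear in \<open>X powr p\<close> and \<open>Y powr p\<close> and its coefficients depend on the two norms only, so it can be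
  applied on one slice at a time, with a substitution that varies from slice to slice.\<close>

lemma powr_add_le_weighted:
  fixes X Y A B p :: real
  assumes "0 \<le> X" "0 \<le> Y" "0 < A" "0 < B" "1 \<le> p"
  shows "(X + Y) powr p \<le> ((A + B) / A) powr (p - 1) * X powr p + ((A + B) / B) powr (p - 1) * Y powr p"
proof -
  let ?l = "A / (A + B)" and ?k = "B / (A + B)"
  have "?l + ?k = (A + B) / (A + B)" by (simp only: add_divide_distrib)
  then have lk: "?l + ?k = 1" "0 < ?l" "0 < ?k" "1 - ?k = ?l" using assms by auto
  have coef: "?l * (X / A * (A + B)) powr p = ((A + B) / A) powr (p - 1) * X powr p"
       "?k * (Y / B * (A + B)) powr p = ((A + B) / B) powr (p - 1) * Y powr p"
  proof -
    have gen: "(1 / r) * (r * Z) powr p = r powr (p - 1) * Z powr p" if "0 < r" "0 \<le> Z" for r Z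
      using that by (simp add: powr_mult powr_diff)
    show "?l * (X / A * (A + B)) powr p = ((A + B) / A) powr (p - 1) * X powr p"
      using gen[of "(A + B) / A" X] assms by (simp add: mult.commute)
    show "?k * (Y / B * (A + B)) powr p = ((A + B) / B) powr (p - 1) * Y powr p"
      using gen[of "(A + B) / B" Y] assms by (simp add: mult.commute)
  qed
  show ?thesis
  proof (cases "X = 0 \<or> Y = 0")
    case True
    have "1 \<le> ((A + B) / A) powr (p - 1)" "1 \<le> ((A + B) / B) powr (p - 1)"
      using assms by (auto intro!: ge_one_powr_ge_zero)
    then show ?thesis using True assms mult_right_mono[of 1 _ "X powr p"] mult_right_mono[of 1 _ "Y powr p"] by auto
  next
    case False
    have e: "?l * (X / A * (A + B)) + ?k * (Y / B * (A + B)) = X + Y"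
    proof -
      have "?l * (X / A * (A + B)) = X" "?k * (Y / B * (A + B)) = Y" using assms by auto
      then show ?thesis by simp
    qed
    have "(?l * (X / A * (A + B)) + ?k * (Y / B * (A + B))) powr p \<le> ?l * (X / A * (A + B)) powr p + ?k * (Y / B * (A + B)) powr p"
      using convex_onD[OF powr_convex[OF assms(5)], of ?k "X / A * (A + B)" "Y / B * (A + B)"] assms False lk by auto
    then show ?thesis unfolding e coef .
  qed
qed

lemma weighted_sum_eq:
  fixes A B p :: real
  assumes "0 < A" "0 < B"
  shows "((A + B) / A) powr (p - 1) * A powr p + ((A + B) / B) powr (p - 1) * B powr p = (A + B) powr p"
proof -
  have "((A + B) / A) powr (p - 1) * A powr p = (A + B) powr (p - 1) * A"
       "((A + B) / B) powr (p - 1) * B powr p = (A + B) powr (p - 1) * B"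
    using assms by (auto simp: powr_divide powr_diff)
  then have "((A + B) / A) powr (p - 1) * A powr p + ((A + B) / B) powr (p - 1) * B powr p = (A + B) powr (p - 1) * (A + B)"
    by (simp add: algebra_simps)
  also have "\<dots> = (A + B) powr p" using assms by (simp add: powr_diff)
  finally show ?thesis .
qed

definition moment :: "real \<Rightarrow> real \<Rightarrow> real \<Rightarrow> 'a::euclidean_space set \<Rightarrow> 'a \<Rightarrow> real" where
  "moment p a b K u = (LINT x:K|lebesgue. askew a b (u \<bullet> x) powr p)"

definition moment_norm :: "real \<Rightarrow> real \<Rightarrow> real \<Rightarrow> 'a::euclidean_space set \<Rightarrow> 'a \<Rightarrow> real" where
  "moment_norm p a b K u = moment p a b K u powr (1 / p)"

lemma set_lebesgue_integral_eq_nn_integral: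
  fixes f :: "'a::euclidean_space \<Rightarrow> real"
  assumes K: "compact K" and f: "continuous_on UNIV f" "\<And>x. 0 \<le> f x"
  shows "ennreal (LINT x:K|lebesgue. f x) = (\<integral>\<^sup>+x. indicator K x * ennreal (f x) \<partial>lborel)"
    and "(\<lambda>x. indicator K x *\<^sub>R f x) \<in> borel_measurable borel"
    and "integrable lborel (\<lambda>x. indicator K x *\<^sub>R f x)"
proof -
  have fm [measurable]: "f \<in> borel_measurable borel" using f(1) by (rule borel_measurable_continuous_onI)
  have Kb [measurable]: "K \<in> sets borel" using K by (simp add: borel_compact)
  show m: "(\<lambda>x. indicator K x *\<^sub>R f x) \<in> borel_measurable borel" by measurable
  show i: "integrable lborel (\<lambda>x. indicator K x *\<^sub>R f x)"
    using borel_integrable_compact[OF K continuous_on_subset[OF f(1)]] by (simp add: set_integrable_def)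
  have "(LINT x:K|lebesgue. f x) = (\<integral>x. indicator K x *\<^sub>R f x \<partial>lborel)"
    unfolding set_lebesgue_integral_def by (rule integral_completion) (use m in simp)
  also have "ennreal \<dots> = (\<integral>\<^sup>+x. ennreal (indicator K x *\<^sub>R f x) \<partial>lborel)"
    by (rule nn_integral_eq_integral[symmetric, OF i]) (use f(2) in auto)
  also have "\<dots> = (\<integral>\<^sup>+x. indicator K x * ennreal (f x) \<partial>lborel)"
    by (intro nn_integral_cong) (auto simp: indicator_def)
  finally show "ennreal (LINT x:K|lebesgue. f x) = (\<integral>\<^sup>+x. indicator K x * ennreal (f x) \<partial>lborel)" .
qed

locale moment_params =
  fixes p a b :: real
  assumes p: "1 < p" and a: "0 \<le> a" and b: "0 \<le> b" and ab: "0 < a + b"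
begin

lemma askew_powr_continuous: "continuous_on UNIV (\<lambda>x. askew a b (u \<bullet> x) powr p)"
  by (intro continuous_on_powr' continuous_intros) (use p askew_nonneg[OF a b] in auto)

lemma moment_eq_nn_integral:
  assumes "compact K"
  shows "ennreal (moment p a b K u) = (\<integral>\<^sup>+x. indicator K x * ennreal (askew a b (u \<bullet> x) powr p) \<partial>lborel)"
  unfolding moment_def by (rule set_lebesgue_integral_eq_nn_integral(1)[OF assms askew_powr_continuous]) simp

lemma moment_nonneg: "0 \<le> moment p a b K u"
  unfolding moment_def set_lebesgue_integral_def by (intro integral_nonneg_AE) simp

lemma moment_norm_nonneg: "0 \<le> moment_norm p a b K u"
  unfolding moment_norm_def by simp

lemma moment_norm_powr: "moment_norm p a b K u powr p = moment p a b K u"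
  unfolding moment_norm_def using p by (simp add: powr_powr moment_nonneg)

lemma moment_pos:
  assumes K: "K \<in> convex_bodies_o" and u: "u \<noteq> 0"
  shows "0 < moment p a b K u"
proof -
  note KD = convex_bodies_oD[OF K]
  have [measurable]: "K \<in> sets borel" using KD(1) by (simp add: borel_compact)
  have "0 \<noteq> (\<integral>\<^sup>+x. indicator K x * ennreal (askew a b (u \<bullet> x) powr p) \<partial>lborel)"
  proof
    define s where "s = (if 0 < a then 1 else -1 :: real)"
    have s: "0 < askew a b t" if "0 < s * t" for t
      using that a b ab unfolding s_def askew_def by (auto split: if_splits simp: less_max_iff_disj mult_pos_neg)
    define G where "G = interior K \<inter> {x. 0 < s * (u \<bullet> x)}"
    have G: "open G" unfolding G_def by (intro open_Int open_interior open_Collect_less continuous_intros)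
    obtain e where e: "0 < e" "cball 0 e \<subseteq> interior K" using KD(3) open_contains_cball[of "interior K"] by auto
    have "(s * e / norm u) *\<^sub>R u \<in> G"
      using e u unfolding G_def by (auto simp: s_def intro!: subsetD[OF e(2)])
    then have "G \<noteq> {}" by blast
    assume "0 = (\<integral>\<^sup>+x. indicator K x * ennreal (askew a b (u \<bullet> x) powr p) \<partial>lborel)"
    then have "AE x in lborel. indicator K x * ennreal (askew a b (u \<bullet> x) powr p) = 0"
      by (subst nn_integral_0_iff_AE[symmetric]) auto
    then have "AE x in lborel. x \<notin> G"
    proof eventually_elim
      case (elim x)
      show ?case
      proof
        assume "x \<in> G"
        then have "x \<in> K" "0 < askew a b (u \<bullet> x)" using interior_subset s unfolding G_def by auto
        then show False using elim by simp
      qed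
    qed
    then have "emeasure lborel G = 0" using G by (intro AE_iff_null_sets[THEN iffD2, THEN null_setsD1]) auto
    then show False using open_not_negligible[OF G \<open>G \<noteq> {}\<close>] G
      by (simp add: negligible_iff_null_sets null_sets_def emeasure_completion)
  qed
  then have "0 \<noteq> ennreal (moment p a b K u)" unfolding moment_eq_nn_integral[OF KD(1)] .
  then show ?thesis using moment_nonneg[of K u] by (auto simp: less_le)
qed

lemma moment_norm_pos: "K \<in> convex_bodies_o \<Longrightarrow> u \<noteq> 0 \<Longrightarrow> 0 < moment_norm p a b K u"
  unfolding moment_norm_def using moment_pos by fastforce

lemma moment_norm_scale:
  assumes "0 \<le> c"
  shows "moment_norm p a b K (c *\<^sub>R u) = c * moment_norm p a b K u"
proof -
  have "moment p a b K (c *\<^sub>R u) = (LINT x:K|lebesgue. c powr p * askew a b (u \<bullet> x) powr p)"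
    unfolding moment_def using assms askew_nonneg[OF a b] by (simp add: askew_scale powr_mult)
  also have "\<dots> = c powr p * moment p a b K u" unfolding moment_def by simp
  finally show ?thesis unfolding moment_norm_def using assms p by (simp add: powr_mult powr_powr moment_nonneg)
qed

lemma le_from_powr: "0 \<le> x \<Longrightarrow> 0 \<le> y \<Longrightarrow> x powr p \<le> y powr p \<Longrightarrow> x \<le> y"
  using p powr_less_mono2[of p y x] by linarith

text \<open>Minkowski's inequality: the pointwise bound \<open>powr_add_le_weighted\<close> is integrated with the values of
  the two norms as weights.\<close>

lemma moment_norm_add:
  assumes K: "K \<in> convex_bodies_o"
  shows "moment_norm p a b K (u + v) \<le> moment_norm p a b K u + moment_norm p a b K v"
proof (cases "u = 0 \<or> v = 0")
  case True
  then show ?thesis using moment_norm_nonneg by auto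
next
  case False
  note KD = convex_bodies_oD[OF K]
  have [measurable]: "K \<in> sets borel" using KD(1) by (simp add: borel_compact)
  define A B where "A = moment_norm p a b K u" and "B = moment_norm p a b K v"
  have AB: "0 < A" "0 < B" using False moment_norm_pos[OF K] unfolding A_def B_def by auto
  define c d where "c = ((A + B) / A) powr (p - 1)" and "d = ((A + B) / B) powr (p - 1)"
  have cd: "0 \<le> c" "0 \<le> d" unfolding c_def d_def by auto
  have "ennreal (moment p a b K (u + v)) \<le> (\<integral>\<^sup>+x. ennreal c * (indicator K x * ennreal (askew a b (u \<bullet> x) powr p))
        + ennreal d * (indicator K x * ennreal (askew a b (v \<bullet> x) powr p)) \<partial>lborel)"
    unfolding moment_eq_nn_integral[OF KD(1)]
  proof (intro nn_integral_mono)
    fix x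
    have "askew a b ((u + v) \<bullet> x) powr p \<le> (askew a b (u \<bullet> x) + askew a b (v \<bullet> x)) powr p"
      using askew_add[of a b "u \<bullet> x" "v \<bullet> x"] askew_nonneg[OF a b] p by (intro powr_mono2) (auto simp: inner_add_left)
    also have "\<dots> \<le> c * askew a b (u \<bullet> x) powr p + d * askew a b (v \<bullet> x) powr p"
      unfolding c_def d_def using askew_nonneg[OF a b] AB p by (intro powr_add_le_weighted) auto
    finally have "ennreal (askew a b ((u + v) \<bullet> x) powr p) \<le> ennreal c * ennreal (askew a b (u \<bullet> x) powr p) + ennreal d * ennreal (askew a b (v \<bullet> x) powr p)"
      using cd by (simp add: ennreal_mult[symmetric] ennreal_plus[symmetric] del: ennreal_plus)
    then show "indicator K x * ennreal (askew a b ((u + v) \<bullet> x) powr p) \<le> ennreal c * (indicator K x * ennreal (askew a b (u \<bullet> x) powr p))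
        + ennreal d * (indicator K x * ennreal (askew a b (v \<bullet> x) powr p))"
      by (auto simp: indicator_def)
  qed
  also have "\<dots> = ennreal c * ennreal (moment p a b K u) + ennreal d * ennreal (moment p a b K v)"
    unfolding moment_eq_nn_integral[OF KD(1)] by (subst nn_integral_add) (simp_all add: nn_integral_cmult)
  also have "\<dots> = ennreal (c * A powr p + d * B powr p)"
    unfolding A_def B_def moment_norm_powr using cd by (simp add: ennreal_mult ennreal_plus moment_nonneg)
  also have "c * A powr p + d * B powr p = (A + B) powr p" unfolding c_def d_def by (rule weighted_sum_eq[OF AB])
  finally have "moment_norm p a b K (u + v) powr p \<le> (A + B) powr p" unfolding moment_norm_powr by (simp add: ennreal_le_iff)
  then show ?thesis using AB unfolding A_def B_def
    by (intro le_from_powr[OF moment_norm_nonneg]) (simp_all add: add_nonneg_nonneg moment_norm_nonneg)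
qed

definition moment_body :: "'a::euclidean_space set \<Rightarrow> 'a set" where
  "moment_body K = wulff (moment_norm p a b K)"

lemma moment_body:
  assumes K: "K \<in> convex_bodies_o"
  shows "moment_body K \<in> convex_bodies_o" "support_fun (moment_body K) = moment_norm p a b K"
  unfolding moment_body_def
  using wulff_support_fun[of "moment_norm p a b K"] moment_norm_scale moment_norm_add[OF K] moment_norm_pos[OF K] by blast+

lemma body_with_support_pow_moment:
  assumes K: "K \<in> convex_bodies_o" and F: "\<And>u. F u = moment p a b K u"
  shows "body_with_support_pow p F = moment_body K"
  unfolding moment_body_def using F moment_norm_powr[of K] p
  by (intro body_with_support_pow_eq moment_norm_scale moment_norm_add[OF K] moment_norm_pos[OF K]) auto

lemma moment_mono:
  assumes "compact K" "compact K'" "K \<subseteq> K'"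
  shows "moment p a b K u \<le> moment p a b K' u"
proof -
  have "ennreal (moment p a b K u) \<le> ennreal (moment p a b K' u)"
    unfolding moment_eq_nn_integral[OF assms(1)] moment_eq_nn_integral[OF assms(2)] using assms(3)
    by (intro nn_integral_mono) (auto simp: indicator_def)
  then show ?thesis by (simp add: ennreal_le_iff moment_nonneg)
qed

lemma moment_body_mono:
  assumes "compact K" "compact K'" "K \<subseteq> K'"
  shows "moment_body K \<subseteq> moment_body K'"
  unfolding moment_body_def moment_norm_def
  using moment_mono[OF assms] p by (intro wulff_mono powr_mono2) (auto simp: moment_nonneg)

end

lemma moment_split:
  assumes "0 \<le> a" "0 \<le> b" "0 < p" "compact K"
  shows "moment p a b K u = a powr p * moment p 1 0 K u + b powr p * moment p 0 1 K u"
proof -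
  have c: "continuous_on UNIV (\<lambda>x. askew a b (u \<bullet> x) powr p)" if "0 \<le> a" "0 \<le> b" for a b
    by (intro continuous_on_powr' continuous_intros) (use assms askew_nonneg[OF that] in auto)
  have i: "set_integrable lebesgue K (\<lambda>x. askew a b (u \<bullet> x) powr p)" if "0 \<le> a" "0 \<le> b" for a b
    using set_lebesgue_integral_eq_nn_integral(2,3)[OF assms(4) c[OF that]] unfolding set_integrable_def
    by (subst integrable_completion) auto
  have "askew a b t powr p = a powr p * askew 1 0 t powr p + b powr p * askew 0 1 t powr p" for t
    using askew_powr[OF assms(1-3)] askew_powr[of 1 0 p t] askew_powr[of 0 1 p t] assms(3) by simp
  then have "moment p a b K u = (LINT x:K|lebesgue. a powr p * askew 1 0 (u \<bullet> x) powr p + b powr p * askew 0 1 (u \<bullet> x) powr p)"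
    unfolding moment_def by simp
  also have "\<dots> = (LINT x:K|lebesgue. a powr p * askew 1 0 (u \<bullet> x) powr p) + (LINT x:K|lebesgue. b powr p * askew 0 1 (u \<bullet> x) powr p)"
    by (rule set_integral_add) (use i[of 1 0] i[of 0 1] in auto)
  finally show ?thesis unfolding moment_def by simp
qed

lemma moment_reflect:
  fixes K :: "'a::euclidean_space set"
  assumes "compact K" "0 < p"
  shows "moment p 1 0 (uminus ` K) u = moment p 0 1 K u"
proof -
  have c: "continuous_on UNIV (\<lambda>x. askew a b (u \<bullet> x) powr p)" if "0 \<le> a" "0 \<le> b" for a b
    by (intro continuous_on_powr' continuous_intros) (use assms askew_nonneg[OF that] in auto)
  have cK: "compact (uminus ` K)" using assms(1) by (rule compact_negations)
  have Kb [measurable]: "K \<in> sets borel" "uminus ` K \<in> sets borel" using assms(1) cK by (auto simp: borel_compact)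
  have "ennreal (moment p 1 0 (uminus ` K) u) = (\<integral>\<^sup>+x. indicator (uminus ` K) x * ennreal (askew 1 0 (u \<bullet> x) powr p) \<partial>lborel)"
    unfolding moment_def by (rule set_lebesgue_integral_eq_nn_integral(1)[OF cK c]) auto
  also have "\<dots> = (\<integral>\<^sup>+x. indicator (uminus ` K) x * ennreal (askew 1 0 (u \<bullet> x) powr p) \<partial>distr lborel borel uminus)"
  proof -
    have "lborel = density (distr lborel borel (\<lambda>x::'a. 0 + (-1) *\<^sub>R x)) (\<lambda>_. \<bar>-1::real\<bar> ^ DIM('a))"
      by (rule lborel_affine) simp
    then have "distr lborel borel (uminus :: 'a \<Rightarrow> 'a) = lborel" by (simp add: density_1)
    then show ?thesis by simp
  qed
  also have "\<dots> = (\<integral>\<^sup>+x. indicator (uminus ` K) (- x) * ennreal (askew 1 0 (u \<bullet> (- x)) powr p) \<partial>lborel)"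
    by (subst nn_integral_distr) auto
  also have "\<dots> = (\<integral>\<^sup>+x. indicator K x * ennreal (askew 0 1 (u \<bullet> x) powr p) \<partial>lborel)"
    by (intro nn_integral_cong) (auto simp: indicator_def askew_def max.commute)
  also have "\<dots> = ennreal (moment p 0 1 K u)"
    unfolding moment_def by (rule set_lebesgue_integral_eq_nn_integral(1)[OF assms(1) c, symmetric]) auto
  finally show ?thesis
    by (simp add: moment_def set_lebesgue_integral_def integral_nonneg_AE)
qed

text \<open>The weights are \<open>a powr p = c_np n p * (n + p) * c1\<close> and \<open>b powr p = c_np n p * (n + p) * c2\<close>,
  where \<open>n\<close> is the dimension.\<close>

theorem Psi_eq_moment_body:
  fixes p c1 c2 :: real
  assumes p: "1 < p" and c: "c1 \<ge> 0" "c2 \<ge> 0" "\<not> (c1 = 0 \<and> c2 = 0)"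
  obtains a b where "moment_params p a b" "\<And>K :: 'a::euclidean_space set. K \<in> convex_bodies_o \<Longrightarrow> Psi p c1 c2 K = moment_params.moment_body p a b K"
proof -
  define C where "C = c_np DIM('a) p * (real DIM('a) + p)"
  have C: "0 < C" unfolding C_def c_np_def using p by (intro mult_pos_pos divide_pos_pos Gamma_real_pos) (auto intro: add_pos_pos)
  define q where "q = C powr (1 / p)"
  have q: "0 < q" "q powr p = C" using C p unfolding q_def by (auto simp: powr_powr)
  define a b where "a = q * c1 powr (1 / p)" and "b = q * c2 powr (1 / p)"
  have abp: "a powr p = C * c1" "b powr p = C * c2" using q p c unfolding a_def b_def by (auto simp: powr_mult powr_powr)
  have ab: "0 \<le> a" "0 \<le> b" unfolding a_def b_def using q by auto
  have "0 < a + b" using c q unfolding a_def b_def by (auto simp: add_pos_nonneg add_nonneg_pos)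
  then interpret M: moment_params p a b using p ab by unfold_locales auto
  interpret Q: moment_params p q 0 using p q by unfold_locales auto
  have plus: "moment_body_plus p K = Q.moment_body K" if K: "K \<in> convex_bodies_o" for K :: "'a set"
  proof -
    have "max 0 t powr p = askew 1 0 t powr p" for t using p by (simp add: askew_powr)
    then have "c_np DIM('a) p * (real DIM('a) + p) * (LINT x:K|lebesgue. max 0 (u \<bullet> x) powr p) = moment p q 0 K u" for u
      using moment_split[of q 0 p K u] q p convex_bodies_oD(1)[OF K] unfolding moment_def C_def[symmetric] by simp
    then show ?thesis unfolding moment_body_plus_def by (intro Q.body_with_support_pow_moment[OF K]) auto
  qed
  have "Psi p c1 c2 K = M.moment_body K" if K: "K \<in> convex_bodies_o" for K :: "'a set"
  proof -
    note KD = convex_bodies_oD[OF K]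
    have mK: "uminus ` K \<in> convex_bodies_o"
      using KD by (auto simp: convex_bodies_o_def compact_negations convex_negations interior_negations)
    have "c1 * support_fun (moment_body_plus p K) u powr p + c2 * support_fun (moment_body_minus p K) u powr p = moment p a b K u" for u
    proof -
      have "moment p q 0 K u = C * moment p 1 0 K u" "moment p q 0 (uminus ` K) u = C * moment p 0 1 K u"
        using moment_split[of q 0 p K u] moment_split[of q 0 p "uminus ` K" u] q p KD(1)
          convex_bodies_oD(1)[OF mK] moment_reflect[OF KD(1), of p u] by auto
      then show ?thesis
        unfolding moment_body_minus_def plus[OF K] plus[OF mK] Q.moment_body(2)[OF K] Q.moment_body(2)[OF mK] Q.moment_norm_powr
        using moment_split[OF ab, of p K u] p KD(1) abp by (simp add: algebra_simps)
    qed
    then show ?thesis unfolding Psi_def Lp_comb_def by (intro M.body_with_support_pow_moment[OF K]) auto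
  qed
  then show ?thesis using that[of a b] M.moment_params_axioms by blast
qed

section \<open>Slices in a coordinate direction\<close>

lemma nn_integral_slices:
  fixes f :: "'a::euclidean_space \<Rightarrow> ennreal"
  assumes "k \<in> Basis" "f \<in> borel_measurable borel"
  shows "(\<integral>\<^sup>+x. f x \<partial>lborel) = (\<integral>\<^sup>+y. (\<integral>\<^sup>+t. f (y + t *\<^sub>R k) \<partial>lborel) \<partial>coord_lborel (Basis - {k}))"
  using nn_integral_coord_lborel_insert[of "Basis - {k}" k f] assms
  by (simp add: insert_absorb coord_lborel_Basis)

definition proj :: "'a::euclidean_space \<Rightarrow> 'a \<Rightarrow> 'a" where
  "proj k y = y - (y \<bullet> k) *\<^sub>R k"

lemma proj_inner [simp]: "k \<in> Basis \<Longrightarrow> proj k y \<bullet> k = 0"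
  by (simp add: proj_def inner_diff_left)

lemma proj_id: "y \<bullet> k = 0 \<Longrightarrow> proj k y = y"
  by (simp add: proj_def)

lemma proj_measurable [measurable]: "proj k \<in> borel_measurable borel"
  unfolding proj_def[abs_def] by measurable

lemma proj_linear: "proj k (x + y) = proj k x + proj k y" "proj k (c *\<^sub>R x) = c *\<^sub>R proj k x"
  by (simp_all add: proj_def inner_add_left algebra_simps)

lemma nn_integral_power_Ioc:
  assumes "0 < c"
  shows "(\<integral>\<^sup>+s. indicator {0<..c} s * ennreal (s ^ m) \<partial>lborel) = ennreal (c ^ Suc m / real (Suc m))"
proof -
  have "(\<integral>\<^sup>+s. indicator {0<..c} s * ennreal (s ^ m) \<partial>lborel) = (\<integral>\<^sup>+s. ennreal (s ^ m) * indicator {0..c} s \<partial>lborel)"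
    by (intro nn_integral_cong_AE eventually_mono[OF AE_lborel_singleton[of 0]]) (auto simp: indicator_def)
  also have "\<dots> = ennreal (c ^ Suc m / real (Suc m) - 0 ^ Suc m / real (Suc m))"
  proof (rule nn_integral_FTC_Icc)
    fix s :: real
    have "((\<lambda>s. s ^ Suc m / real (Suc m)) has_real_derivative (real (Suc m) * s ^ m) / real (Suc m)) (at s)"
      using DERIV_pow[of "Suc m" s UNIV] by (intro DERIV_cdivide) simp
    then show "((\<lambda>s. s ^ Suc m / real (Suc m)) has_real_derivative s ^ m) (at s)"
      by (simp del: power_Suc of_nat_Suc)
  qed (use assms in auto)
  finally show ?thesis by simp
qed

text \<open>The function \<open>g\<close> is homogeneous. At height \<open>s\<close> above the hyperplane orthogonal to \<open>k\<close>, the slice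
  of the sublevel set consists of the points \<open>s * y\<close> with \<open>s \<le> 1 / g (y + \<sigma> k)\<close>. Integration over \<open>s\<close> turns
  the half volume into the integral of a convex function to the power \<open>- n\<close> over a space of
  dimension \<open>n - 1\<close>, the form required by \<open>borell_brascamp_lieb_harmonic\<close>. Since \<open>coord_lborel\<close> sees
  only points orthogonal to \<open>k\<close>, inserting \<open>proj k\<close> does not change the integral; it makes the
  integrand positive everywhere.\<close>

lemma halfspace_sublevel_slices:
  fixes g :: "'a::euclidean_space \<Rightarrow> real"
  assumes k: "k \<in> Basis" and [measurable]: "g \<in> borel_measurable borel"
    and scale: "\<And>c u. 0 < c \<Longrightarrow> g (c *\<^sub>R u) = c * g u" and pos: "\<And>u. u \<noteq> 0 \<Longrightarrow> 0 < g u"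
    and \<sigma>: "\<sigma> = 1 \<or> \<sigma> = (-1::real)"
  shows "ennreal (real DIM('a)) * emeasure lborel {x. 0 < \<sigma> * (k \<bullet> x) \<and> g x \<le> 1}
    = (\<integral>\<^sup>+y. ennreal ((1 / g (proj k y + \<sigma> *\<^sub>R k)) ^ DIM('a)) \<partial>coord_lborel (Basis - {k}))"
proof -
  let ?J = "Basis - {k}" and ?N = "coord_lborel (Basis - {k})"
  define G where "G y = g (proj k y + \<sigma> *\<^sub>R k)" for y
  have Gm [measurable]: "G \<in> borel_measurable borel" unfolding G_def by measurable
  have G: "0 < G y" for y
  proof -
    have "(proj k y + \<sigma> *\<^sub>R k) \<bullet> k = \<sigma>" using k by (simp add: inner_add_left)
    then have "proj k y + \<sigma> *\<^sub>R k \<noteq> 0" using \<sigma> by force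
    then show ?thesis unfolding G_def by (rule pos)
  qed
  interpret N: sigma_finite_measure ?N by (rule sigma_finite_coord_lborel) auto
  interpret NL: pair_sigma_finite ?N "lborel :: real measure" by standard
  have orth: "AE y in ?N. y \<bullet> k = 0" using k by (intro AE_coord_lborel_orthogonal) auto
  have n: "DIM('a) = Suc (card ?J)" using k by (simp add: card_Diff_singleton)
  define S where "S = {x. 0 < \<sigma> * (k \<bullet> x) \<and> g x \<le> 1}"
  have S [measurable]: "S \<in> sets borel" unfolding S_def by measurable
  have "emeasure lborel S = (\<integral>\<^sup>+x. indicator S x \<partial>lborel)" by simp
  also have "\<dots> = (\<integral>\<^sup>+y. (\<integral>\<^sup>+t. indicator S (y + t *\<^sub>R k) \<partial>lborel) \<partial>?N)"
    by (rule nn_integral_slices[OF k]) measurable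
  also have "\<dots> = (\<integral>\<^sup>+y. (\<integral>\<^sup>+s. indicator S (y + (\<sigma> * s) *\<^sub>R k) \<partial>lborel) \<partial>?N)"
  proof (rule nn_integral_cong)
    fix y
    show "(\<integral>\<^sup>+t. indicator S (y + t *\<^sub>R k) \<partial>lborel) = (\<integral>\<^sup>+s. indicator S (y + (\<sigma> * s) *\<^sub>R k) \<partial>lborel)"
      using nn_integral_real_affine[of "\<lambda>t. indicator S (y + t *\<^sub>R k)" \<sigma> 0] \<sigma> by auto
  qed
  also have "\<dots> = (\<integral>\<^sup>+s. (\<integral>\<^sup>+y. indicator S (y + (\<sigma> * s) *\<^sub>R k) \<partial>?N) \<partial>lborel)"
    by (rule NL.Fubini'[symmetric]) measurable
  also have "\<dots> = (\<integral>\<^sup>+s. (\<integral>\<^sup>+y. indicator {0<..1 / G y} s * ennreal (s ^ card ?J) \<partial>?N) \<partial>lborel)"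
  proof (rule nn_integral_cong)
    fix s :: real
    have kS: "0 < \<sigma> * (k \<bullet> (y + (\<sigma> * s) *\<^sub>R k)) \<longleftrightarrow> 0 < s" if "y \<bullet> k = 0" for y
      using that k \<sigma> by (auto simp: inner_add_right inner_commute)
    show "(\<integral>\<^sup>+y. indicator S (y + (\<sigma> * s) *\<^sub>R k) \<partial>?N) = (\<integral>\<^sup>+y. indicator {0<..1 / G y} s * ennreal (s ^ card ?J) \<partial>?N)"
    proof (cases "0 < s")
      case True
      have "(\<integral>\<^sup>+y. indicator S (y + (\<sigma> * s) *\<^sub>R k) \<partial>?N)
         = ennreal (s ^ card ?J) * (\<integral>\<^sup>+y. indicator S (s *\<^sub>R y + (\<sigma> * s) *\<^sub>R k) \<partial>?N)"
        by (rule coord_lborel_scale) (use True in auto)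
      also have "\<dots> = (\<integral>\<^sup>+y. ennreal (s ^ card ?J) * indicator S (s *\<^sub>R y + (\<sigma> * s) *\<^sub>R k) \<partial>?N)"
        by (rule nn_integral_cmult[symmetric]) measurable
      also have "\<dots> = (\<integral>\<^sup>+y. indicator {0<..1 / G y} s * ennreal (s ^ card ?J) \<partial>?N)"
        using orth
      proof (intro nn_integral_cong_AE, eventually_elim)
        case (elim y)
        have "s *\<^sub>R y + (\<sigma> * s) *\<^sub>R k = s *\<^sub>R (proj k y + \<sigma> *\<^sub>R k)"
          using elim by (simp add: proj_id algebra_simps)
        then have "g (s *\<^sub>R y + (\<sigma> * s) *\<^sub>R k) = s * G y" using True by (simp add: scale G_def)
        moreover have "0 < \<sigma> * (k \<bullet> (s *\<^sub>R y + (\<sigma> * s) *\<^sub>R k))" using kS[of "s *\<^sub>R y"] elim True by simp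
        moreover have "s * G y \<le> 1 \<longleftrightarrow> s \<le> 1 / G y" using G[of y] by (simp add: field_simps)
        ultimately have "s *\<^sub>R y + (\<sigma> * s) *\<^sub>R k \<in> S \<longleftrightarrow> s \<in> {0<..1 / G y}" unfolding S_def using True by simp
        then show ?case by (simp add: indicator_def mult.commute)
      qed
      finally show ?thesis .
    next
      case False
      have "(\<integral>\<^sup>+y. indicator S (y + (\<sigma> * s) *\<^sub>R k) \<partial>?N) = (\<integral>\<^sup>+y. 0 \<partial>?N)"
        using orth by (intro nn_integral_cong_AE, eventually_elim) (use kS False in \<open>auto simp: indicator_def S_def\<close>)
      then show ?thesis using False by (simp add: indicator_def)
    qed
  qed
  also have "\<dots> = (\<integral>\<^sup>+y. (\<integral>\<^sup>+s. indicator {0<..1 / G y} s * ennreal (s ^ card ?J) \<partial>lborel) \<partial>?N)"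
    by (rule NL.Fubini') (simp add: indicator_def, measurable)
  also have "\<dots> = (\<integral>\<^sup>+y. ennreal ((1 / G y) ^ DIM('a) / real DIM('a)) \<partial>?N)"
    unfolding n using G by (intro nn_integral_cong nn_integral_power_Ioc) auto
  also have "\<dots> = (\<integral>\<^sup>+y. ennreal ((1 / G y) ^ DIM('a)) * ennreal (1 / real DIM('a)) \<partial>?N)"
    using G by (intro nn_integral_cong) (subst ennreal_mult[symmetric], auto intro: less_imp_le)
  also have "\<dots> = (\<integral>\<^sup>+y. ennreal ((1 / G y) ^ DIM('a)) \<partial>?N) * ennreal (1 / real DIM('a))"
    by (rule nn_integral_multc) measurable
  finally have "ennreal (real DIM('a)) * emeasure lborel S = (\<integral>\<^sup>+y. ennreal ((1 / G y) ^ DIM('a)) \<partial>?N) * (ennreal (1 / real DIM('a)) * ennreal (real DIM('a)))"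
    by (simp only: mult_ac)
  also have "ennreal (1 / real DIM('a)) * ennreal (real DIM('a)) = 1" by (subst ennreal_mult[symmetric]) auto
  finally show ?thesis unfolding S_def G_def by simp
qed

definition refl_coord :: "'a::euclidean_space \<Rightarrow> 'a \<Rightarrow> 'a" where
  "refl_coord k x = x - (2 * (x \<bullet> k)) *\<^sub>R k"

lemma refl_coord_involution: "k \<in> Basis \<Longrightarrow> refl_coord k (refl_coord k x) = x"
  by (simp add: refl_coord_def inner_diff_left algebra_simps)

lemma refl_coord_linear: "linear (refl_coord k)"
  by (rule linearI) (simp_all add: refl_coord_def inner_add_left algebra_simps)

lemma refl_coord_adjoint: "refl_coord k x \<bullet> y = x \<bullet> refl_coord k y"
  by (simp add: refl_coord_def inner_diff_left inner_diff_right inner_commute)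

lemma refl_coord_slice: "k \<in> Basis \<Longrightarrow> y \<bullet> k = 0 \<Longrightarrow> refl_coord k (y + t *\<^sub>R k) = y + (- t) *\<^sub>R k"
  unfolding refl_coord_def mult_2 scaleR_left_distrib by (simp add: inner_add_left)

lemma refl_coord_measurable [measurable]: "refl_coord k \<in> borel_measurable borel"
  unfolding refl_coord_def[abs_def] by measurable

lemma nn_integral_refl_coord:
  fixes f :: "'a::euclidean_space \<Rightarrow> ennreal"
  assumes k: "k \<in> Basis" and [measurable]: "f \<in> borel_measurable borel"
  shows "(\<integral>\<^sup>+x. f (refl_coord k x) \<partial>lborel) = (\<integral>\<^sup>+x. f x \<partial>lborel)"
proof -
  have orth: "AE y in coord_lborel (Basis - {k}). y \<bullet> k = 0" using k by (intro AE_coord_lborel_orthogonal) auto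
  have "(\<integral>\<^sup>+x. f (refl_coord k x) \<partial>lborel) = (\<integral>\<^sup>+y. (\<integral>\<^sup>+t. f (refl_coord k (y + t *\<^sub>R k)) \<partial>lborel) \<partial>coord_lborel (Basis - {k}))"
    by (rule nn_integral_slices[OF k]) measurable
  also have "\<dots> = (\<integral>\<^sup>+y. (\<integral>\<^sup>+t. f (y + t *\<^sub>R k) \<partial>lborel) \<partial>coord_lborel (Basis - {k}))"
    using orth
  proof (intro nn_integral_cong_AE, eventually_elim)
    case (elim y)
    have "(\<integral>\<^sup>+t. f (y + t *\<^sub>R k) \<partial>lborel) = (\<integral>\<^sup>+t. f (y + (- t) *\<^sub>R k) \<partial>lborel)"
      by (subst nn_integral_real_affine[where c="-1" and t=0]) auto
    then show ?case using elim by (simp add: refl_coord_slice[OF k])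
  qed
  also have "\<dots> = (\<integral>\<^sup>+x. f x \<partial>lborel)" by (rule nn_integral_slices[OF k, symmetric]) measurable
  finally show ?thesis .
qed

lemma emeasure_refl_coord:
  fixes S :: "'a::euclidean_space set"
  assumes k: "k \<in> Basis" and [measurable]: "S \<in> sets borel"
  shows "emeasure lborel {x. refl_coord k x \<in> S} = emeasure lborel S"
proof -
  have m: "{x. refl_coord k x \<in> S} \<in> sets borel"
    using measurable_sets[of "refl_coord k" borel borel S] by (simp add: vimage_def)
  have "emeasure lborel {x. refl_coord k x \<in> S} = (\<integral>\<^sup>+x. indicator S (refl_coord k x) \<partial>lborel)"
  proof -
    have "(\<lambda>x. indicator S (refl_coord k x)) = (indicator {x. refl_coord k x \<in> S} :: 'a \<Rightarrow> ennreal)"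
      by (auto simp: indicator_def)
    then show ?thesis using m by simp
  qed
  also have "\<dots> = emeasure lborel S" by (subst nn_integral_refl_coord[OF k]) auto
  finally show ?thesis .
qed

section \<open>Steiner symmetrization\<close>

text \<open>On every line in the direction \<open>k\<close>, half of the difference set of the chord is the chord moved to be
  centered. In this form the body is a linear image of a compact convex set of pairs.\<close>

definition steiner :: "'a::euclidean_space \<Rightarrow> 'a set \<Rightarrow> 'a set" where
  "steiner k K = (\<lambda>(x, x'). proj k x + (((x - x') \<bullet> k) / 2) *\<^sub>R k) ` {z \<in> K \<times> K. proj k (fst z) = proj k (snd z)}"

lemma proj_decomp: "x = proj k x + (x \<bullet> k) *\<^sub>R k"
  by (simp add: proj_def)

lemma proj_slice: "k \<in> Basis \<Longrightarrow> y \<bullet> k = 0 \<Longrightarrow> proj k (y + t *\<^sub>R k) = y" "k \<in> Basis \<Longrightarrow> y \<bullet> k = 0 \<Longrightarrow> (y + t *\<^sub>R k) \<bullet> k = t"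
  by (simp_all add: proj_def inner_add_left)

lemma mem_steiner:
  assumes k: "k \<in> Basis" and y: "y \<bullet> k = 0"
  shows "y + v *\<^sub>R k \<in> steiner k K \<longleftrightarrow> (\<exists>s t. y + s *\<^sub>R k \<in> K \<and> y + t *\<^sub>R k \<in> K \<and> v = (s - t) / 2)"
proof
  assume "y + v *\<^sub>R k \<in> steiner k K"
  then obtain x x' where x: "x \<in> K" "x' \<in> K" "proj k x = proj k x'" "y + v *\<^sub>R k = proj k x + (((x - x') \<bullet> k) / 2) *\<^sub>R k"
    unfolding steiner_def by auto
  have "proj k x = y" using arg_cong[OF x(4), of "proj k"] proj_slice(1)[OF k y] proj_slice(1)[OF k proj_inner[OF k]] by simp
  moreover have "v = ((x - x') \<bullet> k) / 2" using arg_cong[OF x(4), of "\<lambda>z. z \<bullet> k"] proj_slice(2)[OF k y] proj_slice(2)[OF k proj_inner[OF k]] by simp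
  ultimately show "\<exists>s t. y + s *\<^sub>R k \<in> K \<and> y + t *\<^sub>R k \<in> K \<and> v = (s - t) / 2"
    using x(1-3) proj_decomp[of x k] proj_decomp[of x' k] by (intro exI[of _ "x \<bullet> k"] exI[of _ "x' \<bullet> k"]) (auto simp: inner_diff_left)
next
  assume "\<exists>s t. y + s *\<^sub>R k \<in> K \<and> y + t *\<^sub>R k \<in> K \<and> v = (s - t) / 2"
  then obtain s t where st: "y + s *\<^sub>R k \<in> K" "y + t *\<^sub>R k \<in> K" "v = (s - t) / 2" by blast
  show "y + v *\<^sub>R k \<in> steiner k K" unfolding steiner_def
    by (rule image_eqI[of _ _ "(y + s *\<^sub>R k, y + t *\<^sub>R k)"])
       (use st in \<open>auto simp: proj_slice[OF k y] inner_diff_left\<close>)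
qed

lemma steiner_convex_body:
  fixes K :: "'a::euclidean_space set"
  assumes k: "k \<in> Basis" and K: "K \<in> convex_bodies_o"
  shows "steiner k K \<in> convex_bodies_o"
proof -
  note KD = convex_bodies_oD[OF K]
  let ?D = "{z \<in> K \<times> K. proj k (fst z) = proj k (snd z)}" and ?F = "\<lambda>(x, x'). proj k x + (((x - x') \<bullet> k) / 2) *\<^sub>R k"
  have cont_proj: "continuous_on A (\<lambda>z. proj k (f z))" if "continuous_on A f" for A and f :: "'a \<times> 'a \<Rightarrow> 'a"
    unfolding proj_def by (intro continuous_intros that)
  have "closed {z :: 'a \<times> 'a. proj k (fst z) = proj k (snd z)}"
    by (intro closed_Collect_eq cont_proj continuous_intros)
  then have "compact ((K \<times> K) \<inter> {z. proj k (fst z) = proj k (snd z)})"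
    by (intro compact_Int_closed compact_Times KD)
  moreover have D: "?D = (K \<times> K) \<inter> {z. proj k (fst z) = proj k (snd z)}" by auto
  moreover have "continuous_on A ?F" for A unfolding case_prod_unfold
    by (intro continuous_intros cont_proj) auto
  ultimately have 1: "compact (steiner k K)" unfolding steiner_def by (metis (no_types, lifting) compact_continuous_image)
  have linF: "linear ?F" by (rule linearI) (auto simp: proj_linear inner_add_left inner_diff_left algebra_simps add_divide_distrib diff_divide_distrib)
  have "convex ?D" unfolding convex_alt
  proof safe
    fix a b c d and u :: real assume "a \<in> K" "b \<in> K" "c \<in> K" "d \<in> K" "0 \<le> u" "u \<le> 1"
      and p: "proj k (fst (a, b)) = proj k (snd (a, b))" "proj k (fst (c, d)) = proj k (snd (c, d))"
    then show "(1 - u) *\<^sub>R (a, b) + u *\<^sub>R (c, d) \<in> K \<times> K"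
      using KD(2) unfolding convex_alt by auto
    show "proj k (fst ((1 - u) *\<^sub>R (a, b) + u *\<^sub>R (c, d))) = proj k (snd ((1 - u) *\<^sub>R (a, b) + u *\<^sub>R (c, d)))"
      using p by (simp add: proj_linear)
  qed
  then have 2: "convex (steiner k K)" unfolding steiner_def by (rule convex_linear_image[OF linF])
  obtain e where e: "0 < e" "ball 0 e \<subseteq> K" using KD(3) mem_interior by blast
  have "ball 0 e \<subseteq> steiner k K"
  proof
    fix x :: 'a assume x: "x \<in> ball 0 e"
    have m: "proj k x + (- (x \<bullet> k)) *\<^sub>R k = refl_coord k x" unfolding proj_def refl_coord_def mult_2 scaleR_left_distrib by simp
    have "refl_coord k x \<bullet> refl_coord k x = x \<bullet> x"
      by (simp add: refl_coord_adjoint refl_coord_involution[OF k])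
    then have "norm (refl_coord k x) = norm x" by (simp add: norm_eq_sqrt_inner)
    then have "proj k x + (x \<bullet> k) *\<^sub>R k \<in> K" "proj k x + (- (x \<bullet> k)) *\<^sub>R k \<in> K"
      using e x unfolding m proj_decomp[of x k, symmetric] by auto
    then have "proj k x + (x \<bullet> k) *\<^sub>R k \<in> steiner k K"
      unfolding mem_steiner[OF k proj_inner[OF k]]
      by (intro exI[of _ "x \<bullet> k"] exI[of _ "- (x \<bullet> k)"]) simp
    then show "x \<in> steiner k K" unfolding proj_decomp[of x k, symmetric] .
  qed
  then have "0 \<in> interior (steiner k K)" using e(1) by (meson centre_in_ball interiorI open_ball)
  then show ?thesis using 1 2 unfolding convex_bodies_o_def by blast
qed

text \<open>Here \<open>m\<close> is the midpoint of the chord. It is chosen for each chord separately; what is integrated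
  over all chords later on are quantities from which it has cancelled.\<close>

lemma steiner_chord:
  fixes K :: "'a::euclidean_space set"
  assumes k: "k \<in> Basis" and K: "compact K" "convex K" and y: "y \<bullet> k = 0"
  obtains m where "\<And>v. y + v *\<^sub>R k \<in> steiner k K \<longleftrightarrow> y + (m + v) *\<^sub>R k \<in> K"
    "\<And>v. y + v *\<^sub>R k \<in> steiner k K \<longleftrightarrow> y + (m - v) *\<^sub>R k \<in> K"
proof -
  define C where "C = {t. y + t *\<^sub>R k \<in> K}"
  have cont: "continuous_on UNIV (\<lambda>t. y + t *\<^sub>R k)" by (intro continuous_intros)
  have "closed C" unfolding C_def using closed_vimage[OF compact_imp_closed[OF K(1)] cont] by (simp add: vimage_def)
  moreover have "bounded C"
  proof -
    obtain B where B: "\<And>x. x \<in> K \<Longrightarrow> norm x \<le> B" using compact_imp_bounded[OF K(1)] unfolding bounded_iff by blast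
    have "norm t \<le> B" if "t \<in> C" for t
      using order_trans[OF Basis_le_norm[OF k, of "y + t *\<^sub>R k"] B] that proj_slice(2)[OF k y, of t] unfolding C_def by simp
    then show ?thesis unfolding bounded_iff by blast
  qed
  moreover have "convex C" unfolding convex_alt C_def
  proof safe
    fix s t u assume st: "y + s *\<^sub>R k \<in> K" "y + t *\<^sub>R k \<in> K" "0 \<le> u" "u \<le> (1::real)"
    have "y + ((1 - u) *\<^sub>R s + u *\<^sub>R t) *\<^sub>R k = (1 - u) *\<^sub>R (y + s *\<^sub>R k) + u *\<^sub>R (y + t *\<^sub>R k)"
      by (simp add: algebra_simps)
    then show "y + ((1 - u) *\<^sub>R s + u *\<^sub>R t) *\<^sub>R k \<in> K" using K(2) st unfolding convex_alt by auto
  qed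
  ultimately obtain l u where C: "C = {l..u}"
    using connected_compact_interval_1[of C] convex_connected compact_eq_bounded_closed by blast
  have S: "y + v *\<^sub>R k \<in> steiner k K \<longleftrightarrow> (\<exists>s\<in>{l..u}. \<exists>t\<in>{l..u}. v = (s - t) / 2)" for v
    unfolding mem_steiner[OF k y] C[symmetric] C_def by auto
  have K': "y + t *\<^sub>R k \<in> K \<longleftrightarrow> t \<in> {l..u}" for t unfolding C[symmetric] C_def by simp
  have iff: "(\<exists>s\<in>{l..u}. \<exists>t\<in>{l..u}. v = (s - t) / 2) \<longleftrightarrow> \<bar>v\<bar> \<le> (u - l) / 2" for v
  proof
    assume "\<bar>v\<bar> \<le> (u - l) / 2"
    then show "\<exists>s\<in>{l..u}. \<exists>t\<in>{l..u}. v = (s - t) / 2"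
      by (intro bexI[of _ "(l + u) / 2 + v"] bexI[of _ "(l + u) / 2 - v"]) (auto simp: abs_le_iff field_simps)
  qed (auto simp: abs_le_iff field_simps)
  show ?thesis
    by (rule that[of "(l + u) / 2"]) (unfold S iff K', auto simp: abs_le_iff field_simps)
qed

lemma steiner_symmetric:
  assumes k: "k \<in> Basis"
  shows "refl_coord k x \<in> steiner k K \<longleftrightarrow> x \<in> steiner k K"
proof -
  have r: "refl_coord k x = proj k x + (- (x \<bullet> k)) *\<^sub>R k"
    using refl_coord_slice[OF k proj_inner[OF k], of x "x \<bullet> k"] by (simp flip: proj_decomp)
  show ?thesis
  proof -
    have x: "x \<in> steiner k K \<longleftrightarrow> (\<exists>s t. proj k x + s *\<^sub>R k \<in> K \<and> proj k x + t *\<^sub>R k \<in> K \<and> x \<bullet> k = (s - t) / 2)"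
      using mem_steiner[OF k proj_inner[OF k], of x "x \<bullet> k" K] by (simp flip: proj_decomp)
    have "- (x \<bullet> k) = (s - t) / 2 \<longleftrightarrow> x \<bullet> k = (t - s) / 2" for s t by auto
    then show ?thesis unfolding r x mem_steiner[OF k proj_inner[OF k]] by blast
  qed
qed

lemma steiner_symmetric_other:
  assumes k: "k \<in> Basis" and j: "j \<in> Basis" "j \<noteq> k" and K: "\<And>x. x \<in> K \<Longrightarrow> refl_coord j x \<in> K"
    and x: "x \<in> steiner k K"
  shows "refl_coord j x \<in> steiner k K"
proof -
  have jk: "j \<bullet> k = 0" using k j by (simp add: inner_not_same_Basis)
  have slice: "refl_coord j (y + t *\<^sub>R k) = refl_coord j y + t *\<^sub>R k" "refl_coord j y \<bullet> k = y \<bullet> k" for y t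
    using jk by (auto simp: refl_coord_def inner_add_left inner_diff_left inner_commute algebra_simps)
  have "proj k x + (x \<bullet> k) *\<^sub>R k \<in> steiner k K" using x by (simp flip: proj_decomp)
  then obtain s t where st: "proj k x + s *\<^sub>R k \<in> K" "proj k x + t *\<^sub>R k \<in> K" "x \<bullet> k = (s - t) / 2"
    unfolding mem_steiner[OF k proj_inner[OF k]] by blast
  have o: "refl_coord j (proj k x) \<bullet> k = 0" using slice(2) k by simp
  have "refl_coord j (proj k x) + (x \<bullet> k) *\<^sub>R k \<in> steiner k K"
    unfolding mem_steiner[OF k o] using K[OF st(1)] K[OF st(2)] st(3) unfolding slice(1) by blast
  then show ?thesis unfolding slice(1)[symmetric] by (simp flip: proj_decomp)
qed

lemma coord_orthogonal:
  "k \<in> Basis \<Longrightarrow> AE y in coord_lborel (Basis - {k}). y \<bullet> (k :: 'a::euclidean_space) = 0"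
  by (intro AE_coord_lborel_orthogonal) auto

lemma norm_proj_le: "k \<in> Basis \<Longrightarrow> norm (proj k x) \<le> norm x"
proof -
  assume k: "k \<in> Basis"
  have "proj k x \<bullet> proj k x = x \<bullet> x - (x \<bullet> k)\<^sup>2"
    using k by (simp add: proj_def inner_diff_left inner_diff_right inner_commute power2_eq_square)
  then show ?thesis by (simp add: norm_eq_sqrt_inner)
qed

lemma not_AE_coord_lborel_norm_ge:
  fixes k :: "'a::euclidean_space"
  assumes k: "k \<in> Basis" and "0 < \<delta>"
  shows "\<not> (AE y in coord_lborel (Basis - {k}). \<delta> \<le> norm y)"
proof
  assume "AE y in coord_lborel (Basis - {k}). \<delta> \<le> norm y"
  then have "AE y in coord_lborel (Basis - {k}). (\<integral>\<^sup>+t. indicator (ball (0::'a) \<delta>) (y + t *\<^sub>R k) \<partial>lborel) = (0 :: ennreal)"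
    using coord_orthogonal[OF k]
  proof eventually_elim
    case (elim y)
    have "y + t *\<^sub>R k \<notin> ball 0 \<delta>" for t
      using norm_proj_le[OF k, of "y + t *\<^sub>R k"] elim proj_slice(1)[OF k, of y t] by simp
    then show ?case by simp
  qed
  then have "(\<integral>\<^sup>+y. (\<integral>\<^sup>+t. indicator (ball (0::'a) \<delta>) (y + t *\<^sub>R k) \<partial>lborel) \<partial>coord_lborel (Basis - {k})) = (\<integral>\<^sup>+y. 0 \<partial>coord_lborel (Basis - {k}))"
    by (rule nn_integral_cong_AE)
  then have "(\<integral>\<^sup>+x. indicator (ball (0::'a) \<delta>) x \<partial>lborel) = 0"
    by (subst nn_integral_slices[OF k borel_measurable_indicator]) auto
  then show False using \<open>0 < \<delta>\<close> unit_ball_vol_pos[of "real DIM('a)"] by (simp add: emeasure_ball)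
qed

lemma emeasure_halfspace_split:
  fixes S :: "'a::euclidean_space set"
  assumes [measurable]: "S \<in> sets borel" and k: "k \<noteq> 0"
  shows "emeasure lborel S = emeasure lborel {x. 0 < k \<bullet> x \<and> x \<in> S} + emeasure lborel {x. k \<bullet> x < 0 \<and> x \<in> S}"
proof -
  have "emeasure lborel S = emeasure lborel ({x. 0 < k \<bullet> x \<and> x \<in> S} \<union> {x. k \<bullet> x < 0 \<and> x \<in> S})"
    by (intro emeasure_eq_AE eventually_mono[OF AE_lborel_inner_nonzero[OF k]]) (auto simp: not_less)
  also have "\<dots> = emeasure lborel {x. 0 < k \<bullet> x \<and> x \<in> S} + emeasure lborel {x. k \<bullet> x < 0 \<and> x \<in> S}"
    by (intro plus_emeasure[symmetric]) auto
  finally show ?thesis .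
qed

lemma steiner_slice_integral:
  fixes K :: "'a::euclidean_space set" and \<Theta> :: "real \<Rightarrow> ennreal"
  assumes K: "compact K"
    and m: "\<And>v. y + v *\<^sub>R k \<in> steiner k K \<longleftrightarrow> y + (m + v) *\<^sub>R k \<in> K"
    "\<And>v. y + v *\<^sub>R k \<in> steiner k K \<longleftrightarrow> y + (m - v) *\<^sub>R k \<in> K"
    and [measurable]: "\<Theta> \<in> borel_measurable borel"
  shows "(\<integral>\<^sup>+t. indicator K (y + t *\<^sub>R k) * \<Theta> t \<partial>lborel) = (\<integral>\<^sup>+v. indicator (steiner k K) (y + v *\<^sub>R k) * \<Theta> (m + v) \<partial>lborel)"
    and "(\<integral>\<^sup>+t. indicator K (y + t *\<^sub>R k) * \<Theta> t \<partial>lborel) = (\<integral>\<^sup>+v. indicator (steiner k K) (y + v *\<^sub>R k) * \<Theta> (m - v) \<partial>lborel)"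
proof -
  have Kb [measurable]: "K \<in> sets borel" using K by (simp add: borel_compact)
  have [measurable]: "(\<lambda>t. indicator K (y + t *\<^sub>R k) * \<Theta> t) \<in> borel_measurable borel" by measurable
  have i: "indicator (steiner k K) (y + v *\<^sub>R k) = (indicator K (y + (m + v) *\<^sub>R k) :: ennreal)"
    "indicator (steiner k K) (y + v *\<^sub>R k) = (indicator K (y + (m - v) *\<^sub>R k) :: ennreal)" for v
    using m[of v] by (auto simp: indicator_def)
  show "(\<integral>\<^sup>+t. indicator K (y + t *\<^sub>R k) * \<Theta> t \<partial>lborel) = (\<integral>\<^sup>+v. indicator (steiner k K) (y + v *\<^sub>R k) * \<Theta> (m + v) \<partial>lborel)"
    using nn_integral_real_affine[of "\<lambda>t. indicator K (y + t *\<^sub>R k) * \<Theta> t" 1 m] unfolding i(1) by simp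
  show "(\<integral>\<^sup>+t. indicator K (y + t *\<^sub>R k) * \<Theta> t \<partial>lborel) = (\<integral>\<^sup>+v. indicator (steiner k K) (y + v *\<^sub>R k) * \<Theta> (m - v) \<partial>lborel)"
    using nn_integral_real_affine[of "\<lambda>t. indicator K (y + t *\<^sub>R k) * \<Theta> t" "-1" m] unfolding i(2) by simp
qed

lemma vol_steiner:
  fixes K :: "'a::euclidean_space set"
  assumes k: "k \<in> Basis" and K: "K \<in> convex_bodies_o"
  shows "vol (steiner k K) = vol K"
proof -
  note KD = convex_bodies_oD[OF K] and SD = convex_bodies_oD[OF steiner_convex_body[OF k K]]
  have [measurable]: "K \<in> sets borel" "steiner k K \<in> sets borel" using KD(1) SD(1) by (auto simp: borel_compact)
  have "(\<integral>\<^sup>+x. indicator (steiner k K) x \<partial>lborel) = (\<integral>\<^sup>+x. indicator K x \<partial>lborel)"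
    unfolding nn_integral_slices[OF k borel_measurable_indicator[OF \<open>K \<in> sets borel\<close>]]
      nn_integral_slices[OF k borel_measurable_indicator[OF \<open>steiner k K \<in> sets borel\<close>]]
  proof (rule nn_integral_cong_AE, rule eventually_mono[OF coord_orthogonal[OF k]])
    fix y assume y: "y \<bullet> k = 0"
    obtain m where m: "\<And>v. y + v *\<^sub>R k \<in> steiner k K \<longleftrightarrow> y + (m + v) *\<^sub>R k \<in> K"
    "\<And>v. y + v *\<^sub>R k \<in> steiner k K \<longleftrightarrow> y + (m - v) *\<^sub>R k \<in> K"
      using steiner_chord[OF k KD(1,2) y] by blast
    note slice = steiner_slice_integral[where K=K and y=y and k=k and m=m, OF KD(1) m]
    from slice(1)[of "\<lambda>_. 1"] show "(\<integral>\<^sup>+t. indicator (steiner k K) (y + t *\<^sub>R k) \<partial>lborel) = (\<integral>\<^sup>+t. indicator K (y + t *\<^sub>R k) \<partial>lborel :: ennreal)" by simp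
  qed
  then have "emeasure lborel (steiner k K) = emeasure lborel K" by simp
  then show ?thesis by (simp add: measure_completion measure_def)
qed

lemma support_fun_bounds:
  fixes L :: "'a::euclidean_space set"
  assumes L: "L \<in> convex_bodies_o"
  obtains r R where "0 < r" "\<And>u. r * norm u \<le> support_fun L u" "\<And>u. support_fun L u \<le> R * norm u" "0 < R"
proof -
  note LD = convex_bodies_oD[OF L]
  obtain r where r: "0 < r" "cball 0 r \<subseteq> L" using LD(3) mem_interior_cball by blast
  obtain B where B: "\<And>y. y \<in> L \<Longrightarrow> norm y \<le> B" using LD(7) unfolding bounded_iff by blast
  show ?thesis
  proof (rule that[of r "max B 1"])
    fix u :: 'a
    show "r * norm u \<le> support_fun L u"
    proof (cases "u = 0")
      case False
      have "(r / norm u) *\<^sub>R u \<in> L" using r False by (intro subsetD[OF r(2)]) auto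
      from support_fun_upper[OF LD(1) this, of u] show ?thesis
        using False by (simp add: dot_square_norm power2_eq_square)
    qed (use support_fun_scale[OF LD(1,5), of 0 0] in simp)
    show "support_fun L u \<le> max B 1 * norm u"
    proof (rule support_fun_least[OF LD(5)])
      fix y assume "y \<in> L"
      have "u \<bullet> y \<le> norm u * norm y" by (rule norm_cauchy_schwarz)
      also have "\<dots> \<le> norm u * max B 1" using B[OF \<open>y \<in> L\<close>] by (intro mult_left_mono) auto
      finally show "u \<bullet> y \<le> max B 1 * norm u" by (simp add: mult.commute)
    qed
  qed (use r in auto)
qed

section \<open>Moment bodies under Steiner symmetrization\<close>

context moment_params
begin

lemma moment_slices:
  fixes K :: "'a::euclidean_space set"
  assumes k: "k \<in> Basis" and K: "compact K"
  shows "ennreal (moment p a b K u) = (\<integral>\<^sup>+y. (\<integral>\<^sup>+t. indicator K (y + t *\<^sub>R k) * ennreal (askew a b (u \<bullet> y + (u \<bullet> k) * t) powr p) \<partial>lborel) \<partial>coord_lborel (Basis - {k}))"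
proof -
  have [measurable]: "K \<in> sets borel" using K by (simp add: borel_compact)
  show ?thesis unfolding moment_eq_nn_integral[OF K]
    by (subst nn_integral_slices[OF k]) (simp_all add: inner_add_right mult.commute)
qed

text \<open>The integrand is constant on each chord, and symmetrization preserves the length of the chord.\<close>

lemma moment_norm_steiner_orthogonal:
  fixes K :: "'a::euclidean_space set"
  assumes k: "k \<in> Basis" and K: "K \<in> convex_bodies_o" and u: "u \<bullet> k = 0"
  shows "moment_norm p a b (steiner k K) u = moment_norm p a b K u"
proof -
  note KD = convex_bodies_oD[OF K] and SD = convex_bodies_oD[OF steiner_convex_body[OF k K]]
  have "ennreal (moment p a b (steiner k K) u) = ennreal (moment p a b K u)"
    unfolding moment_slices[OF k KD(1)] moment_slices[OF k SD(1)] u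
  proof (rule nn_integral_cong_AE, rule eventually_mono[OF coord_orthogonal[OF k]])
    fix y assume y: "y \<bullet> k = 0"
    obtain m where m: "\<And>v. y + v *\<^sub>R k \<in> steiner k K \<longleftrightarrow> y + (m + v) *\<^sub>R k \<in> K"
    "\<And>v. y + v *\<^sub>R k \<in> steiner k K \<longleftrightarrow> y + (m - v) *\<^sub>R k \<in> K"
      using steiner_chord[OF k KD(1,2) y] by blast
    note slice = steiner_slice_integral[where K=K and y=y and k=k and m=m, OF KD(1) m]
    from slice(1)[of "\<lambda>_. ennreal (askew a b (u \<bullet> y) powr p)"]
    show "(\<integral>\<^sup>+t. indicator (steiner k K) (y + t *\<^sub>R k) * ennreal (askew a b (u \<bullet> y + 0 * t) powr p) \<partial>lborel)
      = (\<integral>\<^sup>+t. indicator K (y + t *\<^sub>R k) * ennreal (askew a b (u \<bullet> y + 0 * t) powr p) \<partial>lborel)" by simp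
  qed
  then show ?thesis unfolding moment_norm_def by (simp add: moment_nonneg)
qed

lemma moment_norm_steiner_refl:
  fixes K :: "'a::euclidean_space set"
  assumes k: "k \<in> Basis" and K: "K \<in> convex_bodies_o"
  shows "moment_norm p a b (steiner k K) (refl_coord k u) = moment_norm p a b (steiner k K) u"
proof -
  note SD = convex_bodies_oD[OF steiner_convex_body[OF k K]]
  have [measurable]: "steiner k K \<in> sets borel" using SD(1) by (simp add: borel_compact)
  have "ennreal (moment p a b (steiner k K) (refl_coord k u)) = (\<integral>\<^sup>+x. indicator (steiner k K) (refl_coord k x) * ennreal (askew a b (u \<bullet> refl_coord k x) powr p) \<partial>lborel)"
    unfolding moment_eq_nn_integral[OF SD(1)] by (simp add: refl_coord_adjoint indicator_def steiner_symmetric[OF k])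
  also have "\<dots> = ennreal (moment p a b (steiner k K) u)"
    unfolding moment_eq_nn_integral[OF SD(1)] by (rule nn_integral_refl_coord[OF k]) measurable
  finally show ?thesis unfolding moment_norm_def by (simp add: moment_nonneg)
qed

text \<open>Let \<open>m\<close> be the midpoint of the chord of \<open>K\<close> over \<open>y\<close>. The chord is run through twice, as \<open>m + v\<close> and as
  \<open>m - v\<close>, with \<open>v\<close> in the centered chord, and \<open>w + z + 2 v = (w + m + v) + (z - m + v)\<close>, so that
  \<open>askew_add\<close> and \<open>powr_add_le_weighted\<close> apply pointwise and the midpoint cancels. If \<open>z = - w\<close>,
  the two summands are \<open>v + q\<close> and \<open>v - q\<close> with \<open>q = w + m\<close>, and \<open>askew_kink\<close> makes the
  inequality strict near \<open>v = 0\<close> unless \<open>q = 0\<close>: equality forces a chord through the interior to be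
  centered at \<open>- w\<close>.\<close>

lemma steiner_fiber_le:
  fixes K :: "'a::euclidean_space set" and y :: 'a and A B w z :: real
  assumes k: "k \<in> Basis" and K: "K \<in> convex_bodies_o" and y: "y \<bullet> k = 0" and AB: "0 < A" "0 < B"
  defines "\<psi> \<equiv> (\<integral>\<^sup>+v. indicator (steiner k K) (y + v *\<^sub>R k) * ennreal (askew a b (w + z + 2 * v) powr p) \<partial>lborel)"
  defines "\<phi> \<equiv> ennreal (((A + B) / A) powr (p - 1)) * (\<integral>\<^sup>+t. indicator K (y + t *\<^sub>R k) * ennreal (askew a b (w + t) powr p) \<partial>lborel)
    + ennreal (((A + B) / B) powr (p - 1)) * (\<integral>\<^sup>+t. indicator K (y + t *\<^sub>R k) * ennreal (askew a b (z - t) powr p) \<partial>lborel)"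
  shows "\<psi> \<le> \<phi>"
    and "\<psi> = \<phi> \<Longrightarrow> \<psi> \<noteq> \<infinity> \<Longrightarrow> z = - w \<Longrightarrow> y + t0 *\<^sub>R k \<in> interior K \<Longrightarrow> y + t *\<^sub>R k \<in> K
       \<Longrightarrow> y + (- (2 * w) - t) *\<^sub>R k \<in> K"
proof -
  note KD = convex_bodies_oD[OF K] and SD = convex_bodies_oD[OF steiner_convex_body[OF k K]]
  have [measurable]: "K \<in> sets borel" "steiner k K \<in> sets borel" using KD(1) SD(1) by (auto simp: borel_compact)
  obtain m where m: "\<And>v. y + v *\<^sub>R k \<in> steiner k K \<longleftrightarrow> y + (m + v) *\<^sub>R k \<in> K"
    "\<And>v. y + v *\<^sub>R k \<in> steiner k K \<longleftrightarrow> y + (m - v) *\<^sub>R k \<in> K"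
      using steiner_chord[OF k KD(1,2) y] by blast
    note slice = steiner_slice_integral[where K=K and y=y and k=k and m=m, OF KD(1) m]
  define c d where "c = ((A + B) / A) powr (p - 1)" and "d = ((A + B) / B) powr (p - 1)"
  have cd: "0 < c" "0 < d" using AB unfolding c_def d_def by (auto simp: add_pos_pos)
  define X Y where "X v = askew a b (w + m + v)" and "Y v = askew a b (z - m + v)" for v
  have XY: "0 \<le> X v" "0 \<le> Y v" for v unfolding X_def Y_def by (rule askew_nonneg[OF a b])+
  have XYm [measurable]: "X \<in> borel_measurable borel" "Y \<in> borel_measurable borel" unfolding X_def[abs_def] Y_def[abs_def] by measurable
  have sum_le: "askew a b (w + z + 2 * v) \<le> X v + Y v" for v
  proof -
    have "w + z + 2 * v = (w + m + v) + (z - m + v)" by simp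
    then show ?thesis unfolding X_def Y_def by (metis askew_add)
  qed
  have weighted: "(X v + Y v) powr p \<le> c * X v powr p + d * Y v powr p" for v
    unfolding c_def d_def using XY AB p by (intro powr_add_le_weighted) auto
  let ?\<Phi>1 = "\<integral>\<^sup>+t. indicator K (y + t *\<^sub>R k) * ennreal (askew a b (w + t) powr p) \<partial>lborel"
  let ?\<Phi>2 = "\<integral>\<^sup>+t. indicator K (y + t *\<^sub>R k) * ennreal (askew a b (z - t) powr p) \<partial>lborel"
  have rhs: "\<phi> = (\<integral>\<^sup>+v. indicator (steiner k K) (y + v *\<^sub>R k) * ennreal (c * X v powr p + d * Y v powr p) \<partial>lborel)"
  proof -
    have "?\<Phi>1 = (\<integral>\<^sup>+v. indicator (steiner k K) (y + v *\<^sub>R k) * ennreal (X v powr p) \<partial>lborel)"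
      by (subst slice(1)) (auto simp: X_def add.assoc)
    moreover have "?\<Phi>2 = (\<integral>\<^sup>+v. indicator (steiner k K) (y + v *\<^sub>R k) * ennreal (Y v powr p) \<partial>lborel)"
      by (subst slice(2)) (auto simp: Y_def algebra_simps)
    ultimately have "\<phi> = (\<integral>\<^sup>+v. ennreal c * (indicator (steiner k K) (y + v *\<^sub>R k) * ennreal (X v powr p)) \<partial>lborel)
       + (\<integral>\<^sup>+v. ennreal d * (indicator (steiner k K) (y + v *\<^sub>R k) * ennreal (Y v powr p)) \<partial>lborel)"
      unfolding \<phi>_def c_def[symmetric] d_def[symmetric] by (simp add: nn_integral_cmult)
    also have "\<dots> = (\<integral>\<^sup>+v. ennreal c * (indicator (steiner k K) (y + v *\<^sub>R k) * ennreal (X v powr p))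
       + ennreal d * (indicator (steiner k K) (y + v *\<^sub>R k) * ennreal (Y v powr p)) \<partial>lborel)"
      by (rule nn_integral_add[symmetric]) measurable
    also have "\<dots> = (\<integral>\<^sup>+v. indicator (steiner k K) (y + v *\<^sub>R k) * ennreal (c * X v powr p + d * Y v powr p) \<partial>lborel)"
      using cd by (intro nn_integral_cong) (auto simp: indicator_def ennreal_mult ennreal_plus)
    finally show ?thesis .
  qed
  have pointwise: "askew a b (w + z + 2 * v) powr p \<le> c * X v powr p + d * Y v powr p" for v
    using weighted[of v] powr_mono2[OF _ askew_nonneg[OF a b] sum_le[of v], of p] p by simp
  show "\<psi> \<le> \<phi>" unfolding rhs \<psi>_def
    by (intro nn_integral_mono mult_left_mono ennreal_leI pointwise) simp
  assume eq: "\<psi> = \<phi>" and fin: "\<psi> \<noteq> \<infinity>" and z: "z = - w" and t0: "y + t0 *\<^sub>R k \<in> interior K" and t: "y + t *\<^sub>R k \<in> K"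
  have q: "w + m = 0"
  proof (rule ccontr)
    assume q: "w + m \<noteq> 0"
    obtain e where e: "0 < e" "ball (y + t0 *\<^sub>R k) e \<subseteq> K" using t0 mem_interior by blast
    have chord: "y + v *\<^sub>R k \<in> steiner k K" if "\<bar>v\<bar> < e" for v
    proof -
      have "y + (t0 + v) *\<^sub>R k \<in> ball (y + t0 *\<^sub>R k) e" "y + (t0 - v) *\<^sub>R k \<in> ball (y + t0 *\<^sub>R k) e"
        using that k by (auto simp: dist_norm algebra_simps)
      then have "y + (t0 + v) *\<^sub>R k \<in> K" "y + (t0 - v) *\<^sub>R k \<in> K" using e by blast+
      then show ?thesis unfolding mem_steiner[OF k y] by force
    qed
    have strict: "askew a b (w + z + 2 * v) powr p < c * X v powr p + d * Y v powr p" if "\<bar>v\<bar> < \<bar>w + m\<bar>" for v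
    proof -
      have "askew a b (w + z + 2 * v) = 2 * askew a b v" using z askew_scale[of 2 a b v] by simp
      also have "\<dots> < X v + Y v" using askew_kink[OF ab that] unfolding X_def Y_def z by (simp add: algebra_simps)
      finally have "askew a b (w + z + 2 * v) powr p < (X v + Y v) powr p"
        using p askew_nonneg[OF a b] by (intro powr_less_mono2) auto
      then show ?thesis using weighted[of v] by linarith
    qed
    define \<epsilon> where "\<epsilon> = min e \<bar>w + m\<bar>"
    have "0 < \<epsilon>" using e(1) q unfolding \<epsilon>_def by simp
    have "\<psi> < (\<integral>\<^sup>+v. indicator (steiner k K) (y + v *\<^sub>R k) * ennreal (c * X v powr p + d * Y v powr p) \<partial>lborel)"
      unfolding \<psi>_def
    proof (rule nn_integral_less)
      show "AE v in lborel. indicator (steiner k K) (y + v *\<^sub>R k) * ennreal (askew a b (w + z + 2 * v) powr p)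
         \<le> indicator (steiner k K) (y + v *\<^sub>R k) * ennreal (c * X v powr p + d * Y v powr p)"
        by (intro AE_I2 mult_left_mono ennreal_leI pointwise) simp
      show "\<not> (AE v in lborel. indicator (steiner k K) (y + v *\<^sub>R k) * ennreal (c * X v powr p + d * Y v powr p)
         \<le> indicator (steiner k K) (y + v *\<^sub>R k) * ennreal (askew a b (w + z + 2 * v) powr p))"
      proof
        assume "AE v in lborel. indicator (steiner k K) (y + v *\<^sub>R k) * ennreal (c * X v powr p + d * Y v powr p)
         \<le> indicator (steiner k K) (y + v *\<^sub>R k) * ennreal (askew a b (w + z + 2 * v) powr p)"
        then have "AE v in lborel. v \<notin> {-\<epsilon><..<\<epsilon>}"
        proof eventually_elim
          case (elim v)
          show ?case
          proof
            assume "v \<in> {-\<epsilon><..<\<epsilon>}"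
            then have v: "\<bar>v\<bar> < e" "\<bar>v\<bar> < \<bar>w + m\<bar>" unfolding \<epsilon>_def by auto
            have "ennreal (c * X v powr p + d * Y v powr p) \<le> ennreal (askew a b (w + z + 2 * v) powr p)"
              using elim chord[OF v(1)] by simp
            then show False using strict[OF v(2)] by (simp add: ennreal_le_iff)
          qed
        qed
        then have "emeasure lborel {-\<epsilon><..<\<epsilon>} = 0"
          by (intro AE_iff_null_sets[THEN iffD2, THEN null_setsD1]) auto
        then show False using \<open>0 < \<epsilon>\<close> by simp
      qed
      show "(\<integral>\<^sup>+v. indicator (steiner k K) (y + v *\<^sub>R k) * ennreal (askew a b (w + z + 2 * v) powr p) \<partial>lborel) \<noteq> \<infinity>"
        using fin unfolding \<psi>_def .
    qed measurable
    then show False using eq unfolding rhs by simp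
  qed
  have "y + (m + (t - m)) *\<^sub>R k \<in> K" using t by simp
  then have "y + (m - (t - m)) *\<^sub>R k \<in> K" using m(1,2) by blast
  moreover have "m - (t - m) = - (2 * w) - t" using q by (simp add: algebra_simps)
  ultimately show "y + (- (2 * w) - t) *\<^sub>R k \<in> K" by simp
qed

lemma moment_norm_steiner_slices:
  fixes K :: "'a::euclidean_space set"
  assumes k: "k \<in> Basis" and K: "K \<in> convex_bodies_o" and z: "z1 \<bullet> k = 0" "z2 \<bullet> k = 0"
  shows "ennreal ((2 * moment_norm p a b (steiner k K) ((1/2) *\<^sub>R (z1 + z2) + k)) powr p)
      = (\<integral>\<^sup>+y. (\<integral>\<^sup>+v. indicator (steiner k K) (y + v *\<^sub>R k) * ennreal (askew a b (z1 \<bullet> y + z2 \<bullet> y + 2 * v) powr p) \<partial>lborel) \<partial>coord_lborel (Basis - {k}))"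
    and "ennreal (moment_norm p a b K (z1 + k) powr p)
      = (\<integral>\<^sup>+y. (\<integral>\<^sup>+t. indicator K (y + t *\<^sub>R k) * ennreal (askew a b (z1 \<bullet> y + t) powr p) \<partial>lborel) \<partial>coord_lborel (Basis - {k}))"
    and "ennreal (moment_norm p a b K (z2 - k) powr p)
      = (\<integral>\<^sup>+y. (\<integral>\<^sup>+t. indicator K (y + t *\<^sub>R k) * ennreal (askew a b (z2 \<bullet> y - t) powr p) \<partial>lborel) \<partial>coord_lborel (Basis - {k}))"
proof -
  note KD = convex_bodies_oD[OF K] and SD = convex_bodies_oD[OF steiner_convex_body[OF k K]]
  have kk: "k \<bullet> k = 1" using k by simp
  have "(2 * moment_norm p a b (steiner k K) ((1/2) *\<^sub>R (z1 + z2) + k)) powr p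
      = moment_norm p a b (steiner k K) (2 *\<^sub>R ((1/2) *\<^sub>R (z1 + z2) + k)) powr p"
    by (subst moment_norm_scale) auto
  also have "2 *\<^sub>R ((1/2) *\<^sub>R (z1 + z2) + k) = z1 + z2 + 2 *\<^sub>R k" by (simp add: algebra_simps)
  finally have e1: "(2 * moment_norm p a b (steiner k K) ((1/2) *\<^sub>R (z1 + z2) + k)) powr p = moment p a b (steiner k K) (z1 + z2 + 2 *\<^sub>R k)"
    unfolding moment_norm_powr .
  show "ennreal ((2 * moment_norm p a b (steiner k K) ((1/2) *\<^sub>R (z1 + z2) + k)) powr p)
      = (\<integral>\<^sup>+y. (\<integral>\<^sup>+v. indicator (steiner k K) (y + v *\<^sub>R k) * ennreal (askew a b (z1 \<bullet> y + z2 \<bullet> y + 2 * v) powr p) \<partial>lborel) \<partial>coord_lborel (Basis - {k}))"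
    unfolding e1 moment_slices[OF k SD(1)]
  proof (rule nn_integral_cong_AE, rule eventually_mono[OF coord_orthogonal[OF k]])
    fix y :: 'a assume y: "y \<bullet> k = 0"
    have e: "(z1 + z2 + 2 *\<^sub>R k) \<bullet> y = z1 \<bullet> y + z2 \<bullet> y" "(z1 + z2 + 2 *\<^sub>R k) \<bullet> k = 2" using y z kk by (simp_all add: inner_add_left inner_diff_left inner_commute[of k y])
    show "(\<integral>\<^sup>+t. indicator (steiner k K) (y + t *\<^sub>R k) * ennreal (askew a b ((z1 + z2 + 2 *\<^sub>R k) \<bullet> y + (z1 + z2 + 2 *\<^sub>R k) \<bullet> k * t) powr p) \<partial>lborel)
      = (\<integral>\<^sup>+t. indicator (steiner k K) (y + t *\<^sub>R k) * ennreal (askew a b (z1 \<bullet> y + z2 \<bullet> y + 2 * t) powr p) \<partial>lborel)"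
      unfolding e by simp
  qed
  show "ennreal (moment_norm p a b K (z1 + k) powr p)
      = (\<integral>\<^sup>+y. (\<integral>\<^sup>+t. indicator K (y + t *\<^sub>R k) * ennreal (askew a b (z1 \<bullet> y + t) powr p) \<partial>lborel) \<partial>coord_lborel (Basis - {k}))"
    unfolding moment_norm_powr moment_slices[OF k KD(1)]
  proof (rule nn_integral_cong_AE, rule eventually_mono[OF coord_orthogonal[OF k]])
    fix y :: 'a assume y: "y \<bullet> k = 0"
    have e: "(z1 + k) \<bullet> y = z1 \<bullet> y" "(z1 + k) \<bullet> k = 1" using y z kk by (simp_all add: inner_add_left inner_diff_left inner_commute[of k y])
    show "(\<integral>\<^sup>+t. indicator K (y + t *\<^sub>R k) * ennreal (askew a b ((z1 + k) \<bullet> y + (z1 + k) \<bullet> k * t) powr p) \<partial>lborel)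
      = (\<integral>\<^sup>+t. indicator K (y + t *\<^sub>R k) * ennreal (askew a b (z1 \<bullet> y + t) powr p) \<partial>lborel)"
      unfolding e by simp
  qed
  show "ennreal (moment_norm p a b K (z2 - k) powr p)
      = (\<integral>\<^sup>+y. (\<integral>\<^sup>+t. indicator K (y + t *\<^sub>R k) * ennreal (askew a b (z2 \<bullet> y - t) powr p) \<partial>lborel) \<partial>coord_lborel (Basis - {k}))"
    unfolding moment_norm_powr moment_slices[OF k KD(1)]
  proof (rule nn_integral_cong_AE, rule eventually_mono[OF coord_orthogonal[OF k]])
    fix y :: 'a assume y: "y \<bullet> k = 0"
    have e: "(z2 - k) \<bullet> y = z2 \<bullet> y" "(z2 - k) \<bullet> k = - 1" using y z kk by (simp_all add: inner_add_left inner_diff_left inner_commute[of k y])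
    show "(\<integral>\<^sup>+t. indicator K (y + t *\<^sub>R k) * ennreal (askew a b ((z2 - k) \<bullet> y + (z2 - k) \<bullet> k * t) powr p) \<partial>lborel)
      = (\<integral>\<^sup>+t. indicator K (y + t *\<^sub>R k) * ennreal (askew a b (z2 \<bullet> y - t) powr p) \<partial>lborel)"
      unfolding e by simp
  qed
qed

lemma slice_measurable:
  fixes K :: "'a::euclidean_space set"
  assumes [measurable]: "K \<in> sets borel" "(\<lambda>x. f (fst x) (snd x)) \<in> borel_measurable (borel \<Otimes>\<^sub>M borel)"
  shows "(\<lambda>y. \<integral>\<^sup>+t. indicator K (y + t *\<^sub>R k) * ennreal (askew a b (f y t) powr p) \<partial>lborel) \<in> borel_measurable (coord_lborel J)"
proof -
  have [measurable]: "(\<lambda>x. f (fst x) (snd x)) \<in> borel_measurable (coord_lborel J \<Otimes>\<^sub>M lborel)"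
    using assms(2) by (subst measurable_cong_sets[OF sets_pair_measure_cong[OF sets_coord_lborel sets_lborel] refl])
  have "(\<lambda>x. indicator K (fst x + snd x *\<^sub>R k) * ennreal (askew a b (f (fst x) (snd x)) powr p)) \<in> borel_measurable (coord_lborel J \<Otimes>\<^sub>M lborel)"
    by measurable
  then show ?thesis by (intro lborel.borel_measurable_nn_integral) (simp add: case_prod_unfold)
qed

text \<open>The inequality of \<open>steiner_fiber_le\<close> is integrated over all chords, with the two norms on the right
  as the weights \<open>A\<close> and \<open>B\<close>; by \<open>weighted_sum_eq\<close> the right-hand sides add up to \<open>(A + B) powr p\<close>.
  If equality holds for \<open>z2 = - z1\<close>, then almost every chord is centered on the hyperplane
  \<open>(z1 + k) \<bullet> x = 0\<close>, and \<open>K\<close> is invariant under the reflection in this hyperplane along \<open>k\<close>.\<close>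

lemma moment_norm_steiner_le:
  fixes K :: "'a::euclidean_space set"
  assumes k: "k \<in> Basis" and K: "K \<in> convex_bodies_o" and z: "z1 \<bullet> k = 0" "z2 \<bullet> k = 0"
  shows "moment_norm p a b (steiner k K) ((1/2) *\<^sub>R (z1 + z2) + k) \<le> (moment_norm p a b K (z1 + k) + moment_norm p a b K (z2 - k)) / 2"
    and "moment_norm p a b (steiner k K) ((1/2) *\<^sub>R (z1 + z2) + k) = (moment_norm p a b K (z1 + k) + moment_norm p a b K (z2 - k)) / 2
      \<Longrightarrow> z2 = - z1 \<Longrightarrow> x \<in> K \<Longrightarrow> x - (2 * ((z1 + k) \<bullet> x)) *\<^sub>R k \<in> K"
proof -
  note KD = convex_bodies_oD[OF K] and SD = convex_bodies_oD[OF steiner_convex_body[OF k K]]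
  have [measurable]: "K \<in> sets borel" "steiner k K \<in> sets borel" using KD(1) SD(1) by (auto simp: borel_compact)
  have kk: "k \<bullet> k = 1" using k by simp
  have "(z1 + k) \<bullet> k = 1" "(z2 - k) \<bullet> k = -1" using z kk by (auto simp: inner_add_left inner_diff_left)
  then have "z1 + k \<noteq> 0" "z2 - k \<noteq> 0" by force+
  define A B where "A = moment_norm p a b K (z1 + k)" and "B = moment_norm p a b K (z2 - k)"
  have AB: "0 < A" "0 < B" unfolding A_def B_def using moment_norm_pos[OF K] \<open>z1 + k \<noteq> 0\<close> \<open>z2 - k \<noteq> 0\<close> by auto
  define c d where "c = ((A + B) / A) powr (p - 1)" and "d = ((A + B) / B) powr (p - 1)"
  have cd: "0 \<le> c" "0 \<le> d" unfolding c_def d_def by auto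
  define H where "H = moment_norm p a b (steiner k K) ((1/2) *\<^sub>R (z1 + z2) + k)"
  let ?N = "coord_lborel (Basis - {k})"
  define \<psi> where "\<psi> y = (\<integral>\<^sup>+v. indicator (steiner k K) (y + v *\<^sub>R k) * ennreal (askew a b (z1 \<bullet> y + z2 \<bullet> y + 2 * v) powr p) \<partial>lborel)" for y
  define \<Phi>1 where "\<Phi>1 y = (\<integral>\<^sup>+t. indicator K (y + t *\<^sub>R k) * ennreal (askew a b (z1 \<bullet> y + t) powr p) \<partial>lborel)" for y
  define \<Phi>2 where "\<Phi>2 y = (\<integral>\<^sup>+t. indicator K (y + t *\<^sub>R k) * ennreal (askew a b (z2 \<bullet> y - t) powr p) \<partial>lborel)" for y
  have m\<psi> [measurable]: "\<psi> \<in> borel_measurable ?N" "\<Phi>1 \<in> borel_measurable ?N" "\<Phi>2 \<in> borel_measurable ?N"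
    unfolding \<psi>_def[abs_def] \<Phi>1_def[abs_def] \<Phi>2_def[abs_def] by (rule slice_measurable; measurable)+
  have int\<psi>: "ennreal ((2 * H) powr p) = (\<integral>\<^sup>+y. \<psi> y \<partial>?N)"
    unfolding H_def \<psi>_def by (rule moment_norm_steiner_slices(1)[OF k K z])
  \<comment> \<open>Since the weights are the two norms, the weighted bound is attained by the integrals.\<close>
  have int12: "(\<integral>\<^sup>+y. ennreal c * \<Phi>1 y + ennreal d * \<Phi>2 y \<partial>?N) = ennreal ((A + B) powr p)"
  proof -
    have "(\<integral>\<^sup>+y. ennreal c * \<Phi>1 y + ennreal d * \<Phi>2 y \<partial>?N) = ennreal c * (\<integral>\<^sup>+y. \<Phi>1 y \<partial>?N) + ennreal d * (\<integral>\<^sup>+y. \<Phi>2 y \<partial>?N)"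
      by (subst nn_integral_add) (auto simp: nn_integral_cmult)
    also have "\<dots> = ennreal c * ennreal (A powr p) + ennreal d * ennreal (B powr p)"
      unfolding A_def B_def moment_norm_steiner_slices(2,3)[OF k K z] \<Phi>1_def \<Phi>2_def ..
    also have "\<dots> = ennreal (c * A powr p + d * B powr p)" using cd by (simp add: ennreal_mult ennreal_plus)
    also have "c * A powr p + d * B powr p = (A + B) powr p" unfolding c_def d_def by (rule weighted_sum_eq[OF AB])
    finally show ?thesis .
  qed
  have le: "AE y in ?N. \<psi> y \<le> ennreal c * \<Phi>1 y + ennreal d * \<Phi>2 y"
    using coord_orthogonal[OF k]
  proof eventually_elim
    case (elim y)
    then show ?case unfolding \<psi>_def \<Phi>1_def \<Phi>2_def c_def d_def by (rule steiner_fiber_le(1)[OF k K _ AB])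
  qed
  have "ennreal ((2 * H) powr p) \<le> ennreal ((A + B) powr p)"
    unfolding int\<psi> int12[symmetric] using le by (rule nn_integral_mono_AE)
  then have "2 * H \<le> A + B" using AB moment_norm_nonneg[where K="steiner k K"] unfolding H_def
    by (intro le_from_powr[of "2 * _"]) (simp_all add: ennreal_le_iff)
  then show "moment_norm p a b (steiner k K) ((1/2) *\<^sub>R (z1 + z2) + k) \<le> (moment_norm p a b K (z1 + k) + moment_norm p a b K (z2 - k)) / 2"
    unfolding A_def B_def H_def by simp
  assume eq: "moment_norm p a b (steiner k K) ((1/2) *\<^sub>R (z1 + z2) + k) = (moment_norm p a b K (z1 + k) + moment_norm p a b K (z2 - k)) / 2"
    and z21: "z2 = - z1" and x: "x \<in> K"
  have fin: "(\<integral>\<^sup>+y. \<psi> y \<partial>?N) \<noteq> \<infinity>" unfolding int\<psi>[symmetric] by simp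
  have eqi: "(\<integral>\<^sup>+y. \<psi> y \<partial>?N) = (\<integral>\<^sup>+y. ennreal c * \<Phi>1 y + ennreal d * \<Phi>2 y \<partial>?N)"
  proof -
    have "2 * H = A + B" using eq unfolding A_def B_def H_def by simp
    then show ?thesis unfolding int\<psi>[symmetric] int12 by simp
  qed
  \<comment> \<open>The two sides have the same finite integral.\<close>
  have ge: "AE y in ?N. ennreal c * \<Phi>1 y + ennreal d * \<Phi>2 y \<le> \<psi> y"
  proof (rule ccontr)
    assume n: "\<not> ?thesis"
    have "(\<integral>\<^sup>+y. \<psi> y \<partial>?N) < (\<integral>\<^sup>+y. ennreal c * \<Phi>1 y + ennreal d * \<Phi>2 y \<partial>?N)"
      by (rule nn_integral_less[OF _ _ fin le n]) measurable
    then show False using eqi by simp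
  qed
  have finy: "AE y in ?N. \<psi> y \<noteq> \<infinity>" using nn_integral_noteq_infinite[OF m\<psi>(1) fin] .
  define R where "R x = x - (2 * ((z1 + k) \<bullet> x)) *\<^sub>R k" for x
  have Rc: "continuous_on UNIV R" unfolding R_def[abs_def] by (intro continuous_intros)
  \<comment> \<open>The interior points with mirror image outside \<open>K\<close> form an open set of measure \<open>0\<close>.\<close>
  define G where "G = interior K \<inter> R -` (- K)"
  have "open (R -` (- K))" using Rc KD(6) by (intro open_vimage) auto
  then have G: "open G" unfolding G_def by (intro open_Int open_interior)
  have "AE y in ?N. (\<integral>\<^sup>+t. indicator G (y + t *\<^sub>R k) \<partial>lborel) = (0::ennreal)"
    using coord_orthogonal[OF k] le ge finy
  proof eventually_elim
    case (elim y)
    have "y + t *\<^sub>R k \<notin> G" for t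
    proof
      assume "y + t *\<^sub>R k \<in> G"
      then have t: "y + t *\<^sub>R k \<in> interior K" "R (y + t *\<^sub>R k) \<notin> K" unfolding G_def by auto
      have "R (y + t *\<^sub>R k) = y + (t - 2 * (z1 \<bullet> y + t)) *\<^sub>R k"
      proof -
        have "(z1 + k) \<bullet> (y + t *\<^sub>R k) = z1 \<bullet> y + t"
          using elim(1) z(1) kk by (simp add: inner_add_left inner_add_right inner_commute[of k y])
        then show ?thesis unfolding R_def scaleR_left_diff_distrib by simp
      qed
      moreover have "y + (- (2 * (z1 \<bullet> y)) - t) *\<^sub>R k \<in> K"
      proof (rule steiner_fiber_le(2)[OF k K elim(1) AB, of "z1 \<bullet> y" "z2 \<bullet> y" t t])
        show "y + t *\<^sub>R k \<in> interior K" "y + t *\<^sub>R k \<in> K" using t interior_subset by auto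
        show "z2 \<bullet> y = - (z1 \<bullet> y)" using z21 by simp
        show "(\<integral>\<^sup>+v. indicator (steiner k K) (y + v *\<^sub>R k) * ennreal (askew a b (z1 \<bullet> y + z2 \<bullet> y + 2 * v) powr p) \<partial>lborel) \<noteq> \<infinity>"
          using elim(4) unfolding \<psi>_def .
      qed (use elim(2,3) in \<open>auto simp: \<psi>_def \<Phi>1_def \<Phi>2_def c_def d_def intro: antisym\<close>)
      moreover have "- (2 * (z1 \<bullet> y)) - t = t - 2 * (z1 \<bullet> y + t)" by simp
      ultimately show False using t(2) by simp
    qed
    then show ?case by simp
  qed
  then have "(\<integral>\<^sup>+y. (\<integral>\<^sup>+t. indicator G (y + t *\<^sub>R k) \<partial>lborel) \<partial>?N) = (\<integral>\<^sup>+y. 0 \<partial>?N)" by (rule nn_integral_cong_AE)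
  then have "(\<integral>\<^sup>+x. indicator G x \<partial>lborel) = 0" using G by (subst nn_integral_slices[OF k]) auto
  then have "emeasure lborel G = 0" using G by simp
  then have "G = {}" using open_not_negligible[OF G] G
    by (auto simp: negligible_iff_null_sets null_sets_def emeasure_completion)
  then have "interior K \<subseteq> R -` K" unfolding G_def by auto
  moreover have "closed (R -` K)" using Rc KD(6) by (intro closed_vimage) auto
  ultimately have "closure (interior K) \<subseteq> R -` K" by (rule closure_minimal)
  then show "x - (2 * ((z1 + k) \<bullet> x)) *\<^sub>R k \<in> K" using x KD(9) unfolding R_def by auto
qed

lemma polar_wrt_moment_body:
  assumes K: "K \<in> convex_bodies_o" and x: "x \<in> interior (moment_body K)"
  shows "emeasure lborel {y. moment_norm p a b K y - x \<bullet> y \<le> 1} = ennreal (vol (polar_wrt (moment_body K) x))"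
    and "{y. moment_norm p a b K y - x \<bullet> y \<le> 1} \<in> sets borel"
  using polar_sublevel_measure[OF moment_body(1)[OF K] x] unfolding moment_body(2)[OF K] by auto

lemma interior_moment_body_iff:
  assumes K: "K \<in> convex_bodies_o"
  shows "x \<in> interior (moment_body K) \<longleftrightarrow> (\<forall>u. u \<noteq> 0 \<longrightarrow> u \<bullet> x < moment_norm p a b K u)"
  using interior_iff_support_fun[OF moment_body(1)[OF K]] unfolding moment_body(2)[OF K] .

lemma moment_norm_measurable:
  assumes K: "K \<in> convex_bodies_o"
  shows "moment_norm p a b K \<in> borel_measurable borel"
  using support_fun_measurable[of "moment_body K"] convex_bodies_oD[OF moment_body(1)[OF K]] unfolding moment_body(2)[OF K] by blast

text \<open>The moment body is symmetric with respect to the hyperplane orthogonal to \<open>k\<close>, and so is its unique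
  Santalo point.\<close>

lemma santalo_point_steiner_orthogonal:
  fixes K :: "'a::euclidean_space set"
  assumes k: "k \<in> Basis" and K: "K \<in> convex_bodies_o"
  shows "santalo_point (moment_body (steiner k K)) \<bullet> k = 0"
proof -
  let ?S = "steiner k K" and ?M = "moment_body (steiner k K)"
  note S = steiner_convex_body[OF k K]
  note M = moment_body(1)[OF S]
  define s where "s = santalo_point ?M"
  have s: "s \<in> interior ?M" unfolding s_def by (rule santalo_point(1)[OF M])
  have rs: "refl_coord k s \<in> interior ?M"
    unfolding interior_moment_body_iff[OF S]
  proof (intro allI impI)
    fix u :: 'a assume "u \<noteq> 0"
    then have "refl_coord k u \<noteq> 0" using refl_coord_involution[OF k, of u] linear_0[OF refl_coord_linear[of k]] by force
    then have "refl_coord k u \<bullet> s < moment_norm p a b ?S (refl_coord k u)" using s unfolding interior_moment_body_iff[OF S] by blast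
    then show "u \<bullet> refl_coord k s < moment_norm p a b ?S u" by (simp add: refl_coord_adjoint moment_norm_steiner_refl[OF k K])
  qed
  have "{y. moment_norm p a b ?S y - refl_coord k s \<bullet> y \<le> 1} = {y. refl_coord k y \<in> {y. moment_norm p a b ?S y - s \<bullet> y \<le> 1}}"
    by (simp add: refl_coord_adjoint moment_norm_steiner_refl[OF k K])
  then have "ennreal (vol (polar_wrt ?M (refl_coord k s))) = ennreal (vol (polar_wrt ?M s))"
    unfolding polar_wrt_moment_body(1)[OF S rs, symmetric] polar_wrt_moment_body(1)[OF S s, symmetric]
    using emeasure_refl_coord[OF k polar_wrt_moment_body(2)[OF S s]] by simp
  then have "vol (polar_wrt ?M (refl_coord k s)) = vol (polar_wrt ?M s)" by simp
  then have "refl_coord k s = s"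
    using santalo_point(2)[OF M] unfolding santalo_polar_def s_def[symmetric]
    by (intro santalo_point_unique[OF M rs _ s]) auto
  then have "(2 * (s \<bullet> k)) *\<^sub>R k = 0" unfolding refl_coord_def by (metis diff_eq_eq add_cancel_left_right)
  then show ?thesis using k unfolding s_def by auto
qed

text \<open>By \<open>moment_norm_steiner_orthogonal\<close> the two moment bodies have the same projection along \<open>k\<close>. A
  hyperplane separating the line from the interior would be parallel to \<open>k\<close> and contradict this.\<close>

lemma steiner_line_meets_interior:
  fixes K :: "'a::euclidean_space set"
  assumes k: "k \<in> Basis" and K: "K \<in> convex_bodies_o" and s: "s \<in> interior (moment_body (steiner k K))"
  shows "\<exists>t. s + t *\<^sub>R k \<in> interior (moment_body K)"
proof (rule ccontr)
  assume contra: "\<not> ?thesis"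
  note LD = convex_bodies_oD[OF moment_body(1)[OF K]]
  let ?l = "range (\<lambda>t. s + t *\<^sub>R k)"
  have "convex ?l" unfolding convex_alt
  proof safe
    fix x y z :: real assume "0 \<le> z" "z \<le> 1"
    have "(1 - z) *\<^sub>R (s + x *\<^sub>R k) + z *\<^sub>R (s + y *\<^sub>R k) = s + ((1 - z) * x + z * y) *\<^sub>R k" by (simp add: algebra_simps)
    then show "(1 - z) *\<^sub>R (s + x *\<^sub>R k) + z *\<^sub>R (s + y *\<^sub>R k) \<in> ?l" by blast
  qed
  moreover have "interior (moment_body K) \<inter> ?l = {}" using contra by auto
  ultimately obtain u c where u: "u \<noteq> 0" "\<forall>x\<in>interior (moment_body K). u \<bullet> x \<le> c" "\<forall>x\<in>?l. u \<bullet> x \<ge> c"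
    using separating_hyperplane_sets[of "interior (moment_body K)" ?l] LD by (auto simp: convex_interior)
  have line: "c \<le> u \<bullet> s + t * (u \<bullet> k)" for t using u(3) by (auto simp: inner_add_right)
  have uk: "u \<bullet> k = 0"
  proof (rule ccontr)
    assume n: "u \<bullet> k \<noteq> 0"
    show False using line[of "(c - u \<bullet> s - 1) / (u \<bullet> k)"] n by simp
  qed
  have "closed {x. u \<bullet> x \<le> c}" by (rule closed_halfspace_le)
  then have "closure (interior (moment_body K)) \<subseteq> {x. u \<bullet> x \<le> c}" using u(2) by (intro closure_minimal) auto
  then have "support_fun (moment_body K) u \<le> c" using LD by (intro support_fun_least) auto
  then have "moment_norm p a b K u \<le> u \<bullet> s" using line[of 0] unfolding moment_body(2)[OF K] by simp
  moreover have "u \<bullet> s < moment_norm p a b (steiner k K) u"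
    using s u(1) unfolding interior_moment_body_iff[OF steiner_convex_body[OF k K]] by blast
  ultimately show False using moment_norm_steiner_orthogonal[OF k K uk] by simp
qed

end

section \<open>The Santalo volume under Steiner symmetrization\<close>

context moment_params
begin

text \<open>Let \<open>s\<close> be the Santalo point for \<open>steiner k K\<close>. For \<open>K\<close> the polar is taken with respect to a point
  \<open>s + t k\<close> chosen by \<open>equal_half_volumes\<close>; its volume is an upper bound for the Santalo volume. The
  inequality \<open>moment_norm_steiner_le\<close> compares, on the hyperplanes at heights \<open>\<plusminus> 1\<close>, the gauge of
  the polar for \<open>steiner k K\<close> with the gauge for \<open>K\<close>; the shift \<open>t\<close> cancels in the mean.
  By \<open>borell_brascamp_lieb_harmonic\<close> each half of the symmetrized polar is at least as large as the
  common half volume for \<open>K\<close>.\<close>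

theorem santalo_volume_steiner:
  fixes K :: "'a::euclidean_space set"
  assumes k: "k \<in> Basis" and K: "K \<in> convex_bodies_o"
  shows "vol (santalo_polar (moment_body K)) \<le> vol (santalo_polar (moment_body (steiner k K)))"
    and "vol (santalo_polar (moment_body K)) = vol (santalo_polar (moment_body (steiner k K))) \<Longrightarrow>
      \<exists>\<zeta>. \<zeta> \<bullet> k = 0 \<and> (\<forall>x\<in>K. x - (2 * ((\<zeta> + k) \<bullet> x)) *\<^sub>R k \<in> K)"
proof -
  let ?S = "steiner k K" and ?n = "DIM('a)" and ?J = "Basis - {k}" and ?N = "coord_lborel (Basis - {k})"
  define h where "h = moment_norm p a b K"
  define hS where "hS = moment_norm p a b ?S"
  note S = steiner_convex_body[OF k K]
  note L = moment_body(1)[OF K] and M = moment_body(1)[OF S]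
  have k0: "k \<noteq> 0" and kk: "k \<bullet> k = 1" using k by auto
  have hm [measurable]: "h \<in> borel_measurable borel" "hS \<in> borel_measurable borel"
    unfolding h_def hS_def using moment_norm_measurable K S by auto
  define s where "s = santalo_point (moment_body ?S)"
  have s: "s \<in> interior (moment_body ?S)" unfolding s_def by (rule santalo_point(1)[OF M])
  have sk: "s \<bullet> k = 0" unfolding s_def by (rule santalo_point_steiner_orthogonal[OF k K])
  obtain \<tau> where \<tau>: "s + \<tau> *\<^sub>R k \<in> interior (moment_body K)" using steiner_line_meets_interior[OF k K s] by blast
  from equal_half_volumes[OF L k0 \<tau>] obtain t where x: "s + t *\<^sub>R k \<in> interior (moment_body K)"
    and half: "emeasure lborel {y \<in> {y. 0 < k \<bullet> y}. h y - (s + t *\<^sub>R k) \<bullet> y \<le> 1}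
      = emeasure lborel {y \<in> {y. k \<bullet> y < 0}. h y - (s + t *\<^sub>R k) \<bullet> y \<le> 1}"
    unfolding h_def moment_body(2)[OF K] by blast
  define g where "g y = h y - (s + t *\<^sub>R k) \<bullet> y" for y
  define gS where "gS y = hS y - s \<bullet> y" for y
  have gm [measurable]: "g \<in> borel_measurable borel" "gS \<in> borel_measurable borel"
    unfolding g_def[abs_def] gS_def[abs_def] by measurable
  have gpos: "u \<noteq> 0 \<Longrightarrow> 0 < g u" "u \<noteq> 0 \<Longrightarrow> 0 < gS u" for u
    using x s unfolding interior_moment_body_iff[OF K] interior_moment_body_iff[OF S] g_def gS_def h_def hS_def
    by (auto simp: inner_commute)
  have gscale: "0 < c \<Longrightarrow> g (c *\<^sub>R u) = c * g u" "0 < c \<Longrightarrow> gS (c *\<^sub>R u) = c * gS u" for c u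
    unfolding g_def gS_def h_def hS_def by (auto simp: moment_norm_scale algebra_simps)
  have gSrefl: "gS (refl_coord k y) = gS y" for y
  proof -
    have "refl_coord k s = s" using sk by (simp add: refl_coord_def)
    then show ?thesis unfolding gS_def hS_def by (simp add: moment_norm_steiner_refl[OF k K] refl_coord_adjoint[symmetric])
  qed
  define P where "P = {y. 0 < k \<bullet> y \<and> g y \<le> 1}"
  define Q where "Q = {y. 0 < k \<bullet> y \<and> gS y \<le> 1}"
  have Pneg: "emeasure lborel {y. k \<bullet> y < 0 \<and> g y \<le> 1} = emeasure lborel P" using half unfolding P_def g_def by simp
  have Qneg: "emeasure lborel {y. k \<bullet> y < 0 \<and> gS y \<le> 1} = emeasure lborel Q"
  proof -
    have Qb: "Q \<in> sets borel" unfolding Q_def by measurable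
    have "k \<bullet> refl_coord k y = - (k \<bullet> y)" for y using k by (simp add: refl_coord_def inner_diff_right inner_commute)
    then have "{y. k \<bullet> y < 0 \<and> gS y \<le> 1} = {y. refl_coord k y \<in> Q}" unfolding Q_def by (auto simp: gSrefl)
    then show ?thesis using emeasure_refl_coord[OF k Qb] by simp
  qed
  have volL: "ennreal (vol (polar_wrt (moment_body K) (s + t *\<^sub>R k))) = emeasure lborel P + emeasure lborel P"
    unfolding polar_wrt_moment_body(1)[OF K x, symmetric]
    using emeasure_halfspace_split[OF polar_wrt_moment_body(2)[OF K x] k0] Pneg unfolding P_def g_def h_def by simp
  have volM: "ennreal (vol (santalo_polar (moment_body ?S))) = emeasure lborel Q + emeasure lborel Q"
    unfolding santalo_polar_def s_def[symmetric] polar_wrt_moment_body(1)[OF S s, symmetric]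
    using emeasure_halfspace_split[OF polar_wrt_moment_body(2)[OF S s] k0] Qneg unfolding Q_def gS_def hS_def by simp
  have n: "?n = Suc (card ?J)" using k by (simp add: card_Diff_singleton)
  \<comment> \<open>The gauges of the polar bodies on the hyperplanes at heights \<open>1\<close>, \<open>- 1\<close> and \<open>1\<close>.\<close>
  define \<alpha> where "\<alpha> y = g (proj k y + k)" for y
  define \<beta> where "\<beta> y = g (proj k y - k)" for y
  define \<gamma> where "\<gamma> y = gS (proj k y + k)" for y
  have [measurable]: "\<alpha> \<in> borel_measurable borel" "\<beta> \<in> borel_measurable borel" "\<gamma> \<in> borel_measurable borel"
    unfolding \<alpha>_def[abs_def] \<beta>_def[abs_def] \<gamma>_def[abs_def] by measurable
  have ne: "proj k y + k \<noteq> 0" "proj k y - k \<noteq> 0" for y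
  proof -
    have "(proj k y + k) \<bullet> k = 1" "(proj k y - k) \<bullet> k = -1" using k by (auto simp: inner_add_left inner_diff_left)
    then show "proj k y + k \<noteq> 0" "proj k y - k \<noteq> 0" by force+
  qed
  have pos: "0 < \<alpha> y" "0 < \<beta> y" "0 < \<gamma> y" for y
    unfolding \<alpha>_def \<beta>_def \<gamma>_def using gpos ne by auto
  have A1: "(\<integral>\<^sup>+y. ennreal ((1 / \<alpha> y) ^ Suc (card ?J)) \<partial>?N) = ennreal (real ?n) * emeasure lborel P"
    using halfspace_sublevel_slices[OF k gm(1) gscale(1) gpos(1), of 1] unfolding \<alpha>_def P_def n[symmetric] by simp
  have A2: "(\<integral>\<^sup>+y. ennreal ((1 / \<beta> y) ^ Suc (card ?J)) \<partial>?N) = ennreal (real ?n) * emeasure lborel P"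
    using halfspace_sublevel_slices[OF k gm(1) gscale(1) gpos(1), of "-1"] Pneg unfolding \<beta>_def n[symmetric] by simp
  have A3: "(\<integral>\<^sup>+y. ennreal ((1 / \<gamma> y) ^ Suc (card ?J)) \<partial>?N) = ennreal (real ?n) * emeasure lborel Q"
    using halfspace_sublevel_slices[OF k gm(2) gscale(2) gpos(2), of 1] unfolding \<gamma>_def Q_def n[symmetric] by simp
  have mean: "(\<alpha> u + \<beta> v) / 2 = (h (proj k u + k) + h (proj k v - k)) / 2 - s \<bullet> proj k ((1/2) *\<^sub>R (u + v))" for u v
  proof -
    have "k \<bullet> proj k u = 0" "k \<bullet> proj k v = 0" using k by (simp_all add: inner_commute[of k])
    then have "(s + t *\<^sub>R k) \<bullet> (proj k u + k) = s \<bullet> proj k u + t" "(s + t *\<^sub>R k) \<bullet> (proj k v - k) = s \<bullet> proj k v - t"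
      using sk kk by (simp_all add: inner_add_left inner_add_right inner_diff_right)
    moreover have "s \<bullet> proj k ((1/2) *\<^sub>R (u + v)) = (s \<bullet> proj k u + s \<bullet> proj k v) / 2"
      by (simp add: proj_linear inner_add_right)
    ultimately show ?thesis unfolding \<alpha>_def \<beta>_def g_def by (simp add: add_divide_distrib diff_divide_distrib)
  qed
  have \<gamma>eq: "\<gamma> y = hS (proj k y + k) - s \<bullet> proj k y" for y
    unfolding \<gamma>_def gS_def using sk by (simp add: inner_add_right)
  have mid: "\<gamma> ((1/2) *\<^sub>R (u + v)) \<le> (\<alpha> u + \<beta> v) / 2" for u v
    unfolding mean \<gamma>eq h_def hS_def
    using moment_norm_steiner_le(1)[OF k K, of "proj k u" "proj k v"] k by (simp add: proj_linear)
  have canc: "emeasure lborel P \<le> emeasure lborel Q" if "ennreal (real ?n) * emeasure lborel P \<le> ennreal (real ?n) * emeasure lborel Q"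
    using that by (subst (asm) ennreal_mult_le_mult_iff) auto
  have PQ: "emeasure lborel P \<le> emeasure lborel Q"
    using borell_brascamp_lieb_harmonic[of ?J \<alpha> \<beta> \<gamma>, OF _ _ _ _ pos mid A1 A2] unfolding A3 by (intro canc) simp
  have le1: "vol (santalo_polar (moment_body K)) \<le> vol (polar_wrt (moment_body K) (s + t *\<^sub>R k))"
    by (rule santalo_point(2)[OF L x])
  have "ennreal (vol (polar_wrt (moment_body K) (s + t *\<^sub>R k))) \<le> ennreal (vol (santalo_polar (moment_body ?S)))"
    unfolding volL volM by (intro add_mono PQ)
  then have le2: "vol (polar_wrt (moment_body K) (s + t *\<^sub>R k)) \<le> vol (santalo_polar (moment_body ?S))"
    by (simp add: ennreal_le_iff)
  show "vol (santalo_polar (moment_body K)) \<le> vol (santalo_polar (moment_body ?S))" using le1 le2 by simp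
  assume eq: "vol (santalo_polar (moment_body K)) = vol (santalo_polar (moment_body ?S))"
  then have "vol (polar_wrt (moment_body K) (s + t *\<^sub>R k)) = vol (santalo_polar (moment_body ?S))" using le1 le2 by simp
  then have sums: "emeasure lborel P + emeasure lborel P = emeasure lborel Q + emeasure lborel Q" using volL volM by simp
  have Qfin: "emeasure lborel Q < \<infinity>"
    using volM by (metis ennreal_add_eq_top ennreal_less_top infinity_ennreal_def less_top)
  have QP: "emeasure lborel Q \<le> emeasure lborel P"
    using sums ennreal_mult_le_mult_iff[of 2 "emeasure lborel Q" "emeasure lborel P"] by (simp add: mult_2)
  show "\<exists>\<zeta>. \<zeta> \<bullet> k = 0 \<and> (\<forall>x\<in>K. x - (2 * ((\<zeta> + k) \<bullet> x)) *\<^sub>R k \<in> K)"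
  proof (rule ccontr)
    assume none: "\<not> ?thesis"
    \<comment> \<open>If no reflection exists, the midpoint inequality is strict at the midpoint \<open>0\<close> for every pair
      \<open>\<zeta>\<close>, \<open>- \<zeta>\<close>. Coercivity of \<open>E\<close> gives a uniform gap \<open>\<Delta>\<close> there, and Lipschitz bounds keep half of it
      for midpoints near \<open>0\<close>. So \<open>\<gamma>\<close> can be enlarged to \<open>\<eta>\<close> near \<open>0\<close> and the integral inequality still
      holds, which contradicts equality of the half volumes.\<close>
    define E where "E \<zeta> = (h (\<zeta> + k) + h (- \<zeta> - k)) / 2" for \<zeta>
    have Elt: "hS k < E \<zeta>" if "\<zeta> \<bullet> k = 0" for \<zeta>
    proof -
      have z: "- \<zeta> \<bullet> k = 0" using that by simp
      have "hS k \<le> E \<zeta>" using moment_norm_steiner_le(1)[OF k K that z] unfolding E_def h_def hS_def by simp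
      moreover have "hS k \<noteq> E \<zeta>"
        using moment_norm_steiner_le(2)[OF k K that z] none that unfolding E_def h_def hS_def by auto
      ultimately show ?thesis by simp
    qed
    obtain r R where rR: "0 < r" "\<And>u. r * norm u \<le> h u" "\<And>u. h u \<le> R * norm u" "0 < R"
      using support_fun_bounds[OF L] unfolding moment_body(2)[OF K] h_def by blast
    obtain r' R' where rR': "\<And>u. hS u \<le> R' * norm u" "0 < R'"
      using support_fun_bounds[OF M] unfolding moment_body(2)[OF S] hS_def by metis
    have hcont: "continuous_on A h" for A
      using support_fun_continuous[of "moment_body K"] convex_bodies_oD[OF L] unfolding moment_body(2)[OF K] h_def by blast
    have Econt: "continuous_on A E" for A unfolding E_def[abs_def]
      by (intro continuous_intros continuous_on_compose2[OF hcont[of UNIV]]) auto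
    define Z where "Z = {\<zeta>. \<zeta> \<bullet> k = 0} \<inter> cball 0 (E 0 / r + norm k)"
    have "closed {\<zeta>. \<zeta> \<bullet> k = 0}" by (intro closed_Collect_eq continuous_intros)
    then have Zc: "compact Z" unfolding Z_def by (intro closed_Int_compact) auto
    have "0 \<le> E 0" unfolding E_def h_def by (simp add: moment_norm_nonneg)
    then have "0 \<in> Z" unfolding Z_def using rR(1) by simp
    then obtain \<zeta>0 where \<zeta>0: "\<zeta>0 \<in> Z" "\<And>\<zeta>. \<zeta> \<in> Z \<Longrightarrow> E \<zeta>0 \<le> E \<zeta>"
      using continuous_attains_inf[OF Zc _ Econt] by blast
    have Emin: "E \<zeta>0 \<le> E \<zeta>" if "\<zeta> \<bullet> k = 0" for \<zeta>
    proof (cases "\<zeta> \<in> Z")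
      case False
      then have "E 0 / r + norm k < norm \<zeta>" using that unfolding Z_def by simp
      then have "E 0 / r < norm (\<zeta> + k)" using norm_triangle_ineq4[of "\<zeta> + k" k] by simp
      then have "E 0 < r * norm (\<zeta> + k)" using rR(1) by (simp add: field_simps)
      also have "\<dots> \<le> E \<zeta>" using rR(2)[of "\<zeta> + k"] rR(2)[of "- \<zeta> - k"] norm_minus_cancel[of "\<zeta> + k"]
        unfolding E_def by (simp add: algebra_simps)
      finally show ?thesis using \<zeta>0(2)[OF \<open>0 \<in> Z\<close>] by simp
    qed (use \<zeta>0 in simp)
    define \<Delta> where "\<Delta> = E \<zeta>0 - hS k"
    have \<Delta>: "0 < \<Delta>" using Elt[of \<zeta>0] \<zeta>0(1) unfolding \<Delta>_def Z_def by simp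
    \<comment> \<open>The Lipschitz constants of \<open>h\<close> and \<open>hS\<close>.\<close>
    define C where "C = R + R'"
    have C: "0 < C" unfolding C_def using rR(4) rR'(2) by simp
    define \<delta> where "\<delta> = \<Delta> / (2 * C)"
    have \<delta>: "0 < \<delta>" "C * \<delta> = \<Delta> / 2" unfolding \<delta>_def using \<Delta> C by auto
    define \<eta> where "\<eta> y = \<gamma> y + (if norm y < \<delta> then \<Delta> / 2 else 0)" for y
    have \<eta>m [measurable]: "\<eta> \<in> borel_measurable borel" unfolding \<eta>_def[abs_def] by measurable
    have \<eta>pos: "0 < \<eta> y" for y using pos(3)[of y] \<Delta> unfolding \<eta>_def by auto
    have \<eta>mid: "\<eta> ((1/2) *\<^sub>R (u + v)) \<le> (\<alpha> u + \<beta> v) / 2" for u v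
    proof (cases "norm ((1/2) *\<^sub>R (u + v)) < \<delta>")
      case True
      \<comment> \<open>The pair \<open>u\<close>, \<open>v\<close> is compared with the pair \<open>D\<close>, \<open>- D\<close>, whose midpoint is \<open>0\<close>.\<close>
      define W where "W = proj k ((1/2) *\<^sub>R (u + v))"
      define D where "D = proj k ((1/2) *\<^sub>R (u - v))"
      have W: "norm W \<le> \<delta>" using order_trans[OF norm_proj_le[OF k] less_imp_le[OF True]] unfolding W_def .
      have UV: "proj k u = W + D" "proj k v = W - D"
      proof -
        have W': "W = (1/2) *\<^sub>R (proj k u + proj k v)" unfolding W_def by (simp only: proj_linear)
        have "u - v = u + (-1) *\<^sub>R v" by simp
        then have D': "D = (1/2) *\<^sub>R (proj k u - proj k v)" unfolding D_def by (simp only: proj_linear) simp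
        have "W + D = (1/2) *\<^sub>R ((proj k u + proj k v) + (proj k u - proj k v))"
          unfolding W' D' by (rule scaleR_right_distrib[symmetric])
        also have "(proj k u + proj k v) + (proj k u - proj k v) = proj k u + proj k u" by simp
        finally show "proj k u = W + D" by (simp only: scaleR_half_double)
        have "W - D = (1/2) *\<^sub>R ((proj k u + proj k v) - (proj k u - proj k v))"
          unfolding W' D' by (rule scaleR_right_diff_distrib[symmetric])
        also have "(proj k u + proj k v) - (proj k u - proj k v) = proj k v + proj k v" by simp
        finally show "proj k v = W - D" by (simp only: scaleR_half_double)
      qed
      have Dk: "D \<bullet> k = 0" unfolding D_def using k by simp
      have h1: "h (D + k) \<le> h (proj k u + k) + R * norm W"
      proof -
        have "h (D + k) \<le> h (proj k u + k) + h (- W)"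
          using moment_norm_add[OF K, of "proj k u + k" "- W"] unfolding h_def UV by (simp add: algebra_simps)
        then show ?thesis using rR(3)[of "- W"] by simp
      qed
      have h2: "h (- D - k) \<le> h (proj k v - k) + R * norm W"
      proof -
        have "h (- D - k) \<le> h (proj k v - k) + h (- W)"
          using moment_norm_add[OF K, of "proj k v - k" "- W"] unfolding h_def UV by (simp add: algebra_simps)
        then show ?thesis using rR(3)[of "- W"] by simp
      qed
      have h3: "hS (W + k) \<le> hS k + R' * norm W"
        using moment_norm_add[OF S, of W k] rR'(1)[of W] unfolding hS_def by simp
      have h4: "E \<zeta>0 \<le> (h (D + k) + h (- D - k)) / 2" using Emin[OF Dk] unfolding E_def .
      have "(R + R') * norm W \<le> C * norm W" unfolding C_def by simp
      also have "\<dots> \<le> C * \<delta>" using W C by (intro mult_left_mono) auto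
      finally have "(R + R') * norm W \<le> \<Delta> / 2" using \<delta>(2) by simp
      then have "hS (W + k) + \<Delta> / 2 \<le> (h (proj k u + k) + h (proj k v - k)) / 2"
      proof -
        have gen: "c + d / 2 \<le> (a1 + b1) / 2"
          if "x + y \<le> d / 2" "a0 \<le> a1 + x" "b0 \<le> b1 + x" "c \<le> c0 + y" "e \<le> (a0 + b0) / 2" "d = e - c0"
          for a0 a1 b0 b1 c c0 d e x y :: real
        proof -
          have "2 * (x + y) \<le> d" "2 * e \<le> a0 + b0" using that(1,5) by simp_all
          then have "2 * c + d \<le> a1 + b1" using that(2,3,4,6) by argo
          then show ?thesis by simp
        qed
        show ?thesis
          by (rule gen[OF _ h1 h2 h3 h4 \<Delta>_def]) (use \<open>(R + R') * norm W \<le> \<Delta> / 2\<close> in \<open>simp add: distrib_right\<close>)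
      qed
      then show ?thesis unfolding \<eta>_def mean \<gamma>eq W_def[symmetric] using True by simp
    next
      case False
      then show ?thesis using mid[of u v] unfolding \<eta>_def by simp
    qed
    have le: "ennreal (real ?n) * emeasure lborel P \<le> (\<integral>\<^sup>+y. ennreal ((1 / \<eta> y) ^ Suc (card ?J)) \<partial>?N)"
      by (rule borell_brascamp_lieb_harmonic[of ?J \<alpha> \<beta> \<eta>, OF _ _ _ _ pos(1,2) \<eta>pos \<eta>mid A1 A2]) auto
    have mono: "ennreal ((1 / \<eta> y) ^ Suc (card ?J)) \<le> ennreal ((1 / \<gamma> y) ^ Suc (card ?J))" for y
    proof -
      have "\<gamma> y \<le> \<eta> y" using \<Delta> unfolding \<eta>_def by simp
      then show ?thesis using pos(3)[of y] \<eta>pos[of y] by (intro ennreal_leI power_mono frac_le) auto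
    qed
    have strict: "\<not> ennreal ((1 / \<gamma> y) ^ Suc (card ?J)) \<le> ennreal ((1 / \<eta> y) ^ Suc (card ?J))" if "norm y < \<delta>" for y
    proof -
      have "\<gamma> y < \<eta> y" using \<Delta> that unfolding \<eta>_def by simp
      then have "1 / \<eta> y < 1 / \<gamma> y" using pos(3)[of y] by (intro divide_strict_left_mono) auto
      then have "(1 / \<eta> y) ^ Suc (card ?J) < (1 / \<gamma> y) ^ Suc (card ?J)" using \<eta>pos[of y] by (intro power_strict_mono) auto
      then show ?thesis using \<eta>pos[of y] by (simp add: ennreal_le_iff2 not_le del: power_Suc)
    qed
    have "(\<integral>\<^sup>+y. ennreal ((1 / \<eta> y) ^ Suc (card ?J)) \<partial>?N) < (\<integral>\<^sup>+y. ennreal ((1 / \<gamma> y) ^ Suc (card ?J)) \<partial>?N)"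
    proof (rule nn_integral_less)
      show "(\<lambda>y. ennreal ((1 / \<eta> y) ^ Suc (card ?J))) \<in> borel_measurable ?N" by measurable
      show "(\<lambda>y. ennreal ((1 / \<gamma> y) ^ Suc (card ?J))) \<in> borel_measurable ?N" by measurable
      have "(\<integral>\<^sup>+y. ennreal ((1 / \<eta> y) ^ Suc (card ?J)) \<partial>?N) \<le> ennreal (real ?n) * emeasure lborel Q"
        unfolding A3[symmetric] by (intro nn_integral_mono mono)
      also have "\<dots> < \<infinity>" using Qfin by (simp add: ennreal_mult_less_top)
      finally show "(\<integral>\<^sup>+y. ennreal ((1 / \<eta> y) ^ Suc (card ?J)) \<partial>?N) \<noteq> \<infinity>" by simp
      show "AE y in ?N. ennreal ((1 / \<eta> y) ^ Suc (card ?J)) \<le> ennreal ((1 / \<gamma> y) ^ Suc (card ?J))"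
        by (intro AE_I2 mono)
      show "\<not> (AE y in ?N. ennreal ((1 / \<gamma> y) ^ Suc (card ?J)) \<le> ennreal ((1 / \<eta> y) ^ Suc (card ?J)))"
      proof
        assume "AE y in ?N. ennreal ((1 / \<gamma> y) ^ Suc (card ?J)) \<le> ennreal ((1 / \<eta> y) ^ Suc (card ?J))"
        then have "AE y in ?N. \<delta> \<le> norm y" by (rule eventually_mono) (use strict not_le in blast)
        then show False using not_AE_coord_lborel_norm_ge[OF k \<delta>(1)] by simp
      qed
    qed
    also have "\<dots> \<le> ennreal (real ?n) * emeasure lborel P" unfolding A3 using QP by (intro mult_left_mono) auto
    finally show False using le by simp
  qed
qed

end

section \<open>Linear changes of variables\<close>

lemma linear_measurable:
  fixes f :: "'a::euclidean_space \<Rightarrow> 'b::euclidean_space"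
  assumes "linear f"
  shows "f \<in> borel_measurable borel"
  using assms by (intro borel_measurable_continuous_onI linear_continuous_on) (simp add: linear_conv_bounded_linear)

text \<open>The number \<open>c\<close> is the absolute value of the determinant of a linear \<open>f\<close>. In this form the property
  composes, and it is used directly as a change of variables.\<close>

definition scales_lborel :: "real \<Rightarrow> ('a::euclidean_space \<Rightarrow> 'a) \<Rightarrow> bool" where
  "scales_lborel c f \<longleftrightarrow> (\<forall>g :: 'a \<Rightarrow> ennreal. g \<in> borel_measurable borel \<longrightarrow>
     (\<integral>\<^sup>+x. g x \<partial>lborel) = ennreal c * (\<integral>\<^sup>+x. g (f x) \<partial>lborel))"

lemma scales_lborelD:
  "scales_lborel c f \<Longrightarrow> g \<in> borel_measurable borel \<Longrightarrow> (\<integral>\<^sup>+x. g x \<partial>lborel) = ennreal c * (\<integral>\<^sup>+x. (g (f x) :: ennreal) \<partial>lborel)"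
  by (simp add: scales_lborel_def)

lemma scales_lborel_compose:
  fixes f g :: "'a::euclidean_space \<Rightarrow> 'a"
  assumes f: "scales_lborel c f" "f \<in> borel_measurable borel" and g: "scales_lborel d g" and "0 \<le> c" "0 \<le> d"
  shows "scales_lborel (c * d) (f \<circ> g)"
  unfolding scales_lborel_def
proof (intro allI impI)
  fix h :: "'a \<Rightarrow> ennreal" assume [measurable]: "h \<in> borel_measurable borel"
  note [measurable] = f(2)
  have "(\<integral>\<^sup>+x. h x \<partial>lborel) = ennreal c * (\<integral>\<^sup>+x. h (f x) \<partial>lborel)" by (rule scales_lborelD[OF f(1)]) measurable
  also have "(\<integral>\<^sup>+x. h (f x) \<partial>lborel) = ennreal d * (\<integral>\<^sup>+x. h (f (g x)) \<partial>lborel)"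
    by (rule scales_lborelD[OF g]) measurable
  finally show "(\<integral>\<^sup>+x. h x \<partial>lborel) = ennreal (c * d) * (\<integral>\<^sup>+x. h ((f \<circ> g) x) \<partial>lborel)"
    using assms by (simp add: ennreal_mult mult.assoc)
qed

lemma scales_lborel_diagonal:
  fixes c :: "'a::euclidean_space \<Rightarrow> real"
  assumes "\<And>b. b \<in> Basis \<Longrightarrow> c b \<noteq> 0"
  shows "scales_lborel (\<Prod>b\<in>Basis. \<bar>c b\<bar>) (\<lambda>x. \<Sum>b\<in>Basis. (c b * (x \<bullet> b)) *\<^sub>R b)"
  unfolding scales_lborel_def
proof (intro allI impI)
  fix g :: "'a \<Rightarrow> ennreal" assume [measurable]: "g \<in> borel_measurable borel"
  define T where "T x = 0 + (\<Sum>b\<in>Basis. (c b * (x \<bullet> b)) *\<^sub>R b)" for x :: 'a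
  have [measurable]: "T \<in> borel_measurable borel" unfolding T_def[abs_def] by measurable
  have "(\<integral>\<^sup>+x. g x \<partial>lborel) = (\<integral>\<^sup>+x. g x \<partial>density (distr lborel borel T) (\<lambda>_. (\<Prod>b\<in>Basis. \<bar>c b\<bar>)))"
    using lborel_affine_euclidean[of c 0] assms unfolding T_def[abs_def] by simp
  also have "\<dots> = (\<integral>\<^sup>+x. ennreal (\<Prod>b\<in>Basis. \<bar>c b\<bar>) * g (T x) \<partial>lborel)"
    by (simp add: nn_integral_density nn_integral_distr)
  also have "\<dots> = ennreal (\<Prod>b\<in>Basis. \<bar>c b\<bar>) * (\<integral>\<^sup>+x. g (T x) \<partial>lborel)"
    by (rule nn_integral_cmult) measurable
  finally show "(\<integral>\<^sup>+x. g x \<partial>lborel) = ennreal (\<Prod>b\<in>Basis. \<bar>c b\<bar>) * (\<integral>\<^sup>+x. g (\<Sum>b\<in>Basis. (c b * (x \<bullet> b)) *\<^sub>R b) \<partial>lborel)"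
    by (simp add: T_def)
qed

lemma scales_lborel_shear:
  fixes j k :: "'a::euclidean_space"
  assumes k: "k \<in> Basis" and j: "j \<bullet> k = 0"
  shows "scales_lborel 1 (\<lambda>x. x + (x \<bullet> j) *\<^sub>R k)"
  unfolding scales_lborel_def
proof (intro allI impI)
  fix g :: "'a \<Rightarrow> ennreal" assume [measurable]: "g \<in> borel_measurable borel"
  have "(\<integral>\<^sup>+x. g (x + (x \<bullet> j) *\<^sub>R k) \<partial>lborel)
     = (\<integral>\<^sup>+y. (\<integral>\<^sup>+t. g ((y + t *\<^sub>R k) + ((y + t *\<^sub>R k) \<bullet> j) *\<^sub>R k) \<partial>lborel) \<partial>coord_lborel (Basis - {k}))"
    by (rule nn_integral_slices[OF k]) measurable
  also have "\<dots> = (\<integral>\<^sup>+y. (\<integral>\<^sup>+t. g (y + t *\<^sub>R k) \<partial>lborel) \<partial>coord_lborel (Basis - {k}))"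
  proof (rule nn_integral_cong)
    fix y
    have "(\<integral>\<^sup>+t. g (y + t *\<^sub>R k) \<partial>lborel) = (\<integral>\<^sup>+t. g (y + (y \<bullet> j + 1 * t) *\<^sub>R k) \<partial>lborel)"
      by (subst nn_integral_real_affine[where c=1 and t="y \<bullet> j"]) auto
    also have "\<dots> = (\<integral>\<^sup>+t. g ((y + t *\<^sub>R k) + ((y + t *\<^sub>R k) \<bullet> j) *\<^sub>R k) \<partial>lborel)"
      using j by (simp add: inner_add_left inner_commute[of k j] scaleR_left_distrib add_ac)
    finally show "(\<integral>\<^sup>+t. g ((y + t *\<^sub>R k) + ((y + t *\<^sub>R k) \<bullet> j) *\<^sub>R k) \<partial>lborel) = (\<integral>\<^sup>+t. g (y + t *\<^sub>R k) \<partial>lborel)" by simp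
  qed
  also have "\<dots> = (\<integral>\<^sup>+x. g x \<partial>lborel)" by (rule nn_integral_slices[OF k, symmetric]) measurable
  finally show "(\<integral>\<^sup>+x. g x \<partial>lborel) = ennreal 1 * (\<integral>\<^sup>+x. g (x + (x \<bullet> j) *\<^sub>R k) \<partial>lborel)" by simp
qed

lemma scales_lborel_permute:
  fixes \<pi> :: "'n::finite \<Rightarrow> 'n"
  assumes \<pi>: "bij \<pi>"
  shows "scales_lborel 1 (\<lambda>x :: real^'n. \<chi> i. x $ \<pi> i)"
proof -
  let ?f = "\<lambda>x :: real^'n. \<chi> i. x $ \<pi> i"
  have lin: "linear ?f" by (rule linearI) (simp_all add: vec_eq_iff)
  note [measurable] = linear_measurable[OF lin]
  have "lborel = distr lborel borel ?f"
  proof (rule lborel_eqI)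
    fix l u :: "real^'n" assume lu: "\<And>b. b \<in> Basis \<Longrightarrow> l \<bullet> b \<le> u \<bullet> b"
    let ?l = "\<chi> i. l $ inv \<pi> i" and ?u = "\<chi> i. u $ inv \<pi> i"
    have le: "l $ i \<le> u $ i" for i using lu[of "axis i 1"] by (simp add: inner_axis axis_in_Basis_iff)
    have "?f -` box l u = box ?l ?u"
    proof (rule set_eqI)
      fix x
      have "x \<in> ?f -` box l u \<longleftrightarrow> (\<forall>i. l $ i < x $ \<pi> i \<and> x $ \<pi> i < u $ i)" by (simp add: mem_box_cart)
      also have "\<dots> \<longleftrightarrow> (\<forall>j. l $ inv \<pi> j < x $ j \<and> x $ j < u $ inv \<pi> j)"
        using \<pi> by (metis bij_inv_eq_iff)
      finally show "x \<in> ?f -` box l u \<longleftrightarrow> x \<in> box ?l ?u" by (simp add: mem_box_cart)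
    qed
    then have "emeasure (distr lborel borel ?f) (box l u) = emeasure lborel (box ?l ?u)"
      by (subst emeasure_distr) auto
    also have "\<dots> = (\<Prod>b\<in>Basis. (?u - ?l) \<bullet> b)"
      using le by (intro emeasure_lborel_box) (auto simp: Basis_vec_def inner_axis)
    also have "(\<Prod>b\<in>Basis. (?u - ?l) \<bullet> b) = (\<Prod>i\<in>UNIV. (u - l) $ inv \<pi> i)"
      by (subst prod.reindex_bij_betw[of "\<lambda>i. axis i 1" UNIV Basis, symmetric])
         (auto simp: bij_betw_def inj_on_def axis_eq_axis Basis_vec_def inner_axis)
    also have "\<dots> = (\<Prod>i\<in>UNIV. (u - l) $ i)"
      using \<pi> by (intro prod.reindex_bij_betw) (simp add: bij_imp_bij_inv)
    also have "\<dots> = (\<Prod>b\<in>Basis. (u - l) \<bullet> b)"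
      by (subst prod.reindex_bij_betw[of "\<lambda>i. axis i 1" UNIV Basis, symmetric])
         (auto simp: bij_betw_def inj_on_def axis_eq_axis Basis_vec_def inner_axis)
    finally show "emeasure (distr lborel borel ?f) (box l u) = (\<Prod>b\<in>Basis. (u - l) \<bullet> b)" .
  qed simp
  then have eq: "distr lborel borel ?f = lborel" by (rule sym)
  have "(\<integral>\<^sup>+x. g x \<partial>lborel) = (\<integral>\<^sup>+x. g (?f x) \<partial>lborel)" if [measurable]: "g \<in> borel_measurable borel" for g :: "real^'n \<Rightarrow> ennreal"
    using nn_integral_distr[of ?f lborel borel g] unfolding eq by simp
  then show ?thesis unfolding scales_lborel_def by simp
qed

lemma Basis_sum_cart: "(\<Sum>b\<in>Basis. (c b * ((x::real^'n) \<bullet> b)) *\<^sub>R b) = (\<chi> i. c (axis i 1) * x $ i)"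
proof -
  have "(\<Sum>b\<in>Basis. (c b * (x \<bullet> b)) *\<^sub>R b) = (\<Sum>i\<in>UNIV. (c (axis i 1) * x $ i) *\<^sub>R axis i 1)"
    by (subst sum.reindex_bij_betw[of "\<lambda>i. axis i 1" UNIV Basis, symmetric])
       (auto simp: bij_betw_def inj_on_def axis_eq_axis Basis_vec_def inner_axis)
  also have "\<dots> = (\<chi> i. c (axis i 1) * x $ i)"
    by (simp add: vec_eq_iff axis_def if_distrib cong: if_cong)
  finally show ?thesis .
qed

text \<open>Induction over products of elementary maps. Diagonal maps and coordinate swaps are self-adjoint and
  the adjoint of a shear is a shear, so the adjoint of \<open>f\<close> has the same factor; no determinant is
  involved.\<close>

lemma linear_scales_lborel:
  fixes f :: "real^'n \<Rightarrow> real^'n"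
  assumes "linear f" "inj f"
  obtains c where "0 < c" "scales_lborel c f" "scales_lborel c (adjoint f)"
proof -
  have "inj f \<longrightarrow> (\<exists>c>0. scales_lborel c f \<and> scales_lborel c (adjoint f))"
    using assms(1)
  proof (rule induct_linear_elementary; (intro impI)?)
    fix f g :: "real^'n \<Rightarrow> real^'n"
    assume lin: "linear f" "linear g" and IH: "inj f \<longrightarrow> (\<exists>c>0. scales_lborel c f \<and> scales_lborel c (adjoint f))"
      "inj g \<longrightarrow> (\<exists>c>0. scales_lborel c g \<and> scales_lborel c (adjoint g))" and inj: "inj (f \<circ> g)"
    have g: "inj g" using inj by (rule inj_on_imageI2)
    then have "surj g" using linear_injective_imp_surjective[OF lin(2)] by simp
    have f: "inj f"
    proof (rule injI)
      fix x y assume "f x = f y"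
      moreover obtain u v where "x = g u" "y = g v" using \<open>surj g\<close> by (metis surjD)
      ultimately show "x = y" using injD[OF inj, of u v] by simp
    qed
    obtain c d where c: "0 < c" "scales_lborel c f" "scales_lborel c (adjoint f)"
      and d: "0 < d" "scales_lborel d g" "scales_lborel d (adjoint g)" using IH f g by blast
    have "adjoint (f \<circ> g) = adjoint g \<circ> adjoint f"
      by (rule adjoint_unique) (simp add: adjoint_works[OF lin(1)] adjoint_works[OF lin(2)] adjoint_clauses lin)
    then show "\<exists>c>0. scales_lborel c (f \<circ> g) \<and> scales_lborel c (adjoint (f \<circ> g))"
      using scales_lborel_compose[OF c(2) linear_measurable[OF lin(1)] d(2)]
        scales_lborel_compose[OF d(3) linear_measurable[OF adjoint_linear[OF lin(2)]] c(3)] c(1) d(1)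
      by (intro exI[of _ "c * d"]) (auto simp: mult.commute)
  next
    fix f :: "real^'n \<Rightarrow> real^'n" and i assume lin: "linear f" and z: "\<And>x. f x $ i = 0" and inj: "inj f"
    have "surj f" using linear_injective_imp_surjective[OF lin inj] by simp
    then obtain x where "f x = axis i 1" by (metis surjD)
    then show "\<exists>c>0. scales_lborel c f \<and> scales_lborel c (adjoint f)" using z[of x] by simp
  next
    fix c :: "'n \<Rightarrow> real" assume inj: "inj (\<lambda>x :: real^'n. \<chi> i. c i * x $ i)"
    define d where "d b = c (SOME i. b = axis i (1::real))" for b :: "real^'n"
    have d: "d (axis i 1) = c i" for i unfolding d_def by (simp add: axis_eq_axis)
    have nz: "c i \<noteq> 0" for i
    proof
      assume "c i = 0"
      then have "(\<chi> j. c j * (axis i 1 :: real^'n) $ j) = (\<chi> j. c j * (0 :: real^'n) $ j)" by (simp add: vec_eq_iff axis_def)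
      then have "(axis i 1 :: real^'n) = 0" using injD[OF inj, of "axis i 1" 0] by simp
      then show False by simp
    qed
    have "adjoint (\<lambda>x :: real^'n. \<chi> i. c i * x $ i) = (\<lambda>x. \<chi> i. c i * x $ i)"
      by (rule adjoint_unique) (simp add: inner_vec_def mult_ac)
    moreover have "scales_lborel (\<Prod>b\<in>(Basis :: (real^'n) set). \<bar>d b\<bar>) (\<lambda>x. \<chi> i. c i * x $ i)"
      using scales_lborel_diagonal[of d] nz unfolding Basis_sum_cart d by (force simp: Basis_vec_def d)
    moreover have "0 < (\<Prod>b\<in>(Basis :: (real^'n) set). \<bar>d b\<bar>)" by (intro prod_pos) (auto simp: Basis_vec_def d nz)
    ultimately show "\<exists>e>0. scales_lborel e (\<lambda>x. \<chi> i. c i * x $ i) \<and> scales_lborel e (adjoint (\<lambda>x. \<chi> i. c i * x $ i))" by metis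
  next
    fix m n :: 'n
    let ?\<pi> = "Transposition.transpose m n"
    have "adjoint (\<lambda>x :: real^'n. \<chi> i. x $ ?\<pi> i) = (\<lambda>x. \<chi> i. x $ ?\<pi> i)"
    proof (rule adjoint_unique, intro allI)
      fix x y :: "real^'n"
      have "(\<Sum>i\<in>UNIV. x $ ?\<pi> i * y $ i) = (\<Sum>i\<in>UNIV. x $ ?\<pi> (?\<pi> i) * y $ ?\<pi> i)"
        by (rule sum.reindex_bij_betw[symmetric]) simp
      then show "(\<chi> i. x $ ?\<pi> i) \<bullet> y = x \<bullet> (\<chi> i. y $ ?\<pi> i)" by (simp add: inner_vec_def)
    qed
    then show "\<exists>c>0. scales_lborel c (\<lambda>x :: real^'n. \<chi> i. x $ ?\<pi> i) \<and> scales_lborel c (adjoint (\<lambda>x :: real^'n. \<chi> i. x $ ?\<pi> i))"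
      using scales_lborel_permute[of ?\<pi>] by (intro exI[of _ 1]) simp
  next
    fix m n :: 'n assume mn: "m \<noteq> n"
    have sh: "(\<lambda>x :: real^'n. \<chi> i. if i = m then x $ m + x $ n else x $ i) = (\<lambda>x. x + (x \<bullet> axis n 1) *\<^sub>R axis m 1)" for m n
    proof
      fix x :: "real^'n"
      have "x \<bullet> axis n 1 = x $ n" by (simp add: inner_axis)
      then show "(\<chi> i. if i = m then x $ m + x $ n else x $ i) = x + (x \<bullet> axis n 1) *\<^sub>R axis m 1"
        by (simp add: vec_eq_iff axis_def)
    qed
    have s: "scales_lborel 1 (\<lambda>x :: real^'n. x + (x \<bullet> axis n 1) *\<^sub>R axis m 1)" if "m \<noteq> n" for m n
      using that by (intro scales_lborel_shear) (auto simp: axis_in_Basis_iff inner_axis_axis)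
    have "adjoint (\<lambda>x :: real^'n. x + (x \<bullet> axis n 1) *\<^sub>R axis m 1) = (\<lambda>x. x + (x \<bullet> axis m 1) *\<^sub>R axis n 1)"
      by (rule adjoint_unique) (simp add: inner_add_left inner_add_right inner_commute)
    then show "\<exists>c>0. scales_lborel c (\<lambda>x :: real^'n. \<chi> i. if i = m then x $ m + x $ n else x $ i) \<and> scales_lborel c (adjoint (\<lambda>x :: real^'n. \<chi> i. if i = m then x $ m + x $ n else x $ i))"
      unfolding sh using s[OF mn] s[OF mn[symmetric]] by (intro exI[of _ 1]) simp
  qed
  then show ?thesis using that assms(2) by blast
qed

lemma scales_lborel_scaleR:
  assumes "0 < d"
  shows "scales_lborel (d ^ DIM('a)) (\<lambda>x :: 'a::euclidean_space. d *\<^sub>R x)"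
  unfolding scales_lborel_def
proof (intro allI impI)
  fix g :: "'a \<Rightarrow> ennreal" assume "g \<in> borel_measurable borel"
  from coord_lborel_scale[OF finite_Basis this assms]
  show "(\<integral>\<^sup>+x. g x \<partial>lborel) = ennreal (d ^ DIM('a)) * (\<integral>\<^sup>+x. g (d *\<^sub>R x) \<partial>lborel)"
    unfolding coord_lborel_Basis .
qed

lemma compact_linear_image_self:
  fixes f :: "'a::euclidean_space \<Rightarrow> 'b::euclidean_space"
  assumes "linear f" "compact K"
  shows "compact (f ` K)"
  using assms by (intro compact_continuous_image linear_continuous_on) (simp_all add: linear_conv_bounded_linear)

lemma convex_body_linear_image:
  fixes f :: "'a::euclidean_space \<Rightarrow> 'a"
  assumes K: "K \<in> convex_bodies_o" and f: "linear f" "inj f"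
  shows "f ` K \<in> convex_bodies_o"
proof -
  note KD = convex_bodies_oD[OF K]
  have "compact (f ` K)" using KD(1) f(1) by (rule compact_linear_image_self[rotated])
  moreover have "convex (f ` K)" using KD(2) f(1) by (rule convex_linear_image[rotated])
  moreover have "interior (f ` K) = f ` interior K" by (rule interior_injective_linear_image[OF f])
  moreover have "0 \<in> f ` interior K" using KD(3) linear_0[OF f(1)] by (metis image_eqI)
  ultimately show ?thesis unfolding convex_bodies_o_def by simp
qed

lemma scales_lborel_indicator:
  fixes f :: "'a::euclidean_space \<Rightarrow> 'a"
  assumes f: "scales_lborel c f" "inj f" and K: "f ` K \<in> sets borel" and g: "g \<in> borel_measurable borel"
  shows "(\<integral>\<^sup>+x. indicator (f ` K) x * g x \<partial>lborel) = ennreal c * (\<integral>\<^sup>+x. indicator K x * (g (f x) :: ennreal) \<partial>lborel)"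
proof -
  have "(\<lambda>x. indicator (f ` K) x * g x) \<in> borel_measurable borel" using K g by measurable
  from scales_lborelD[OF f(1) this] show ?thesis
    using f(2) by (simp add: indicator_def inj_image_mem_iff)
qed

lemma vol_linear_image:
  fixes f :: "'a::euclidean_space \<Rightarrow> 'a"
  assumes f: "scales_lborel c f" "linear f" "inj f" and K: "compact K" and c: "0 < c"
  shows "vol (f ` K) = c * vol K"
proof -
  have cf: "compact (f ` K)" using K f(2) by (rule compact_linear_image_self[rotated])
  have b: "K \<in> sets borel" "f ` K \<in> sets borel" using K cf by (auto simp: borel_compact)
  have "emeasure lborel (f ` K) = ennreal c * emeasure lborel K"
    using scales_lborel_indicator[OF f(1,3) b(2), of "\<lambda>_. 1"] b by simp
  then show ?thesis using b c by (simp add: measure_completion measure_def enn2real_mult)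
qed

section \<open>Isotropic position and bodies with many reflections\<close>

text \<open>A maximal orthonormal set for \<open>B\<close> spans the space, since otherwise a Gram--Schmidt step would extend
  it.\<close>

lemma orthonormalizing_map_exists:
  fixes B :: "'a::euclidean_space \<Rightarrow> 'a \<Rightarrow> real"
  assumes lin: "\<And>x y z. B (x + y) z = B x z + B y z" "\<And>c x z. B (c *\<^sub>R x) z = c * B x z"
    and sym: "\<And>x y. B x y = B y x" and pos: "\<And>x. x \<noteq> 0 \<Longrightarrow> 0 < B x x"
  obtains f :: "'a \<Rightarrow> 'a" where "linear f" "inj f" "\<And>x. B (f x) (f x) = x \<bullet> x"
proof -
  have B0: "B 0 z = 0" for z using lin(2)[of 0 0 z] by simp
  have Bsum: "B (\<Sum>v\<in>S. a v *\<^sub>R v) z = (\<Sum>v\<in>S. a v * B v z)" if "finite S" for S :: "'a set" and a z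
    using that by (induction S rule: finite_induct) (auto simp: lin B0)
  define P where "P S \<longleftrightarrow> finite S \<and> (\<forall>u\<in>S. \<forall>v\<in>S. B u v = (if u = v then 1 else 0))" for S
  have indep: "independent S \<and> card S \<le> DIM('a)" if "P S" for S
  proof -
    have "independent S"
    proof (rule independent_if_scalars_zero)
      show "finite S" using that by (simp add: P_def)
      fix a u assume s: "(\<Sum>v\<in>S. a v *\<^sub>R v) = 0" and u: "u \<in> S"
      have "0 = B (\<Sum>v\<in>S. a v *\<^sub>R v) u" by (simp add: s B0)
      also have "\<dots> = (\<Sum>v\<in>S. a v * B v u)" using that by (intro Bsum) (simp add: P_def)
      also have "\<dots> = (\<Sum>v\<in>S. if v = u then a v else 0)" using that u by (intro sum.cong) (auto simp: P_def)
      also have "\<dots> = a u" using that u by (simp add: P_def)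
      finally show "a u = 0" by simp
    qed
    then show ?thesis using independent_bound by blast
  qed
  have "P {}" by (simp add: P_def)
  then obtain S where S: "P S" "\<And>T. P T \<Longrightarrow> card T \<le> card S"
  proof -
    have "\<forall>T. P T \<longrightarrow> card T < Suc DIM('a)" using indep by (auto simp: less_Suc_eq_le)
    from ex_has_greatest_nat[of P, OF \<open>P {}\<close> this] show ?thesis using that by blast
  qed
  have "span S = UNIV"
  proof (rule ccontr)
    assume "span S \<noteq> UNIV"
    then obtain x where x: "x \<notin> span S" by auto
    define y where "y = x - (\<Sum>v\<in>S. B x v *\<^sub>R v)"
    have "y \<noteq> 0"
    proof
      assume "y = 0"
      then have "x = (\<Sum>v\<in>S. B x v *\<^sub>R v)" by (simp add: y_def)
      moreover have "(\<Sum>v\<in>S. B x v *\<^sub>R v) \<in> span S" by (intro span_sum span_scale span_base)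
      ultimately show False using x by simp
    qed
    have yS: "B y u = 0" if "u \<in> S" for u
    proof -
      have "B x u = B y u + B (\<Sum>v\<in>S. B x v *\<^sub>R v) u" unfolding lin(1)[symmetric] by (simp add: y_def)
      also have "B (\<Sum>v\<in>S. B x v *\<^sub>R v) u = (\<Sum>v\<in>S. B x v * B v u)" using S(1) by (intro Bsum) (simp add: P_def)
      also have "\<dots> = (\<Sum>v\<in>S. if v = u then B x v else 0)" using S(1) that by (intro sum.cong) (auto simp: P_def)
      also have "\<dots> = B x u" using S(1) that by (simp add: P_def)
      finally show ?thesis by simp
    qed
    define w where "w = (1 / sqrt (B y y)) *\<^sub>R y"
    have by0: "0 < B y y" using pos[OF \<open>y \<noteq> 0\<close>] .
    have wS: "B w u = 0" "B u w = 0" if "u \<in> S" for u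
      using yS[OF that] sym[of u w] by (auto simp: w_def lin)
    have "B w w = (1 / sqrt (B y y)) * (1 / sqrt (B y y)) * B y y"
      unfolding w_def lin(2) sym[of y "_ *\<^sub>R y"] by simp
    then have ww: "B w w = 1" using by0 by (simp add: field_simps)
    have "w \<notin> S" using ww wS by force
    have "P (insert w S)" using S(1) ww wS \<open>w \<notin> S\<close> unfolding P_def by auto
    from S(2)[OF this] show False using S(1) \<open>w \<notin> S\<close> by (simp add: P_def)
  qed
  moreover have "independent S" using indep S(1) by blast
  ultimately have "card S = DIM('a)" using dim_span_eq_card_independent dim_UNIV by metis
  then obtain \<beta> where \<beta>: "bij_betw \<beta> (Basis :: 'a set) S"
    using S(1) finite_same_card_bij[of Basis S] by (auto simp: P_def)
  define f where "f x = (\<Sum>b\<in>Basis. (x \<bullet> b) *\<^sub>R \<beta> b)" for x :: 'a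
  have flin: "linear f" unfolding f_def
    by (rule linearI) (simp_all add: inner_add_left scaleR_left_distrib sum.distrib scaleR_sum_right)
  have Bf: "B (f x) z = (\<Sum>b\<in>Basis. (x \<bullet> b) * B (\<beta> b) z)" for x z
  proof -
    have "B (\<Sum>b\<in>F. (x \<bullet> b) *\<^sub>R \<beta> b) z = (\<Sum>b\<in>F. (x \<bullet> b) * B (\<beta> b) z)" if "finite F" for F
      using that by (induction F rule: finite_induct) (auto simp: lin B0)
    then show ?thesis unfolding f_def by simp
  qed
  have Bff: "B (f x) (f x) = x \<bullet> x" for x
  proof -
    have "B (\<beta> b) (f x) = x \<bullet> b" if "b \<in> Basis" for b
    proof -
      have "B (\<beta> b) (f x) = (\<Sum>c\<in>Basis. (x \<bullet> c) * B (\<beta> c) (\<beta> b))" by (subst sym) (rule Bf)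
      also have "\<dots> = (\<Sum>c\<in>Basis. if c = b then x \<bullet> c else 0)"
      proof (intro sum.cong refl)
        fix c :: 'a assume "c \<in> Basis"
        then have "\<beta> c \<in> S" "\<beta> b \<in> S" "\<beta> c = \<beta> b \<longleftrightarrow> c = b" using \<beta> that by (auto simp: bij_betw_def inj_on_def)
        then show "(x \<bullet> c) * B (\<beta> c) (\<beta> b) = (if c = b then x \<bullet> c else 0)" using S(1) by (simp add: P_def)
      qed
      also have "\<dots> = x \<bullet> b" using that by simp
      finally show ?thesis .
    qed
    then show ?thesis unfolding Bf by (subst euclidean_inner) simp
  qed
  have "inj f"
  proof (rule linear_injective_0[OF flin, THEN iffD2], intro allI impI)
    fix x assume "f x = 0"
    then show "x = 0" using Bff[of x] B0 by simp
  qed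
  then show ?thesis using that flin Bff by blast
qed

definition second_moment :: "'a::euclidean_space set \<Rightarrow> 'a \<Rightarrow> 'a \<Rightarrow> real" where
  "second_moment K u v = (LINT x:K|lebesgue. (u \<bullet> x) * (v \<bullet> x))"

lemma second_moment_eq_nn_integral:
  assumes "compact K"
  shows "ennreal (second_moment K u u) = (\<integral>\<^sup>+x. indicator K x * ennreal ((u \<bullet> x)\<^sup>2) \<partial>lborel)"
  unfolding second_moment_def power2_eq_square
  by (rule set_lebesgue_integral_eq_nn_integral(1)[OF assms]) (auto intro!: continuous_intros)

lemma second_moment_bilinear:
  assumes K: "compact K"
  shows "second_moment K (x + y) z = second_moment K x z + second_moment K y z"
    and "second_moment K (c *\<^sub>R x) z = c * second_moment K x z"
    and "second_moment K x y = second_moment K y x"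
proof -
  have i: "set_integrable lebesgue K (\<lambda>w. (u \<bullet> w) * (v \<bullet> w))" for u v :: 'a
  proof -
    have "set_integrable lborel K (\<lambda>w. (u \<bullet> w) * (v \<bullet> w))"
      unfolding set_integrable_def by (rule borel_integrable_compact[OF K]) (intro continuous_intros)
    moreover have [measurable]: "K \<in> sets borel" using K by (simp add: borel_compact)
    have "(\<lambda>x. indicat_real K x *\<^sub>R (u \<bullet> x * (v \<bullet> x))) \<in> borel_measurable lborel" by measurable
    ultimately show ?thesis unfolding set_integrable_def by (simp only: integrable_completion)
  qed
  show "second_moment K (x + y) z = second_moment K x z + second_moment K y z"
    unfolding second_moment_def inner_add_left distrib_right by (rule set_integral_add(2)[OF i i])
  show "second_moment K (c *\<^sub>R x) z = c * second_moment K x z"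
    unfolding second_moment_def by (simp add: mult.assoc)
  show "second_moment K x y = second_moment K y x"
    unfolding second_moment_def by (simp add: mult.commute)
qed

lemma second_moment_pos:
  fixes K :: "'a::euclidean_space set"
  assumes K: "K \<in> convex_bodies_o" and u: "u \<noteq> 0"
  shows "0 < second_moment K u u"
proof -
  note KD = convex_bodies_oD[OF K]
  have [measurable]: "K \<in> sets borel" using KD(1) by (simp add: borel_compact)
  have n: "0 \<le> second_moment K u u" unfolding second_moment_def set_lebesgue_integral_def
    by (intro integral_nonneg_AE) simp
  have "second_moment K u u \<noteq> 0"
  proof
    assume "second_moment K u u = 0"
    then have "(\<integral>\<^sup>+x. indicator K x * ennreal ((u \<bullet> x)\<^sup>2) \<partial>lborel) = 0" unfolding second_moment_eq_nn_integral[OF KD(1), symmetric] by simp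
    then have "AE x in lborel. indicator K x * ennreal ((u \<bullet> x)\<^sup>2) = 0" by (subst (asm) nn_integral_0_iff_AE) auto
    then have "AE x in lborel. x \<notin> interior K"
      using AE_lborel_inner_nonzero[OF u]
    proof eventually_elim
      case (elim x)
      then show ?case using interior_subset[of K] by (auto simp: indicator_def split: if_splits)
    qed
    then have "emeasure lborel (interior K) = 0" by (intro AE_iff_null_sets[THEN iffD2, THEN null_setsD1]) auto
    then show False using open_not_negligible[OF open_interior KD(8)]
      by (simp add: negligible_iff_null_sets null_sets_def emeasure_completion)
  qed
  then show ?thesis using n by simp
qed

lemma second_moment_linear_image:
  fixes f :: "'a::euclidean_space \<Rightarrow> 'a"
  assumes f: "scales_lborel c f" "linear f" "inj f" and K: "compact K" and c: "0 < c"
  shows "second_moment (f ` K) u u = c * second_moment K (adjoint f u) (adjoint f u)"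
proof -
  have cf: "compact (f ` K)" by (rule compact_linear_image_self[OF f(2) K])
  have b: "K \<in> sets borel" "f ` K \<in> sets borel" using K cf by (auto simp: borel_compact)
  have n: "0 \<le> second_moment A u u" for A and u :: 'a unfolding second_moment_def set_lebesgue_integral_def
    by (intro integral_nonneg_AE) simp
  have "ennreal (second_moment (f ` K) u u) = ennreal c * (\<integral>\<^sup>+x. indicator K x * ennreal ((u \<bullet> f x)\<^sup>2) \<partial>lborel)"
    unfolding second_moment_eq_nn_integral[OF cf] by (rule scales_lborel_indicator[OF f(1,3) b(2)]) measurable
  also have "\<dots> = ennreal (c * second_moment K (adjoint f u) (adjoint f u))"
    using c n unfolding ennreal_mult'[OF less_imp_le[OF c]] second_moment_eq_nn_integral[OF K] by (simp add: adjoint_clauses[OF f(2)])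
  finally show ?thesis using n c by simp
qed

lemma linear_inverse:
  fixes f :: "'a::euclidean_space \<Rightarrow> 'a"
  assumes f: "linear f" "inj f"
  shows "f (inv f x) = x" "inv f (f x) = x" "linear (inv f)" "inj (inv f)"
proof -
  have "surj f" using linear_injective_imp_surjective[OF f] by simp
  then show fi: "f (inv f x) = x" "inv f (f x) = x" for x using f(2) by (auto simp: surj_f_inv_f)
  show "inj (inv f)" using \<open>surj f\<close> by (rule surj_imp_inj_inv)
  show "linear (inv f)"
  proof (rule linearI)
    fix x y :: 'a and c :: real
    show "inv f (x + y) = inv f x + inv f y"
      using fi(2)[of "inv f x + inv f y"] by (simp add: linear_add[OF f(1)] fi(1))
    show "inv f (c *\<^sub>R x) = c *\<^sub>R inv f x"
      using fi(2)[of "c *\<^sub>R inv f x"] by (simp add: linear_scale[OF f(1)] fi(1))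
  qed
qed

lemma adjoint_inj:
  fixes f :: "'a::euclidean_space \<Rightarrow> 'a"
  assumes f: "linear f" "inj f"
  shows "inj (adjoint f)"
proof (rule linear_injective_0[OF adjoint_linear[OF f(1)], THEN iffD2], intro allI impI)
  fix x assume "adjoint f x = 0"
  then have "f (inv f x) \<bullet> x = 0" using adjoint_works[OF f(1), of "inv f x" x] by simp
  then show "x = 0" by (simp add: linear_inverse(1)[OF f])
qed

text \<open>The condition \<open>l \<bullet> e = 2\<close> makes \<open>x - (l \<bullet> x) *\<^sub>R e\<close> an involution, a possibly oblique reflection in the
  direction \<open>e\<close>. The property is invariant under linear maps, as symmetry with respect to orthogonal
  reflections is not.\<close>

definition reflection_rich :: "'a::euclidean_space set \<Rightarrow> bool" where
  "reflection_rich K \<longleftrightarrow> (\<forall>e. e \<noteq> 0 \<longrightarrow> (\<exists>l. l \<bullet> e = 2 \<and> (\<forall>x\<in>K. x - (l \<bullet> x) *\<^sub>R e \<in> K)))"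

lemma reflection_rich_linear_image:
  fixes f :: "'a::euclidean_space \<Rightarrow> 'a"
  assumes K: "reflection_rich K" and f: "linear f" "inj f"
  shows "reflection_rich (f ` K)"
  unfolding reflection_rich_def
proof (intro allI impI)
  fix e :: 'a assume e: "e \<noteq> 0"
  define g where "g = inv f"
  have fg: "f (g x) = x" "g (f x) = x" and g: "linear g" for x
    unfolding g_def by (rule linear_inverse[OF f])+
  have "g e \<noteq> 0" using e fg(1)[of e] linear_0[OF f(1)] by auto
  then obtain l where l: "l \<bullet> g e = 2" "\<And>x. x \<in> K \<Longrightarrow> x - (l \<bullet> x) *\<^sub>R g e \<in> K"
    using K unfolding reflection_rich_def by blast
  show "\<exists>l. l \<bullet> e = 2 \<and> (\<forall>x\<in>f ` K. x - (l \<bullet> x) *\<^sub>R e \<in> f ` K)"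
  proof (intro exI[of _ "adjoint g l"] conjI ballI)
    show "adjoint g l \<bullet> e = 2" using l(1) by (simp add: adjoint_clauses[OF g])
    fix y assume "y \<in> f ` K"
    then obtain x where x: "x \<in> K" "y = f x" by blast
    have "y - (adjoint g l \<bullet> y) *\<^sub>R e = f (x - (l \<bullet> x) *\<^sub>R g e)"
      unfolding x(2) by (simp add: adjoint_clauses[OF g] fg linear_diff[OF f(1)] linear_scale[OF f(1)])
    then show "y - (adjoint g l \<bullet> y) *\<^sub>R e \<in> f ` K" using l(2)[OF x(1)] by blast
  qed
qed

text \<open>A linear involution that preserves \<open>K\<close> preserves its volume and hence its second moment form. If this form is a
  multiple of the inner product, then the adjoint of the reflection is an isometry.\<close>

lemma isotropic_reflection_orthogonal:
  fixes K :: "(real^'n) set"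
  assumes K: "K \<in> convex_bodies_o" and iso: "\<And>u. second_moment K u u = c * (u \<bullet> u)" and c: "0 < c"
    and l: "l \<bullet> e = 2" "\<And>x. x \<in> K \<Longrightarrow> x - (l \<bullet> x) *\<^sub>R e \<in> K"
  shows "l = (2 / (e \<bullet> e)) *\<^sub>R e"
proof -
  note KD = convex_bodies_oD[OF K]
  define R where "R x = x - (l \<bullet> x) *\<^sub>R e" for x
  have lin: "linear R" unfolding R_def by (rule linearI) (auto simp: inner_add_right algebra_simps)
  have RR: "R (R x) = x" for x unfolding R_def using l(1) by (simp add: inner_diff_right algebra_simps flip: mult_2)
  have inj: "inj R" by (metis RR injI)
  have RK: "R ` K = K"
  proof
    show "R ` K \<subseteq> K" using l(2) unfolding R_def by blast
    show "K \<subseteq> R ` K"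
    proof
      fix x assume "x \<in> K"
      then have "R x \<in> K" using l(2) unfolding R_def by blast
      then show "x \<in> R ` K" using RR[of x] by (metis image_eqI)
    qed
  qed
  obtain d where d: "0 < d" "scales_lborel d R" by (rule linear_scales_lborel[OF lin inj])
  have volK: "0 < vol K"
  proof -
    have "\<not> negligible K" using open_not_negligible[OF open_interior KD(8)] negligible_subset interior_subset by blast
    then show ?thesis using KD(1) lmeasurable_compact negligible_iff_measure0 by (metis zero_less_measure_iff)
  qed
  have "vol K = d * vol K" using vol_linear_image[OF d(2) lin inj KD(1) d(1)] unfolding RK .
  then have "d = 1" using volK by simp
  have adj: "adjoint R e = e - (e \<bullet> e) *\<^sub>R l"
  proof -
    have "adjoint R = (\<lambda>u. u - (u \<bullet> e) *\<^sub>R l)"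
      by (rule adjoint_unique) (simp add: R_def inner_diff_left inner_diff_right inner_commute)
    then show ?thesis by simp
  qed
  have "second_moment K e e = second_moment K (adjoint R e) (adjoint R e)"
    using second_moment_linear_image[OF d(2) lin inj KD(1) d(1), of e] \<open>d = 1\<close> unfolding RK by simp
  then have "e \<bullet> e = (e - (e \<bullet> e) *\<^sub>R l) \<bullet> (e - (e \<bullet> e) *\<^sub>R l)" unfolding adj iso using c by simp
  also have "\<dots> = e \<bullet> e - 4 * (e \<bullet> e) + (e \<bullet> e)\<^sup>2 * (l \<bullet> l)"
    using l(1) by (simp add: inner_diff_left inner_diff_right inner_commute power2_eq_square algebra_simps)
  finally have "(e \<bullet> e) * ((e \<bullet> e) * (l \<bullet> l) - 4) = 0" by (simp add: power2_eq_square algebra_simps)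
  moreover have e0: "e \<bullet> e \<noteq> 0" using l(1) by auto
  ultimately have ll: "l \<bullet> l = 4 / (e \<bullet> e)" by (simp add: field_simps)
  have "(l - (2 / (e \<bullet> e)) *\<^sub>R e) \<bullet> (l - (2 / (e \<bullet> e)) *\<^sub>R e) = l \<bullet> l - 4 / (e \<bullet> e)"
    using l(1) e0 by (simp add: inner_diff_left inner_diff_right inner_commute field_simps)
  then show ?thesis using ll by simp
qed

text \<open>In isotropic position all the reflections are orthogonal. The one in the direction \<open>x - y\<close>
  exchanges \<open>x\<close> and \<open>y\<close> if these have the same norm, so the body is a union of spheres, and by convexity
  a ball.\<close>

lemma reflection_rich_ellipsoid:
  fixes K :: "(real^'n) set"
  assumes K: "K \<in> convex_bodies_o" and rich: "reflection_rich K"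
  shows "centered_ellipsoid K"
proof -
  note KD = convex_bodies_oD[OF K]
  obtain f :: "real^'n \<Rightarrow> real^'n" where f: "linear f" "inj f" "\<And>x. second_moment K (f x) (f x) = x \<bullet> x"
    using orthonormalizing_map_exists[of "second_moment K"] second_moment_bilinear[OF KD(1)] second_moment_pos[OF K] by blast
  obtain c where c: "0 < c" "scales_lborel c f" "scales_lborel c (adjoint f)" by (rule linear_scales_lborel[OF f(1,2)])
  define F where "F = adjoint f"
  have F: "linear F" unfolding F_def by (rule adjoint_linear[OF f(1)])
  have "inj F" unfolding F_def by (rule adjoint_inj[OF f(1,2)])
  have adjF: "adjoint F = f" unfolding F_def by (rule adjoint_adjoint[OF f(1)])
  define K' where "K' = F ` K"
  have K': "K' \<in> convex_bodies_o" unfolding K'_def by (rule convex_body_linear_image[OF K F \<open>inj F\<close>])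
  note KD' = convex_bodies_oD[OF K']
  have iso: "second_moment K' u u = c * (u \<bullet> u)" for u
    unfolding K'_def using second_moment_linear_image[OF c(3)[folded F_def] F \<open>inj F\<close> KD(1) c(1)] f(3) unfolding adjF by simp
  have rich': "reflection_rich K'" unfolding K'_def by (rule reflection_rich_linear_image[OF rich F \<open>inj F\<close>])
  have swap: "y \<in> K'" if x: "x \<in> K'" and n: "norm y = norm x" for x y
  proof (cases "x = y")
    case False
    define e where "e = x - y"
    have "e \<noteq> 0" using False by (simp add: e_def)
    then obtain l where l: "l \<bullet> e = 2" "\<And>x. x \<in> K' \<Longrightarrow> x - (l \<bullet> x) *\<^sub>R e \<in> K'" using rich' unfolding reflection_rich_def by blast
    have "l = (2 / (e \<bullet> e)) *\<^sub>R e" by (rule isotropic_reflection_orthogonal[OF K' iso c(1) l])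
    moreover have "e \<bullet> e = 2 * (e \<bullet> x)"
    proof -
      have "y \<bullet> y = x \<bullet> x" using n by (simp add: dot_square_norm)
      then show ?thesis unfolding e_def by (simp add: inner_diff_left inner_diff_right inner_commute)
    qed
    moreover from this have "e \<bullet> x \<noteq> 0" using \<open>e \<noteq> 0\<close> by (metis inner_eq_zero_iff mult_zero_right)
    ultimately have "l \<bullet> x = 1" by (simp add: inner_commute)
    then show ?thesis using l(2)[OF x] unfolding e_def by simp
  qed (use x in simp)
  \<comment> \<open>A point of maximal norm determines the radius.\<close>
  obtain x0 where x0: "x0 \<in> K'" "\<And>x. x \<in> K' \<Longrightarrow> norm x \<le> norm x0"
    using continuous_attains_sup[OF KD'(1,5), of norm] by (auto intro: continuous_intros)
  obtain r where r: "0 < r" "cball 0 r \<subseteq> K'" using KD'(3) mem_interior_cball by blast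
  have x0pos: "0 < norm x0"
  proof -
    have "r *\<^sub>R axis undefined 1 \<in> K'" using r by (intro subsetD[OF r(2)]) (simp add: norm_axis_1)
    from x0(2)[OF this] have "r \<le> norm x0" using r(1) by (simp add: norm_axis_1)
    with r(1) show ?thesis by (rule less_le_trans)
  qed
  have ball: "K' = cball 0 (norm x0)"
  proof
    show "K' \<subseteq> cball 0 (norm x0)" using x0(2) by auto
    show "cball 0 (norm x0) \<subseteq> K'"
    proof
      fix y :: "real^'n" assume y: "y \<in> cball 0 (norm x0)"
      show "y \<in> K'"
      proof (cases "y = 0")
        case False
        have "(norm x0 / norm y) *\<^sub>R y \<in> K'" using False by (intro swap[OF x0(1)]) simp
        then have "(1 - norm y / norm x0) *\<^sub>R 0 + (norm y / norm x0) *\<^sub>R ((norm x0 / norm y) *\<^sub>R y) \<in> K'"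
          using convexD_alt[OF KD'(2,4), of "(norm x0 / norm y) *\<^sub>R y" "norm y / norm x0"] y x0pos
          by (simp add: divide_le_eq)
        then show ?thesis using False x0pos by simp
      qed (use KD'(4) in simp)
    qed
  qed
  define g where "g x = norm x0 *\<^sub>R inv F x" for x
  note invF = linear_inverse(3,4)[OF F \<open>inj F\<close>]
  have g: "linear g" unfolding g_def by (intro linearI) (simp_all add: linear_add[OF invF(1)] linear_scale[OF invF(1)] scaleR_add_right)
  have "inj g" unfolding g_def using x0pos invF(2) by (auto simp: inj_def)
  then have "bij g" using linear_injective_imp_surjective[OF g] by (simp add: bij_def)
  moreover have "K = g ` cball 0 1"
  proof -
    have "K = inv F ` cball 0 (norm x0)" using ball \<open>inj F\<close> unfolding K'_def by (metis image_inv_f_f)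
    also have "cball 0 (norm x0) = (\<lambda>x. norm x0 *\<^sub>R x) ` cball (0 :: real^'n) 1"
      using x0pos cball_scale[of "norm x0" "0 :: real^'n" 1] by simp
    also have "inv F ` \<dots> = g ` cball 0 1" unfolding image_image g_def by (simp add: linear_scale[OF invF(1)])
    finally show ?thesis .
  qed
  ultimately show ?thesis using g unfolding centered_ellipsoid_def by blast
qed

section \<open>The Santalo product of a moment body\<close>

context moment_params
begin

definition santalo_product :: "'a::euclidean_space set \<Rightarrow> real" where
  "santalo_product K = vol K powr (real DIM('a) / p + 1) * vol (santalo_polar (moment_body K))"

lemma exponent_pos: "0 < real DIM('a::euclidean_space) / p + 1"
  using p by (intro add_nonneg_pos) auto

lemma vol_convex_body_pos:
  assumes K: "K \<in> convex_bodies_o"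
  shows "0 < vol K"
proof -
  note KD = convex_bodies_oD[OF K]
  have "\<not> negligible K" using open_not_negligible[OF open_interior KD(8)] negligible_subset interior_subset by blast
  then show ?thesis using KD(1) lmeasurable_compact negligible_iff_measure0 by (metis zero_less_measure_iff)
qed

lemma moment_norm_linear_image:
  fixes f :: "'a::euclidean_space \<Rightarrow> 'a"
  assumes f: "scales_lborel c f" "linear f" "inj f" and K: "compact K" and c: "0 < c"
  shows "moment_norm p a b (f ` K) u = c powr (1 / p) * moment_norm p a b K (adjoint f u)"
proof -
  have cf: "compact (f ` K)" by (rule compact_linear_image_self[OF f(2) K])
  have b: "K \<in> sets borel" "f ` K \<in> sets borel" using K cf by (auto simp: borel_compact)
  have "ennreal (moment p a b (f ` K) u) = ennreal c * (\<integral>\<^sup>+x. indicator K x * ennreal (askew a b (u \<bullet> f x) powr p) \<partial>lborel)"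
    unfolding moment_eq_nn_integral[OF cf] by (rule scales_lborel_indicator[OF f(1,3) b(2)]) measurable
  also have "\<dots> = ennreal (c * moment p a b K (adjoint f u))"
    unfolding ennreal_mult'[OF less_imp_le[OF c]] moment_eq_nn_integral[OF K] by (simp add: adjoint_clauses[OF f(2)])
  finally have "moment p a b (f ` K) u = c * moment p a b K (adjoint f u)"
    using c by (simp add: moment_nonneg)
  then show ?thesis unfolding moment_norm_def using c by (simp add: powr_mult moment_nonneg)
qed

text \<open>If \<open>f\<close> has determinant \<open>\<plusminus> c\<close>, then the moment norm acquires the factor \<open>c powr (1 / p)\<close> besides the
  adjoint substitution, and the volume of the polar body the factor \<open>c powr (- 1 - n / p)\<close>, which the
  power of the volume compensates. Only the transported base point is compared with the Santalo
  point; the reverse inequality is this one for the inverse map.\<close>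

lemma santalo_product_linear_le:
  fixes f :: "real^'n \<Rightarrow> real^'n"
  assumes K: "K \<in> convex_bodies_o" and f: "linear f" "inj f"
  shows "santalo_product (f ` K) \<le> santalo_product K"
proof -
  let ?n = "DIM(real^'n)"
  note KD = convex_bodies_oD[OF K]
  note fK = convex_body_linear_image[OF K f]
  obtain c where c: "0 < c" "scales_lborel c f" "scales_lborel c (adjoint f)" by (rule linear_scales_lborel[OF f])
  define d where "d = c powr (1 / p)"
  have d: "0 < d" unfolding d_def using c(1) by simp
  let ?F = "adjoint f"
  have F: "linear ?F" "inj ?F" using adjoint_linear[OF f(1)] adjoint_inj[OF f] by auto
  have norm_eq: "moment_norm p a b (f ` K) u = d * moment_norm p a b K (?F u)" for u
    unfolding d_def by (rule moment_norm_linear_image[OF c(2) f KD(1) c(1)])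
  define s where "s = santalo_point (moment_body K)"
  have s: "s \<in> interior (moment_body K)" unfolding s_def by (rule santalo_point(1)[OF moment_body(1)[OF K]])
  define x where "x = d *\<^sub>R f s"
  have inner: "u \<bullet> x = d * (?F u \<bullet> s)" for u unfolding x_def by (simp add: adjoint_clauses[OF f(1)])
  have x: "x \<in> interior (moment_body (f ` K))"
    unfolding interior_moment_body_iff[OF fK]
  proof (intro allI impI)
    fix u :: "real^'n" assume "u \<noteq> 0"
    then have "?F u \<noteq> 0" using injD[OF F(2), of u 0] linear_0[OF F(1)] by auto
    then have "?F u \<bullet> s < moment_norm p a b K (?F u)" using s unfolding interior_moment_body_iff[OF K] by blast
    then show "u \<bullet> x < moment_norm p a b (f ` K) u" unfolding inner norm_eq using d by simp
  qed
  define S where "S = {w. moment_norm p a b K w - s \<bullet> w \<le> 1}"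
  have S: "S \<in> sets borel" "emeasure lborel S = ennreal (vol (santalo_polar (moment_body K)))"
    unfolding S_def santalo_polar_def s_def[symmetric] using polar_wrt_moment_body[OF K s] by auto
  define S' where "S' = {u. moment_norm p a b (f ` K) u - x \<bullet> u \<le> 1}"
  have S': "S' \<in> sets borel" "emeasure lborel S' = ennreal (vol (polar_wrt (moment_body (f ` K)) x))"
    unfolding S'_def using polar_wrt_moment_body[OF fK x] by auto
  have sc: "scales_lborel (c * d ^ ?n) (?F \<circ> (\<lambda>u. d *\<^sub>R u))"
    by (rule scales_lborel_compose[OF c(3) linear_measurable[OF F(1)] scales_lborel_scaleR[OF d]]) (use c(1) d in auto)
  have "(\<lambda>u. indicator S ((?F \<circ> (\<lambda>u. d *\<^sub>R u)) u)) = (indicator S' :: _ \<Rightarrow> ennreal)"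
  proof
    fix u
    have "moment_norm p a b (f ` K) u - x \<bullet> u = moment_norm p a b K (d *\<^sub>R ?F u) - s \<bullet> (d *\<^sub>R ?F u)"
      using d inner[of u] unfolding norm_eq by (simp add: moment_norm_scale inner_commute[of x] inner_commute[of s])
    then show "indicator S ((?F \<circ> (\<lambda>u. d *\<^sub>R u)) u) = (indicator S' u :: ennreal)"
      unfolding S_def S'_def by (simp add: indicator_def linear_scale[OF F(1)])
  qed
  then have "emeasure lborel S = ennreal (c * d ^ ?n) * emeasure lborel S'"
    using scales_lborelD[OF sc borel_measurable_indicator[OF S(1)]] S(1) S'(1) by simp
  then have "vol (santalo_polar (moment_body K)) = c * d ^ ?n * vol (polar_wrt (moment_body (f ` K)) x)"
    unfolding S(2) S'(2) using c(1) d by (simp add: ennreal_mult[symmetric])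
  moreover have "vol (santalo_polar (moment_body (f ` K))) \<le> vol (polar_wrt (moment_body (f ` K)) x)"
    by (rule santalo_point(2)[OF moment_body(1)[OF fK] x])
  ultimately have le: "c * d ^ ?n * vol (santalo_polar (moment_body (f ` K))) \<le> vol (santalo_polar (moment_body K))"
    using c(1) d by simp
  have "c * d ^ ?n = c powr (real ?n / p + 1)"
    unfolding d_def using c(1) by (simp add: powr_power powr_add field_simps)
  moreover have "vol (f ` K) = c * vol K" by (rule vol_linear_image[OF c(2) f KD(1) c(1)])
  ultimately have "santalo_product (f ` K) = vol K powr (real ?n / p + 1) * (c * d ^ ?n * vol (santalo_polar (moment_body (f ` K))))"
    unfolding santalo_product_def using c(1) by (simp add: powr_mult mult_ac)
  also have "\<dots> \<le> santalo_product K" unfolding santalo_product_def using le by (intro mult_left_mono) auto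
  finally show ?thesis .
qed

lemma santalo_product_linear:
  fixes f :: "real^'n \<Rightarrow> real^'n"
  assumes K: "K \<in> convex_bodies_o" and f: "linear f" "inj f"
  shows "santalo_product (f ` K) = santalo_product K"
proof (rule antisym[OF santalo_product_linear_le[OF assms]])
  have "inv f ` (f ` K) = K" by (simp add: image_image linear_inverse(2)[OF f])
  then show "santalo_product K \<le> santalo_product (f ` K)"
    using santalo_product_linear_le[OF convex_body_linear_image[OF K f] linear_inverse(3,4)[OF f]] by simp
qed

lemma santalo_product_steiner:
  fixes K :: "'a::euclidean_space set"
  assumes k: "k \<in> Basis" and K: "K \<in> convex_bodies_o"
  shows "santalo_product K \<le> santalo_product (steiner k K)"
    and "santalo_product K = santalo_product (steiner k K) \<Longrightarrow> \<exists>\<zeta>. \<zeta> \<bullet> k = 0 \<and> (\<forall>x\<in>K. x - (2 * ((\<zeta> + k) \<bullet> x)) *\<^sub>R k \<in> K)"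
proof -
  show "santalo_product K \<le> santalo_product (steiner k K)"
    unfolding santalo_product_def vol_steiner[OF k K] using santalo_volume_steiner(1)[OF k K] by (intro mult_left_mono) auto
  assume "santalo_product K = santalo_product (steiner k K)"
  then have "vol (santalo_polar (moment_body K)) = vol (santalo_polar (moment_body (steiner k K)))"
    unfolding santalo_product_def vol_steiner[OF k K] using vol_convex_body_pos[OF K] by simp
  then show "\<exists>\<zeta>. \<zeta> \<bullet> k = 0 \<and> (\<forall>x\<in>K. x - (2 * ((\<zeta> + k) \<bullet> x)) *\<^sub>R k \<in> K)"
    by (rule santalo_volume_steiner(2)[OF k K])
qed

text \<open>Symmetrization in one coordinate direction after the other; by \<open>steiner_symmetric_other\<close> the
  reflections gained before are kept.\<close>

lemma unconditional_improvement:
  fixes K :: "'a::euclidean_space set"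
  assumes K: "K \<in> convex_bodies_o"
  shows "\<exists>K'\<in>(convex_bodies_o :: 'a set set). santalo_product K \<le> santalo_product K' \<and> (\<forall>j\<in>Basis. \<forall>x\<in>K'. refl_coord j x \<in> K')"
proof -
  have "finite F \<Longrightarrow> F \<subseteq> Basis \<Longrightarrow> \<exists>K'\<in>(convex_bodies_o :: 'a set set). santalo_product K \<le> santalo_product K' \<and> (\<forall>j\<in>F. \<forall>x\<in>K'. refl_coord j x \<in> K')" for F :: "'a set"
  proof (induction F rule: finite_induct)
    case empty
    then show ?case using K by blast
  next
    case (insert k F)
    then obtain K' where K': "K' \<in> convex_bodies_o" "santalo_product K \<le> santalo_product K'" "\<And>j x. j \<in> F \<Longrightarrow> x \<in> K' \<Longrightarrow> refl_coord j x \<in> K'"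
      by blast
    have k: "k \<in> Basis" using insert.prems by blast
    show ?case
    proof (intro bexI[of _ "steiner k K'"] conjI ballI)
      show "steiner k K' \<in> convex_bodies_o" by (rule steiner_convex_body[OF k K'(1)])
      show "santalo_product K \<le> santalo_product (steiner k K')" using K'(2) santalo_product_steiner(1)[OF k K'(1)] by simp
      fix j x assume j: "j \<in> insert k F" and x: "x \<in> steiner k K'"
      show "refl_coord j x \<in> steiner k K'"
      proof (cases "j = k")
        case True
        then show ?thesis using x steiner_symmetric[OF k] by blast
      next
        case False
        then have "j \<in> F" using j by blast
        then show ?thesis using K'(3) insert.prems False x by (intro steiner_symmetric_other[OF k]) auto
      qed
    qed
  qed
  from this[OF finite_Basis order_refl] show ?thesis .
qed

end

text \<open>Averaging a point where the maximum of \<open>k \<bullet> x\<close> is attained with its reflections removes the other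
  coordinates.\<close>

lemma unconditional_vertex:
  fixes K :: "'a::euclidean_space set"
  assumes K: "K \<in> convex_bodies_o" and refl: "\<And>j x. j \<in> Basis \<Longrightarrow> x \<in> K \<Longrightarrow> refl_coord j x \<in> K" and k: "k \<in> Basis"
  shows "support_fun K k *\<^sub>R k \<in> K"
proof -
  note KD = convex_bodies_oD[OF K]
  obtain y where y: "y \<in> K" "support_fun K k = k \<bullet> y" by (rule support_fun_attained[OF KD(1,5)])
  have "finite F \<Longrightarrow> F \<subseteq> Basis - {k} \<Longrightarrow> \<exists>x\<in>K. k \<bullet> x = k \<bullet> y \<and> (\<forall>j\<in>F. j \<bullet> x = 0)" for F
  proof (induction F rule: finite_induct)
    case empty
    then show ?case using y by blast
  next
    case (insert j F)
    then obtain x where x: "x \<in> K" "k \<bullet> x = k \<bullet> y" "\<And>i. i \<in> F \<Longrightarrow> i \<bullet> x = 0" by auto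
    have j: "j \<in> Basis" "j \<noteq> k" using insert.prems by auto
    have "(1/2) *\<^sub>R x + (1/2) *\<^sub>R refl_coord j x \<in> K"
      using convexD[OF KD(2) x(1) refl[OF j(1) x(1)], of "1/2" "1/2"] by simp
    moreover have "(1/2) *\<^sub>R x + (1/2) *\<^sub>R refl_coord j x = x - (x \<bullet> j) *\<^sub>R j"
    proof -
      have "(1/2) *\<^sub>R x + (1/2) *\<^sub>R refl_coord j x = (1/2) *\<^sub>R (x + x) - (x \<bullet> j) *\<^sub>R j"
        unfolding refl_coord_def scaleR_right_diff_distrib scaleR_right_distrib by simp
      then show ?thesis by (simp only: scaleR_half_double)
    qed
    ultimately have "x - (x \<bullet> j) *\<^sub>R j \<in> K" by simp
    moreover have "i \<bullet> (x - (x \<bullet> j) *\<^sub>R j) = i \<bullet> x" if "i \<in> Basis" "i \<noteq> j" for i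
      using that j by (simp add: inner_diff_right inner_not_same_Basis)
    moreover have "j \<bullet> (x - (x \<bullet> j) *\<^sub>R j) = 0" using j by (simp add: inner_diff_right inner_commute)
    moreover have "i \<bullet> (x - (x \<bullet> j) *\<^sub>R j) = 0" if i: "i \<in> insert j F" for i
    proof (cases "i = j")
      case False
      then have "i \<in> Basis" "i \<bullet> x = 0" using i insert.prems x(3) by auto
      then show ?thesis using calculation(2) False by metis
    qed (use calculation(3) in simp)
    moreover have "k \<bullet> (x - (x \<bullet> j) *\<^sub>R j) = k \<bullet> y" using calculation(2)[OF k] j(2) x(2) by simp
    ultimately show ?case by blast
  qed
  from this[of "Basis - {k}"] obtain x where x: "x \<in> K" "k \<bullet> x = k \<bullet> y" "\<And>j. j \<in> Basis - {k} \<Longrightarrow> j \<bullet> x = 0" by auto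
  have "x = (k \<bullet> y) *\<^sub>R k"
  proof (rule euclidean_eqI)
    fix i :: 'a assume "i \<in> Basis"
    then show "x \<bullet> i = ((k \<bullet> y) *\<^sub>R k) \<bullet> i"
      using x(2) x(3)[of i] k by (cases "i = k") (auto simp: inner_commute inner_not_same_Basis)
  qed
  then show ?thesis using x(1) y(2) by simp
qed

context moment_params
begin

text \<open>After scaling the axes, the body contains the vectors \<open>\<plusminus> k\<close> of the coordinate basis and lies in the cube
  \<open>\<bar>x \<bullet> k\<bar> \<le> 1\<close>. The cross-polytope contains the ball of radius \<open>1 / n\<close>, and the ball of radius \<open>n\<close>
  contains the cube. These radii are crude, but the same for all bodies.\<close>

lemma unconditional_position:
  fixes K :: "(real^'n) set"
  assumes K: "K \<in> convex_bodies_o" and refl: "\<And>j x. j \<in> Basis \<Longrightarrow> x \<in> K \<Longrightarrow> refl_coord j x \<in> K"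
  shows "\<exists>K'\<in>(convex_bodies_o :: (real^'n) set set). santalo_product K' = santalo_product K \<and> cball 0 (1 / real DIM(real^'n)) \<subseteq> K' \<and> K' \<subseteq> cball 0 (real DIM(real^'n))"
proof -
  let ?n = "real DIM(real^'n)"
  note KD = convex_bodies_oD[OF K]
  define r where "r k = support_fun K k" for k :: "real^'n"
  have r: "0 < r k" if "k \<in> Basis" for k
    using interior_iff_support_fun[OF K, of 0] KD(3) nonzero_Basis[OF that] unfolding r_def by simp
  have vertex: "r k *\<^sub>R k \<in> K" if "k \<in> Basis" for k unfolding r_def by (rule unconditional_vertex[OF K refl that])
  have axis_in: "(t * r k) *\<^sub>R k \<in> K" if k: "k \<in> Basis" and t: "\<bar>t\<bar> \<le> 1" for k t
  proof -
    have "refl_coord k (r k *\<^sub>R k) \<in> K" by (rule refl[OF k vertex[OF k]])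
    moreover have "refl_coord k (r k *\<^sub>R k) = - (r k *\<^sub>R k)"
      using refl_coord_slice[OF k, of 0 "r k"] by simp
    ultimately have neg: "- (r k *\<^sub>R k) \<in> K" by simp
    have "(1 - \<bar>t\<bar>) *\<^sub>R 0 + \<bar>t\<bar> *\<^sub>R z \<in> K" if "z \<in> K" for z
      using KD(2,4) that t unfolding convex_alt by auto
    from this[OF vertex[OF k]] this[OF neg] show ?thesis by (cases "0 \<le> t") auto
  qed
  define f where "f x = (\<Sum>k\<in>Basis. ((1 / r k) * (x \<bullet> k)) *\<^sub>R k)" for x :: "real^'n"
  have f: "linear f" unfolding f_def
    by (rule linearI) (simp_all add: inner_add_left distrib_left scaleR_left_distrib sum.distrib scaleR_sum_right mult.left_commute add_divide_distrib)
  have fk: "f x \<bullet> k = x \<bullet> k / r k" if "k \<in> Basis" for x k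
    unfolding f_def using that by (simp add: inner_sum_left inner_Basis if_distrib cong: if_cong)
  have "inj f"
  proof (rule injI)
    fix x y assume "f x = f y"
    show "x = y"
    proof (rule euclidean_eqI)
      fix b :: "real^'n" assume b: "b \<in> Basis"
      have "x \<bullet> b / r b = y \<bullet> b / r b" unfolding fk[OF b, symmetric] \<open>f x = f y\<close> ..
      then show "x \<bullet> b = y \<bullet> b" using r[OF b] by simp
    qed
  qed
  show ?thesis
  proof (intro bexI[of _ "f ` K"] conjI subsetI)
    show "f ` K \<in> convex_bodies_o" by (rule convex_body_linear_image[OF K f \<open>inj f\<close>])
    show "santalo_product (f ` K) = santalo_product K" by (rule santalo_product_linear[OF K f \<open>inj f\<close>])
    fix y assume "y \<in> f ` K"
    then obtain x where x: "x \<in> K" "y = f x" by blast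
    have "\<bar>y \<bullet> k\<bar> \<le> 1" if k: "k \<in> Basis" for k
    proof -
      have "k \<bullet> x \<le> r k" "k \<bullet> refl_coord k x \<le> r k"
        unfolding r_def using support_fun_upper[OF KD(1)] x(1) refl[OF k x(1)] by auto
      moreover have "k \<bullet> refl_coord k x = - (k \<bullet> x)" using k by (simp add: refl_coord_def inner_diff_right inner_commute)
      ultimately have "\<bar>x \<bullet> k\<bar> \<le> r k" by (simp add: inner_commute)
      then show ?thesis unfolding x(2) fk[OF k] using r[OF k] by (simp add: field_simps)
    qed
    then have "norm y \<le> (\<Sum>k\<in>(Basis :: (real^'n) set). 1)" by (intro order_trans[OF norm_le_l1] sum_mono) auto
    then show "y \<in> cball 0 ?n" by simp
  next
    fix y :: "real^'n" assume y: "y \<in> cball 0 (1 / ?n)"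
    define x where "x = (\<Sum>k\<in>Basis. (1 / ?n) *\<^sub>R (((?n * (y \<bullet> k)) * r k) *\<^sub>R k))"
    have "x \<in> K" unfolding x_def
    proof (rule convex_sum[OF _ KD(2)])
      fix k :: "real^'n" assume k: "k \<in> Basis"
      have "\<bar>y \<bullet> k\<bar> \<le> 1 / ?n" using Basis_le_norm[OF k, of y] y by simp
      then have "?n * \<bar>y \<bullet> k\<bar> \<le> 1" by (simp add: field_simps)
      then show "((?n * (y \<bullet> k)) * r k) *\<^sub>R k \<in> K" using k by (intro axis_in) (auto simp: abs_mult)
    qed auto
    moreover have "f x = y"
    proof (rule euclidean_eqI)
      fix k :: "real^'n" assume k: "k \<in> Basis"
      have "x \<bullet> k = (y \<bullet> k) * r k"
        unfolding x_def using k by (simp add: inner_sum_left inner_Basis if_distrib cong: if_cong)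
      then show "f x \<bullet> k = y \<bullet> k" using fk[OF k] r[OF k] by simp
    qed
    ultimately show "y \<in> f ` K" by blast
  qed
qed

lemma vol_mono: "compact K \<Longrightarrow> compact K' \<Longrightarrow> K \<subseteq> K' \<Longrightarrow> vol K \<le> vol K'"
  by (intro measure_mono_fmeasurable) (auto simp: lmeasurable_compact fmeasurableD)

text \<open>Continuity of the product, from the monotonicity of its two factors in opposite senses and from its
  linear invariance: the bodies \<open>K\<close> and \<open>M\<close> are compared with \<open>M\<close> shrunk by \<open>t\<close>.\<close>

lemma santalo_product_sandwich:
  fixes K M :: "(real^'n) set"
  assumes K: "K \<in> convex_bodies_o" and M: "M \<in> convex_bodies_o" and t: "0 < t"
    and KM: "K \<subseteq> (\<lambda>x. t *\<^sub>R x) ` M" and MK: "M \<subseteq> (\<lambda>x. t *\<^sub>R x) ` K"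
  shows "santalo_product K \<le> t powr (2 * real DIM(real^'n) * (real DIM(real^'n) / p + 1)) * santalo_product M"
proof -
  let ?n = "DIM(real^'n)" and ?A = "(\<lambda>x. (1 / t) *\<^sub>R x) ` M"
  define e where "e = real ?n / p + 1"
  have e: "0 < e" unfolding e_def by (rule exponent_pos)
  have lin: "linear (\<lambda>x :: real^'n. c *\<^sub>R x)" for c by (rule linearI) (simp_all add: scaleR_right_distrib)
  have inj: "inj (\<lambda>x :: real^'n. c *\<^sub>R x)" if "0 < c" for c using that by (auto simp: inj_def)
  note KD = convex_bodies_oD[OF K] and MD = convex_bodies_oD[OF M]
  have A: "?A \<in> convex_bodies_o" using t by (intro convex_body_linear_image M lin inj) simp
  note AD = convex_bodies_oD[OF A]
  have AK: "?A \<subseteq> K" using MK t by auto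
  have vs: "vol (santalo_polar (moment_body K)) \<le> vol (santalo_polar (moment_body ?A))"
    by (rule santalo_volume_antimono[OF moment_body(1)[OF A] moment_body(1)[OF K] moment_body_mono[OF AD(1) KD(1) AK]])
  have vt: "vol ((\<lambda>x. c *\<^sub>R x) ` M) = c ^ ?n * vol M" if "0 < c" for c
    by (rule vol_linear_image[OF scales_lborel_scaleR[OF that] lin inj[OF that] MD(1)]) (use that in simp)
  have "vol K \<le> t ^ ?n * vol M"
    using vol_mono[OF KD(1) compact_linear_image_self[OF lin MD(1)] KM] vt[OF t] by simp
  also have "\<dots> = t ^ (2 * ?n) * vol ?A"
    using vt[of "1 / t"] t by (simp add: power_one_over power_mult power2_eq_square power_mult_distrib field_simps)
  finally have "vol K powr e \<le> (t ^ (2 * ?n) * vol ?A) powr e" using e by (intro powr_mono2) auto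
  also have "\<dots> = t powr (2 * real ?n * e) * vol ?A powr e"
    using t by (simp add: powr_mult powr_powr flip: powr_realpow)
  finally have v: "vol K powr e \<le> t powr (2 * real ?n * e) * vol ?A powr e" .
  have "santalo_product K \<le> (t powr (2 * real ?n * e) * vol ?A powr e) * vol (santalo_polar (moment_body ?A))"
    unfolding santalo_product_def e_def[symmetric] by (intro mult_mono v vs) auto
  also have "\<dots> = t powr (2 * real ?n * e) * santalo_product ?A"
    unfolding santalo_product_def e_def[symmetric] by simp
  also have "santalo_product ?A = santalo_product M" using t by (intro santalo_product_linear M lin inj) simp
  finally show ?thesis unfolding e_def .
qed

end

section \<open>Maximizers\<close>

context moment_params
begin

text \<open>Support functions of bodies between the two balls are equibounded and equicontinuous, so for a
  maximizing sequence a subsequence converges uniformly on the unit sphere. The maximizer is cut out by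
  the limit function, and \<open>santalo_product_sandwich\<close> with factors tending to \<open>1\<close> passes to the limit.\<close>

lemma maximizer_between_balls:
  assumes r: "0 < r" "r \<le> R"
  shows "\<exists>M\<in>(convex_bodies_o :: (real^'n) set set). \<forall>K\<in>convex_bodies_o. cball (0 :: real^'n) r \<subseteq> K \<longrightarrow> K \<subseteq> cball 0 R \<longrightarrow> santalo_product K \<le> santalo_product M"
proof -
  let ?n = "DIM(real^'n)"
  define e where "e = real ?n / p + 1"
  have e: "0 < e" unfolding e_def by (rule exponent_pos)
  define U where "U = {K :: (real^'n) set. K \<in> convex_bodies_o \<and> cball 0 r \<subseteq> K \<and> K \<subseteq> cball 0 R}"
  have cb: "cball (0 :: real^'n) \<rho> \<in> convex_bodies_o" if "0 < \<rho>" for \<rho>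
    using that by (simp add: convex_bodies_o_def)
  have ne: "cball 0 r \<in> U" unfolding U_def using r cb by auto
  define C where "C = vol (cball (0 :: real^'n) R) powr e * vol (santalo_polar (moment_body (cball (0 :: real^'n) r)))"
  have bound: "santalo_product K \<le> C" if "K \<in> U" for K
  proof -
    have K: "K \<in> convex_bodies_o" "cball 0 r \<subseteq> K" "K \<subseteq> cball 0 R" using that unfolding U_def by auto
    note KD = convex_bodies_oD[OF K(1)]
    have "vol K powr e \<le> vol (cball (0 :: real^'n) R) powr e"
      using vol_mono[OF KD(1) compact_cball K(3)] e by (intro powr_mono2) auto
    moreover have "vol (santalo_polar (moment_body K)) \<le> vol (santalo_polar (moment_body (cball (0 :: real^'n) r)))"
      by (rule santalo_volume_antimono[OF moment_body(1)[OF cb[OF r(1)]] moment_body(1)[OF K(1)] moment_body_mono[OF compact_cball KD(1) K(2)]])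
    ultimately show ?thesis unfolding santalo_product_def C_def e_def[symmetric] by (intro mult_mono) auto
  qed
  have bdd: "bdd_above (santalo_product ` U)" using bound by (intro bdd_aboveI2)
  define S where "S = (SUP K\<in>U. santalo_product K)"
  have "\<exists>K\<in>U. S - 1 / real (Suc i) < santalo_product K" for i
    using less_cSUP_iff[of U santalo_product "S - 1 / real (Suc i)"] bdd ne unfolding S_def[symmetric] by auto
  then obtain X where X: "\<And>i. X i \<in> U" "\<And>i. S - 1 / real (Suc i) < santalo_product (X i)" by metis
  have XU: "X i \<in> convex_bodies_o" "cball 0 r \<subseteq> X i" "X i \<subseteq> cball 0 R" for i using X(1)[of i] unfolding U_def by auto
  note XD = convex_bodies_oD[OF XU(1)]
  define h where "h i = support_fun (X i)" for i
  have up: "h i u \<le> R * norm u" for i u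
    unfolding h_def
  proof (rule support_fun_least[OF XD(5)])
    fix y assume "y \<in> X i"
    then have "norm y \<le> R" using subsetD[OF XU(3)[of i], of y] by simp
    then have "norm u * norm y \<le> norm u * R" by (intro mult_left_mono) auto
    then show "u \<bullet> y \<le> R * norm u" using norm_cauchy_schwarz[of u y] by (simp add: mult.commute)
  qed
  have low: "r * norm u \<le> h i u" for i u
  proof (cases "u = 0")
    case False
    have "(r / norm u) *\<^sub>R u \<in> X i" using r False by (intro subsetD[OF XU(2)]) simp
    from support_fun_upper[OF XD(1) this, of u] show ?thesis
      using False unfolding h_def by (simp add: dot_square_norm power2_eq_square)
  qed (use support_fun_scale[OF XD(1,5), of 0 i 0] in \<open>simp add: h_def\<close>)
  have lip: "\<bar>h i u - h i v\<bar> \<le> R * norm (u - v)" for i u v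
  proof -
    have "h i u \<le> h i (u - v) + h i v" "h i v \<le> h i (v - u) + h i u"
      using support_fun_subadd[OF XD(1,5), of i "u - v" v] support_fun_subadd[OF XD(1,5), of i "v - u" u] unfolding h_def by auto
    then show ?thesis using up[of i "u - v"] up[of i "v - u"] by (simp add: norm_minus_commute abs_le_iff)
  qed
  have R: "0 < R" using r by simp
  obtain g k where g: "continuous_on (cball (0 :: real^'n) 1) g" "strict_mono (k :: nat \<Rightarrow> nat)"
      "\<And>\<epsilon>. 0 < \<epsilon> \<Longrightarrow> \<exists>N. \<forall>n x. n \<ge> N \<and> x \<in> cball 0 1 \<longrightarrow> norm (h (k n) x - g x) < \<epsilon>"
  proof (rule Arzela_Ascoli[of "cball (0 :: real^'n) 1" h R])
    fix i :: nat and x :: "real^'n" assume "x \<in> cball 0 1"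
    then have "R * norm x \<le> R * 1" using R by (intro mult_left_mono) auto
    moreover have "0 \<le> r * norm x" using r by simp
    ultimately show "norm (h i x) \<le> R" using up[of i x] low[of x i] by simp
  next
    fix x :: "real^'n" and \<epsilon> :: real assume "0 < \<epsilon>"
    show "\<exists>d>0. \<forall>n y. y \<in> cball 0 1 \<and> norm (x - y) < d \<longrightarrow> norm (h n x - h n y) < \<epsilon>"
    proof (intro exI[of _ "\<epsilon> / R"] conjI allI impI)
      show "0 < \<epsilon> / R" using \<open>0 < \<epsilon>\<close> R by simp
      fix n y assume "y \<in> cball 0 1 \<and> norm (x - y) < \<epsilon> / R"
      then have "R * norm (x - y) < \<epsilon>" using R by (simp add: field_simps)
      then show "norm (h n x - h n y) < \<epsilon>" using lip[of n x y] by simp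
    qed
  qed auto
  have gbound: "r \<le> g u" "g u \<le> R" if u: "u \<in> sphere 0 1" for u
  proof -
    have approx: "\<exists>n. \<bar>h (k n) u - g u\<bar> < \<epsilon>" if "0 < \<epsilon>" for \<epsilon>
    proof -
      obtain N where "\<forall>n x. n \<ge> N \<and> x \<in> cball 0 1 \<longrightarrow> norm (h (k n) x - g x) < \<epsilon>" using g(3)[OF \<open>0 < \<epsilon>\<close>] by blast
      then have "norm (h (k N) u - g u) < \<epsilon>" using u by auto
      then show ?thesis by (intro exI[of _ N]) simp
    qed
    have hb: "r \<le> h (k n) u" "h (k n) u \<le> R" for n using low[of u "k n"] up[of "k n" u] u by auto
    show "r \<le> g u"
    proof (rule field_le_epsilon)
      fix \<epsilon> :: real assume "0 < \<epsilon>"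
      then obtain n where "\<bar>h (k n) u - g u\<bar> < \<epsilon>" using approx by blast
      then show "r \<le> g u + \<epsilon>" using hb(1)[of n] by linarith
    qed
    show "g u \<le> R"
    proof (rule field_le_epsilon)
      fix \<epsilon> :: real assume "0 < \<epsilon>"
      then obtain n where "\<bar>h (k n) u - g u\<bar> < \<epsilon>" using approx by blast
      then show "g u \<le> R + \<epsilon>" using hb(2)[of n] by linarith
    qed
  qed
  \<comment> \<open>The values of \<open>g\<close> on the sphere yield both inclusions between \<open>M\<close> and dilates of the bodies
    in the subsequence.\<close>
  define M where "M = (\<Inter>u\<in>sphere 0 1. {x :: real^'n. u \<bullet> x \<le> g u})"
  have unit: "(1 / norm x) *\<^sub>R x \<in> sphere 0 1" if "x \<noteq> 0" for x :: "real^'n" using that by simp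
  have Mle: "u \<bullet> x \<le> norm u * g ((1 / norm u) *\<^sub>R u)" if "x \<in> M" "u \<noteq> 0" for u x
  proof -
    have "((1 / norm u) *\<^sub>R u) \<bullet> x \<le> g ((1 / norm u) *\<^sub>R u)" using that unit[OF that(2)] unfolding M_def by blast
    then have "norm u * (((1 / norm u) *\<^sub>R u) \<bullet> x) \<le> norm u * g ((1 / norm u) *\<^sub>R u)" by (intro mult_left_mono) auto
    then show ?thesis using that(2) by simp
  qed
  have M: "M \<in> convex_bodies_o"
  proof -
    have "closed M" unfolding M_def by (intro closed_INT ballI closed_halfspace_le)
    moreover have "norm x \<le> R" if "x \<in> M" for x
    proof (cases "x = 0")
      case False
      have "norm x * norm x \<le> norm x * g ((1 / norm x) *\<^sub>R x)" using Mle[OF that False] by (simp add: dot_square_norm power2_eq_square)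
      then show ?thesis using gbound(2)[OF unit[OF False]] False by simp
    qed (use R in simp)
    ultimately have "compact M" unfolding compact_eq_bounded_closed bounded_iff by blast
    moreover have "convex M" unfolding M_def by (intro convex_INT convex_halfspace_le)
    moreover have "ball 0 r \<subseteq> M"
    proof
      fix x :: "real^'n" assume "x \<in> ball 0 r"
      show "x \<in> M" unfolding M_def
      proof (intro INT_I CollectI)
        fix u :: "real^'n" assume u: "u \<in> sphere 0 1"
        have "u \<bullet> x \<le> norm u * norm x" by (rule norm_cauchy_schwarz)
        also have "\<dots> \<le> r" using u \<open>x \<in> ball 0 r\<close> by simp
        also have "\<dots> \<le> g u" by (rule gbound(1)[OF u])
        finally show "u \<bullet> x \<le> g u" .
      qed
    qed
    then have "0 \<in> interior M" using r(1) by (meson centre_in_ball interiorI open_ball)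
    ultimately show ?thesis unfolding convex_bodies_o_def by blast
  qed
  define q where "q = 2 * real ?n * e"
  have key: "S \<le> t powr q * santalo_product M" if t: "1 < t" for t
  proof -
    have "0 < (t - 1) * r" using t r by simp
    then obtain N where N: "\<And>n x. n \<ge> N \<Longrightarrow> x \<in> cball 0 1 \<Longrightarrow> norm (h (k n) x - g x) < (t - 1) * r" using g(3) by meson
    have bd: "S - 1 / real (Suc n) \<le> t powr q * santalo_product M" if n: "N \<le> n" for n
    proof -
      have near: "h (k n) u \<le> t * g u" "g u \<le> t * h (k n) u" if u: "u \<in> sphere 0 1" for u
      proof -
        have "\<bar>h (k n) u - g u\<bar> < (t - 1) * r" using N[OF n, of u] u by simp
        moreover have "(t - 1) * r \<le> (t - 1) * g u" "(t - 1) * r \<le> (t - 1) * h (k n) u"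
          using gbound(1)[OF u] low[of u "k n"] u t by (auto intro!: mult_left_mono)
        ultimately show "h (k n) u \<le> t * g u" "g u \<le> t * h (k n) u" by (auto simp: left_diff_distrib)
      qed
      have "santalo_product (X (k n)) \<le> t powr q * santalo_product M"
        unfolding q_def e_def
      proof (rule santalo_product_sandwich[OF XU(1) M])
        show "0 < t" using t by simp
        show "X (k n) \<subseteq> (\<lambda>x. t *\<^sub>R x) ` M"
        proof
          fix x assume x: "x \<in> X (k n)"
          have "(1 / t) *\<^sub>R x \<in> M" unfolding M_def
          proof (intro INT_I CollectI)
            fix u :: "real^'n" assume u: "u \<in> sphere 0 1"
            have "u \<bullet> x \<le> t * g u" using support_fun_upper[OF XD(1) x, of u] near(1)[OF u] unfolding h_def by simp
            then show "u \<bullet> ((1 / t) *\<^sub>R x) \<le> g u" using t by (simp add: divide_le_eq mult.commute)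
          qed
          then show "x \<in> (\<lambda>x. t *\<^sub>R x) ` M" using t by (intro image_eqI[of _ _ "(1 / t) *\<^sub>R x"]) auto
        qed
        show "M \<subseteq> (\<lambda>x. t *\<^sub>R x) ` X (k n)"
        proof
          fix x assume x: "x \<in> M"
          have "(1 / t) *\<^sub>R x \<in> X (k n)"
            unfolding mem_iff_support_fun[OF XD(1,2,5)]
          proof
            fix u
            show "u \<bullet> ((1 / t) *\<^sub>R x) \<le> support_fun (X (k n)) u"
            proof (cases "u = 0")
              case False
              have "u \<bullet> x \<le> norm u * g ((1 / norm u) *\<^sub>R u)" by (rule Mle[OF x False])
              also have "\<dots> \<le> norm u * (t * h (k n) ((1 / norm u) *\<^sub>R u))"
                using near(2)[OF unit[OF False]] by (intro mult_left_mono) auto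
              also have "\<dots> = t * h (k n) u"
                using False support_fun_scale[OF XD(1,5), of "1 / norm u" "k n" u] unfolding h_def by simp
              finally show ?thesis using t unfolding h_def by (simp add: divide_le_eq mult.commute)
            qed (use support_fun_scale[OF XD(1,5), of 0 "k n" 0] in simp)
          qed
          then show "x \<in> (\<lambda>x. t *\<^sub>R x) ` X (k n)" using t by (intro image_eqI[of _ _ "(1 / t) *\<^sub>R x"]) auto
        qed
      qed
      moreover have "1 / real (Suc (k n)) \<le> 1 / real (Suc n)"
        using seq_suble[OF g(2), of n] by (intro frac_le) auto
      ultimately show ?thesis using X(2)[of "k n"] by linarith
    qed
    have "(\<lambda>n. S - 1 / real (Suc n)) \<longlonglongrightarrow> S - 0"
      by (intro tendsto_diff tendsto_const LIMSEQ_Suc[OF lim_1_over_n])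
    then show ?thesis using bd by (intro LIMSEQ_le_const2[of _ S]) auto
  qed
  have "S \<le> santalo_product M"
  proof (rule LIMSEQ_le_const)
    have "(\<lambda>n. 1 + 1 / real (Suc n)) \<longlonglongrightarrow> 1 + 0"
      by (intro tendsto_add tendsto_const LIMSEQ_Suc[OF lim_1_over_n])
    then have "(\<lambda>n. (1 + 1 / real (Suc n)) powr q * santalo_product M) \<longlonglongrightarrow> (1 + 0) powr q * santalo_product M"
      by (intro tendsto_mult tendsto_powr tendsto_const) auto
    then show "(\<lambda>n. (1 + 1 / real (Suc n)) powr q * santalo_product M) \<longlonglongrightarrow> santalo_product M" by simp
    show "\<exists>N. \<forall>n\<ge>N. S \<le> (1 + 1 / real (Suc n)) powr q * santalo_product M" by (intro exI allI impI key) simp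
  qed
  moreover have "santalo_product K \<le> S" if "K \<in> U" for K unfolding S_def by (rule cSUP_upper[OF that bdd])
  ultimately show ?thesis using M unfolding U_def by (intro bexI[of _ M]) force+
qed

text \<open>Every body can be replaced by one between two fixed balls without lowering the product.\<close>

lemma maximizer_exists:
  "\<exists>M\<in>(convex_bodies_o :: (real^'n) set set). \<forall>K\<in>convex_bodies_o. santalo_product (K :: (real^'n) set) \<le> santalo_product M"
proof -
  let ?n = "real DIM(real^'n)"
  have n: "1 \<le> ?n" by (simp add: Suc_leI)
  have "0 < 1 / ?n" "1 / ?n \<le> ?n" using n by (auto intro: order_trans[of _ 1])
  from maximizer_between_balls[OF this, where 'n='n] obtain M :: "(real^'n) set" where M: "M \<in> convex_bodies_o"
    "\<And>K :: (real^'n) set. K \<in> convex_bodies_o \<Longrightarrow> cball 0 (1 / ?n) \<subseteq> K \<Longrightarrow> K \<subseteq> cball 0 ?n \<Longrightarrow> santalo_product K \<le> santalo_product M" by blast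
  have "santalo_product K \<le> santalo_product M" if K: "K \<in> convex_bodies_o" for K :: "(real^'n) set"
  proof -
    obtain K' :: "(real^'n) set" where K': "K' \<in> convex_bodies_o" "santalo_product K \<le> santalo_product K'" "\<And>j x. j \<in> Basis \<Longrightarrow> x \<in> K' \<Longrightarrow> refl_coord j x \<in> K'"
      using unconditional_improvement[OF K] by blast
    obtain K'' :: "(real^'n) set" where "K'' \<in> convex_bodies_o" "santalo_product K'' = santalo_product K'" "cball 0 (1 / ?n) \<subseteq> K''" "K'' \<subseteq> cball 0 ?n"
      using unconditional_position[OF K'(1,3)] by blast
    then show ?thesis using M(2)[of K''] K'(2) by simp
  qed
  then show ?thesis using M(1) by blast
qed

text \<open>A rotation turns \<open>e\<close> into a multiple of a coordinate direction \<open>k\<close>. Symmetrization in the direction \<open>k\<close> cannot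
  increase the product any further, so the equality case of \<open>santalo_product_steiner\<close> provides a reflection,
  which is carried back by the rotation.\<close>

lemma maximizer_ellipsoid:
  fixes K :: "(real^'n) set"
  assumes K: "K \<in> convex_bodies_o" and max: "\<And>K' :: (real^'n) set. K' \<in> convex_bodies_o \<Longrightarrow> santalo_product K' \<le> santalo_product K"
  shows "centered_ellipsoid K"
proof (rule reflection_rich_ellipsoid[OF K], unfold reflection_rich_def, intro allI impI)
  fix e :: "real^'n" assume e: "e \<noteq> 0"
  obtain k :: "real^'n" where k: "k \<in> Basis" using nonempty_Basis by blast
  have "norm e = norm (norm e *\<^sub>R k)" using k by simp
  then obtain f where "orthogonal_transformation f" and fe: "f e = norm e *\<^sub>R k" by (rule orthogonal_transformation_exists)
  then have f: "linear f" "inj f" by (auto simp: orthogonal_transformation_linear orthogonal_transformation_inj)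
  note fK = convex_body_linear_image[OF K f]
  have "santalo_product (f ` K) = santalo_product (steiner k (f ` K))"
    using santalo_product_steiner(1)[OF k fK] max[OF steiner_convex_body[OF k fK]] santalo_product_linear[OF K f] by linarith
  then obtain \<zeta> where \<zeta>: "\<zeta> \<bullet> k = 0" "\<And>x. x \<in> f ` K \<Longrightarrow> x - (2 * ((\<zeta> + k) \<bullet> x)) *\<^sub>R k \<in> f ` K"
    using santalo_product_steiner(2)[OF k fK] by blast
  have ke: "k = (1 / norm e) *\<^sub>R f e" unfolding fe using e by simp
  define l where "l = (2 / norm e) *\<^sub>R adjoint f (\<zeta> + k)"
  have l: "l \<bullet> x = (2 / norm e) * ((\<zeta> + k) \<bullet> f x)" for x unfolding l_def by (simp add: adjoint_clauses[OF f(1)])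
  show "\<exists>l. l \<bullet> e = 2 \<and> (\<forall>x\<in>K. x - (l \<bullet> x) *\<^sub>R e \<in> K)"
  proof (intro exI[of _ l] conjI ballI)
    show "l \<bullet> e = 2" unfolding l fe using e k \<zeta>(1) by (simp add: inner_add_left)
    fix x assume x: "x \<in> K"
    have "f x - (2 * ((\<zeta> + k) \<bullet> f x)) *\<^sub>R k = f x - (l \<bullet> x) *\<^sub>R f e"
      unfolding l fe using e by simp
    also have "\<dots> = f (x - (l \<bullet> x) *\<^sub>R e)" by (simp add: linear_diff[OF f(1)] linear_scale[OF f(1)])
    finally have "f (x - (l \<bullet> x) *\<^sub>R e) \<in> f ` K" using \<zeta>(2)[of "f x"] x by auto
    then show "x - (l \<bullet> x) *\<^sub>R e \<in> K" using f(2) by (simp add: inj_image_mem_iff)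
  qed
qed

theorem santalo_product_inequality:
  fixes K :: "(real^'n) set"
  assumes K: "K \<in> convex_bodies_o"
  shows "santalo_product K \<le> santalo_product (cball (0 :: real^'n) 1)"
    and "santalo_product K = santalo_product (cball (0 :: real^'n) 1) \<longleftrightarrow> centered_ellipsoid K"
proof -
  have B: "cball (0 :: real^'n) 1 \<in> convex_bodies_o" by (simp add: convex_bodies_o_def)
  have ell: "santalo_product E = santalo_product (cball (0 :: real^'n) 1)" if "centered_ellipsoid E" for E :: "(real^'n) set"
    using that santalo_product_linear[OF B] unfolding centered_ellipsoid_def bij_def by blast
  obtain M :: "(real^'n) set" where M: "M \<in> convex_bodies_o" "\<And>K :: (real^'n) set. K \<in> convex_bodies_o \<Longrightarrow> santalo_product K \<le> santalo_product M"
    using maximizer_exists by blast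
  have MB: "santalo_product M = santalo_product (cball (0 :: real^'n) 1)" by (rule ell[OF maximizer_ellipsoid[OF M]])
  show "santalo_product K \<le> santalo_product (cball (0 :: real^'n) 1)" using M(2)[OF K] MB by simp
  show "santalo_product K = santalo_product (cball (0 :: real^'n) 1) \<longleftrightarrow> centered_ellipsoid K"
  proof
    assume "santalo_product K = santalo_product (cball (0 :: real^'n) 1)"
    then show "centered_ellipsoid K" using M(2) MB by (intro maximizer_ellipsoid[OF K]) simp
  qed (rule ell)
qed

end

theorem mainTheorem3:
  fixes p c1 c2 :: real and K :: "(real ^ 'n) set"
  assumes "CARD('n) \<ge> 3"
    and "1 < p"
    and "c1 \<ge> 0" and "c2 \<ge> 0" and "\<not> (c1 = 0 \<and> c2 = 0)"
    and "K \<in> convex_bodies_o"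
  shows "vol K powr (real CARD('n) / p + 1) * vol (santalo_polar (Psi p c1 c2 K))
           \<le> vol (cball (0 :: real ^ 'n) 1) powr (real CARD('n) / p + 1)
              * vol (santalo_polar (Psi p c1 c2 (cball (0 :: real ^ 'n) 1)))
       \<and> (vol K powr (real CARD('n) / p + 1) * vol (santalo_polar (Psi p c1 c2 K))
           = vol (cball (0 :: real ^ 'n) 1) powr (real CARD('n) / p + 1)
              * vol (santalo_polar (Psi p c1 c2 (cball (0 :: real ^ 'n) 1)))
          \<longleftrightarrow> centered_ellipsoid K)"
proof -
  obtain a b where ab: "moment_params p a b"
    and Psi: "\<And>K :: (real^'n) set. K \<in> convex_bodies_o \<Longrightarrow> Psi p c1 c2 K = moment_params.moment_body p a b K"
    using Psi_eq_moment_body[OF assms(2-5), where 'a="real^'n"] by metis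
  interpret moment_params p a b by (rule ab)
  have B: "cball (0 :: real^'n) 1 \<in> convex_bodies_o" by (simp add: convex_bodies_o_def)
  show ?thesis
    using santalo_product_inequality[OF assms(6)]
    unfolding Psi[OF assms(6)] Psi[OF B] santalo_product_def by simp
qed

end
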